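(* Let $r$ and $k$ be integers. Let $m$ be an integer and let $m^* \in \{m, m+1\}$ be such that $m^* \equiv 1 \pmod 2$. Let $G$ be a connected $r$-regular graph of order $n$. Suppose that $$\lambda_3(G) < \begin{cases} \rho_1(r, m-1) & \text{if } m \text{ is odd},\\ \rho_2(r, m-1) & \text{if } m \text{ is even}.\end{cases}$$ If one of the following conditions holds, then $G$ has a $k$-factor: (i) $r$ is odd, $k$ is even, and $k \leq r\left(1 - \frac{1}{m^*}\right)$; (ii) both $r$ and $k$ are odd, and $\frac{r}{m^*} \leq k$.
   Context: All graphs are finite and simple. $\lambda_1(X) \geq \lambda_2(X) \geq \lambda_3(X) \geq \cdots$ denote the eigenvalues of the adjacency matrix of a graph $X$. For integers $r$ and $t$: $\rho_1(r,t)$ denotes the minimum of $\lambda_1(H)$ over all connected irregular (not regular) graphs $H$ of order $n'$ with $n' \not\equiv r \pmod 2$, maximum degree $r$, and size $e'$ satisfying $2e' \geq rn' - t$; $\rho_2(r,t)$ denotes the minimum of $\lambda_1(H)$ over all connected irregular graphs $H$ of order $n'$ with $n' \equiv r \pmod 2$, maximum degree $r$, and size $e'$ satisfying $2e' \geq rn' - t$. A $k$-factor of $G$ is a spanning subgraph $F$ with $d_F(x) = k$ for all vertices $x$.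
   Formalization: The formal theorem adds 0 ≤ k ≤ r and m ≥ 0: as written, (ii) allows k > r (e.g. K_4, r=m=3, k=5) and (i) allows negative k, where no k-factor can exist; for m < 0 the minima ρ_1, ρ_2 range over an empty family and are undefined. *)

theory Defs
  imports
    Complex_Main
    "HOL-Computational_Algebra.Polynomial"
    "HOL-Library.Multiset"
    "HOL-Combinatorics.List_Permutation"
    "Jordan_Normal_Form.Matrix"
    "Jordan_Normal_Form.Char_Poly"
begin

subsection \<open>Finite simple graphs\<close>

text \<open>A graph is a pair of a vertex set and a set of edges, an edge being the set of its two ends.\<close>

type_synonym 'a ugraph = "'a set \<times> 'a set set"

abbreviation verts :: "'a ugraph \<Rightarrow> 'a set" where "verts X \<equiv> fst X"
abbreviation edges :: "'a ugraph \<Rightarrow> 'a set set" where "edges X \<equiv> snd X"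

definition simple_graph :: "'a ugraph \<Rightarrow> bool" where
  "simple_graph X \<longleftrightarrow> finite (verts X) \<and> (\<forall>e\<in>edges X. e \<subseteq> verts X \<and> card e = 2)"

definition graph_order :: "'a ugraph \<Rightarrow> nat" where
  "graph_order X = card (verts X)"

definition graph_size :: "'a ugraph \<Rightarrow> nat" where
  "graph_size X = card (edges X)"

definition vdegree :: "'a ugraph \<Rightarrow> 'a \<Rightarrow> nat" where
  "vdegree X v = card {e \<in> edges X. v \<in> e}"

definition max_degree :: "'a ugraph \<Rightarrow> nat" where
  "max_degree X = Max (vdegree X ` verts X)"

definition regular_graph :: "nat \<Rightarrow> 'a ugraph \<Rightarrow> bool" where
  "regular_graph d X \<longleftrightarrow> (\<forall>v\<in>verts X. vdegree X v = d)"

definition irregular_graph :: "'a ugraph \<Rightarrow> bool" where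
  "irregular_graph X \<longleftrightarrow> \<not> (\<exists>d. regular_graph d X)"

definition connected_graph :: "'a ugraph \<Rightarrow> bool" where
  "connected_graph X \<longleftrightarrow> verts X \<noteq> {} \<and>
     (\<forall>u\<in>verts X. \<forall>v\<in>verts X. (u, v) \<in> {(x, y). {x, y} \<in> edges X}\<^sup>*)"

definition is_factor :: "nat \<Rightarrow> 'a ugraph \<Rightarrow> 'a ugraph \<Rightarrow> bool" where
  "is_factor k X F \<longleftrightarrow> simple_graph F \<and> verts F = verts X \<and> edges F \<subseteq> edges X \<and> regular_graph k F"

subsection \<open>Adjacency eigenvalues\<close>

text \<open>The adjacency matrix with respect to a list \<open>vs\<close> that enumerates the vertices without repetition.\<close>

definition adj_matrix :: "'a list \<Rightarrow> 'a ugraph \<Rightarrow> real mat" where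
  "adj_matrix vs X = mat (length vs) (length vs)
     (\<lambda>(i, j). if {vs ! i, vs ! j} \<in> edges X then 1 else 0)"

definition vertex_list :: "'a ugraph \<Rightarrow> 'a list" where
  "vertex_list X = (SOME vs. distinct vs \<and> set vs = verts X)"

text \<open>The choice of the enumeration is immaterial, see \<open>adj_char_poly_eq\<close> below.\<close>

definition adj_char_poly :: "'a ugraph \<Rightarrow> real poly" where
  "adj_char_poly X = char_poly (adj_matrix (vertex_list X) X)"

text \<open>All eigenvalues with multiplicity, in non-increasing order. The adjacency matrix is real
  symmetric, so its characteristic polynomial has only real roots and none is missed.\<close>

definition graph_eigenvalues :: "'a ugraph \<Rightarrow> real list" where
  "graph_eigenvalues X = rev (sorted_list_of_multiset (proots (adj_char_poly X)))"

text \<open>The \<open>i\<close>-th largest eigenvalue, counting from 1; it is only meaningful for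
  \<open>1 \<le> i \<le> graph_order X\<close>.\<close>

definition graph_lambda :: "nat \<Rightarrow> 'a ugraph \<Rightarrow> real" where
  "graph_lambda i X = graph_eigenvalues X ! (i - 1)"

lemma adj_matrix_similar:
  assumes "distinct vs" "distinct ws" "set vs = set ws"
  shows "similar_mat (adj_matrix vs X) (adj_matrix ws X)"
proof -
  have "mset vs = mset ws" using assms by (metis set_eq_iff_mset_eq_distinct)
  then obtain p where p: "p permutes {..<length ws}" and vs: "permute_list p ws = vs"
    by (rule mset_eq_permutation)
  define n where "n = length ws"
  have p': "p permutes {..<n}" using p n_def by simp
  have len: "length vs = n" using vs n_def by auto
  have nth: "vs ! i = ws ! p i" if "i < n" for i
    using vs that p' n_def permute_list_nth[of p ws i] by auto
  have pl: "p i < n" if "i < n" for i using permutes_in_image[OF p'] that by auto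
  have inj: "p i = p j \<longleftrightarrow> i = j" for i j using permutes_inj[OF p'] by (auto dest: injD)
  have ifm: "(if a then 1 else 0) * y = (if a then y else 0)"
    "y * (if a then 1 else 0) = (if a then y else 0)" for a and y :: real by auto
  define P :: "real mat" where "P = mat n n (\<lambda>(i, j). if j = p i then 1 else 0)"
  define Q :: "real mat" where "Q = mat n n (\<lambda>(i, j). if i = p j then 1 else 0)"
  let ?A = "adj_matrix vs X" and ?B = "adj_matrix ws X"
  have A: "?A \<in> carrier_mat n n" and B: "?B \<in> carrier_mat n n"
    by (auto simp: adj_matrix_def len n_def)
  have PQc: "P \<in> carrier_mat n n" "Q \<in> carrier_mat n n" by (auto simp: P_def Q_def)
  have PQ: "P * Q = 1\<^sub>m n"
  proof (rule eq_matI)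
    fix i j assume "i < dim_row (1\<^sub>m n)" "j < dim_col (1\<^sub>m n)"
    then have ij: "i < n" "j < n" by auto
    have "(P * Q) $$ (i, j) = (\<Sum>l = 0..<n. (if l = p i then if l = p j then 1 else 0 else 0))"
      using ij by (simp add: P_def Q_def scalar_prod_def ifm)
    also have "\<dots> = 1\<^sub>m n $$ (i, j)" using ij pl by (simp add: inj)
    finally show "(P * Q) $$ (i, j) = 1\<^sub>m n $$ (i, j)" .
  qed (use PQc in auto)
  have QP: "Q * P = 1\<^sub>m n" using mat_mult_left_right_inverse[OF PQc PQ] .
  have PB: "P * ?B = ?A * P"
  proof (rule eq_matI)
    fix i j assume "i < dim_row (?A * P)" "j < dim_col (?A * P)"
    then have ij: "i < n" "j < n" using A PQc by auto
    obtain j' where j': "j = p j'" "j' < n"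
      using ij permutes_image[OF p'] by (metis imageE lessThan_iff)
    have "(P * ?B) $$ (i, j) = (\<Sum>l = 0..<n. (if l = p i then ?B $$ (l, j) else 0))"
      using ij B by (simp add: P_def scalar_prod_def ifm)
    also have "\<dots> = ?B $$ (p i, j)" using ij pl by simp
    also have "\<dots> = ?A $$ (i, j')"
      using ij j' pl by (simp add: adj_matrix_def len n_def[symmetric] nth)
    also have "\<dots> = (\<Sum>l = 0..<n. (if l = j' then ?A $$ (i, l) else 0))" using j' by simp
    also have "\<dots> = (?A * P) $$ (i, j)"
      using ij A j' by (simp add: P_def scalar_prod_def inj ifm)
    finally show "(P * ?B) $$ (i, j) = (?A * P) $$ (i, j)" .
  qed (use A B PQc in auto)
  have "?A = ?A * (P * Q)" using A PQ by simp
  also have "\<dots> = P * ?B * Q" using A PQc PB by (simp add: assoc_mult_mat[of _ n n _ n _ n])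
  finally have "similar_mat_wit ?A ?B P Q"
    using A B PQc PQ QP by (intro similar_mat_witI) auto
  then show ?thesis by (auto simp: similar_mat_def)
qed

lemma adj_char_poly_eq:
  assumes "distinct vs" "set vs = verts X"
  shows "adj_char_poly X = char_poly (adj_matrix vs X)"
proof -
  have "distinct (vertex_list X) \<and> set (vertex_list X) = verts X"
    unfolding vertex_list_def by (rule someI[of _ vs]) (use assms in auto)
  then show ?thesis
    unfolding adj_char_poly_def using assms by (intro char_poly_similar adj_matrix_similar) auto
qed

subsection \<open>The minimum spectral radii\<close>

text \<open>Every finite graph is isomorphic to one whose vertices are natural numbers, so \<open>H\<close>
  ranges over those. \<open>LEAST\<close> denotes the minimum of the set of all \<open>\<lambda>\<^sub>1(H)\<close>; it is unspecified
  when there is no such \<open>H\<close>.\<close>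

definition irregular_class :: "nat \<Rightarrow> int \<Rightarrow> nat ugraph \<Rightarrow> bool" where
  "irregular_class r t H \<longleftrightarrow> simple_graph H \<and> connected_graph H \<and> irregular_graph H \<and>
     max_degree H = r \<and> 2 * int (graph_size H) \<ge> int r * int (graph_order H) - t"

definition rho1 :: "nat \<Rightarrow> int \<Rightarrow> real" where
  "rho1 r t = (LEAST x. \<exists>H. irregular_class r t H \<and> graph_order H mod 2 \<noteq> r mod 2 \<and>
     x = graph_lambda 1 H)"

definition rho2 :: "nat \<Rightarrow> int \<Rightarrow> real" where
  "rho2 r t = (LEAST x. \<exists>H. irregular_class r t H \<and> graph_order H mod 2 = r mod 2 \<and>
     x = graph_lambda 1 H)"

end

theory Submission
  imports Defs "Jordan_Normal_Form.Jordan_Normal_Form_Existence"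
    "Jordan_Normal_Form.Jordan_Normal_Form_Uniqueness"
begin

text \<open>Passing to the complement of a factor in \<open>G\<close> exchanges \<open>k\<close> and \<open>r - k\<close>, so let \<open>k\<close> be even. If there
  is no \<open>k\<close>-factor, Tutte's 1-factor theorem, applied to a gadget graph, yields disjoint sets \<open>S\<close>, \<open>T\<close>
  and components of \<open>G - (S \<union> T)\<close> that send an odd number of edges to \<open>T\<close>. Let \<open>a\<close> and \<open>b\<close> be the
  numbers of edges from a component to \<open>S\<close> and \<open>T\<close>. Counting the edges at \<open>S\<close> and \<open>T\<close> shows that the
  sum of \<open>r - k a - (r - k) b\<close> over the components is at least \<open>2 r\<close>. As \<open>b \<ge> 1\<close>, every summand is less
  than \<open>r\<close>, so at least three are positive; for these \<open>a = 0\<close> and \<open>(r - k) b < r\<close>, whence \<open>b < m\<^sup>*\<close>.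
  By interlacing \<open>\<lambda>\<^sub>3(G)\<close> is at least the smallest of the three spectral radii.

  Each such component has odd order at least \<open>r + 2\<close> and lies in the class that defines
  \<open>\<rho>\<^sub>2(r, m - 1)\<close>, which settles even \<open>m\<close>. For odd \<open>m\<close> the parity of the order does not fit the class that
  defines \<open>\<rho>\<^sub>1(r, m - 1)\<close>. There the complete graph on \<open>r + 1\<close> vertices minus a matching of \<open>j\<close> edges, where
  \<open>2 j + 1 = min m r\<close>, has spectral radius at most \<open>r - (2 j - 1) / (r + 2)\<close>, while the components have
  average degree at least that.\<close>

subsection \<open>Tutte's 1-factor theorem\<close>

text \<open>An arbitrary barrier of the gadget graph could contain some ports or cores of a vertex
  but not the others, and then describes no pair \<open>S\<close>, \<open>T\<close>. A violating set
  of least size cures this: each of its elements is adjacent to at least three odd components,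
  whereas the surviving neighbours of a port or core lie in at most two components once an element
  of the same kind at the same vertex survives. So ports and cores are removed all or none.

  Evenness of \<open>k\<close> matters because a vertex gadget has \<open>r + (r - k)\<close>
  elements: whole gadgets then do not affect parity, and only the edges to \<open>T\<close> decide
  whether a component is odd.

  The minima \<open>rho1\<close> and \<open>rho2\<close> range over infinitely many graphs, so a
  spectral radius bounds them only if the minimum is attained. If some member has spectral radius
  \<open>x < r\<close>, then members with radius at most \<open>x\<close> have bounded order, as
  their average degree is at least \<open>r - t / n'\<close>. Hence strict inequality
  \<open>< r\<close> must be proved for every graph that is compared with these minima.

  The comparison graph for odd \<open>m\<close> must keep a vertex of degree \<open>r\<close>
  outside the matching, which is why \<open>r\<close> enters \<open>min m r\<close>.\<close>

lemma hall:
  assumes "finite I" "\<And>i. i \<in> I \<Longrightarrow> finite (A i)"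
    and "\<And>J. J \<subseteq> I \<Longrightarrow> card J \<le> card (\<Union>i\<in>J. A i)"
  shows "\<exists>f. inj_on f I \<and> (\<forall>i\<in>I. f i \<in> A i)"
  using assms
proof (induct "card I" arbitrary: I A rule: less_induct)
  case less
  have fin: "finite (\<Union>i\<in>J. A i)" if "J \<subseteq> I" for J
    using that less.prems(1,2) finite_subset by blast
  \<comment> \<open>Halmos-Vaughan split. A tight subfamily \<open>J\<close> is matched inside its
    own union, and tightness preserves Hall's condition for the rest outside that union. Without a
    tight subfamily every proper nonempty one has a spare element, so any single \<open>a\<close>
    may be given away.\<close>
  show ?case
  proof (cases "\<exists>J. J \<subset> I \<and> J \<noteq> {} \<and> card J = card (\<Union>i\<in>J. A i)")
    case True
    then obtain J where J: "J \<subset> I" "J \<noteq> {}" "card J = card (\<Union>i\<in>J. A i)" by blast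
    let ?U = "\<Union>i\<in>J. A i"
    have finJ: "finite J" using J less.prems(1) finite_subset by blast
    have "card J < card I" using psubset_card_mono[OF less.prems(1) J(1)] .
    then obtain f where f: "inj_on f J" "\<forall>i\<in>J. f i \<in> A i"
      using less.hyps[of J A] J finJ less.prems by blast
    have "\<exists>g. inj_on g (I - J) \<and> (\<forall>i\<in>I - J. g i \<in> A i - ?U)"
    proof (rule less.hyps)
      show "card (I - J) < card I"
        using J less.prems(1) by (intro psubset_card_mono) auto
      fix K assume K: "K \<subseteq> I - J"
      then have finK: "finite K" using less.prems(1) finite_subset by blast
      have "card K + card J = card (K \<union> J)"
        using K finK finJ by (intro card_Un_disjoint[symmetric]) auto
      also have "\<dots> \<le> card (\<Union>i\<in>K \<union> J. A i)" using K J by (intro less.prems) auto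
      also have "(\<Union>i\<in>K \<union> J. A i) = (\<Union>i\<in>K. A i - ?U) \<union> ?U" by auto
      also have "card \<dots> = card (\<Union>i\<in>K. A i - ?U) + card ?U"
        using K J fin[of "K"] fin[of J] by (intro card_Un_disjoint) (auto intro: finite_subset)
      finally show "card K \<le> card (\<Union>i\<in>K. A i - ?U)" using J(3) by simp
    qed (use less.prems in auto)
    then obtain g where g: "inj_on g (I - J)" "\<forall>i\<in>I - J. g i \<in> A i - ?U" by blast
    let ?h = "\<lambda>i. if i \<in> J then f i else g i"
    have "inj_on ?h I"
    proof (rule inj_onI)
      fix i j assume "i \<in> I" "j \<in> I" "?h i = ?h j"
      have "f x \<noteq> g y" if "x \<in> J" "y \<in> I - J" for x y using f(2) g(2) that by auto
      with \<open>i \<in> I\<close> \<open>j \<in> I\<close> \<open>?h i = ?h j\<close> have "i \<in> J \<longleftrightarrow> j \<in> J" by (metis DiffI)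
      then show "i = j" using \<open>i \<in> I\<close> \<open>j \<in> I\<close> \<open>?h i = ?h j\<close> inj_onD[OF f(1)] inj_onD[OF g(1)]
        by (cases "i \<in> J") auto
    qed
    moreover have "\<forall>i\<in>I. ?h i \<in> A i" using f g by auto
    ultimately show ?thesis by blast
  next
    case no_tight: False
    show ?thesis
    proof (cases "I = {}")
      case True then show ?thesis by auto
    next
      case ne: False
      then obtain i where i: "i \<in> I" by auto
      have "card {i} \<le> card (A i)" using less.prems(3)[of "{i}"] i by simp
      then obtain a where a: "a \<in> A i" by fastforce
      have "\<exists>g. inj_on g (I - {i}) \<and> (\<forall>j\<in>I - {i}. g j \<in> A j - {a})"
      proof (rule less.hyps)
        show "card (I - {i}) < card I" using i less.prems(1) by (intro psubset_card_mono) auto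
        fix K assume K: "K \<subseteq> I - {i}"
        show "card K \<le> card (\<Union>j\<in>K. A j - {a})"
        proof (cases "K = {}")
          case False
          have "K \<subset> I" using K i by auto
          then have "card K < card (\<Union>j\<in>K. A j)"
            using less.prems(3)[of K] no_tight False by (metis le_neq_implies_less psubset_imp_subset)
          moreover have "(\<Union>j\<in>K. A j - {a}) = (\<Union>j\<in>K. A j) - {a}" by auto
          moreover have "card (\<Union>j\<in>K. A j) - 1 \<le> card ((\<Union>j\<in>K. A j) - {a})"
            by (metis card_Diff_singleton_if diff_le_self order_refl)
          ultimately show ?thesis by simp
        qed simp
      qed (use less.prems in auto)
      then obtain g where g: "inj_on g (I - {i})" "\<forall>j\<in>I - {i}. g j \<in> A j - {a}" by blast
      have "inj_on (g(i := a)) I"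
      proof (rule inj_onI)
        fix j k assume "j \<in> I" "k \<in> I" "(g(i := a)) j = (g(i := a)) k"
        then show "j = k" using g by (auto split: if_splits dest: inj_onD)
      qed
      moreover have "\<forall>j\<in>I. (g(i := a)) j \<in> A j" using g a by auto
      ultimately show ?thesis by blast
    qed
  qed
qed

lemma same_parity_gap: "(even a \<longleftrightarrow> even b) \<Longrightarrow> b < a \<Longrightarrow> b + 2 \<le> a" for a b :: nat
  by presburger

section \<open>Components, parity and barriers\<close>

locale sym_graph =
  fixes E :: "'b \<Rightarrow> 'b \<Rightarrow> bool"
  assumes sym: "E x y \<Longrightarrow> E y x"
begin

definition closed_in :: "'b set \<Rightarrow> 'b set \<Rightarrow> bool" where
  "closed_in W C \<longleftrightarrow> C \<subseteq> W \<and> (\<forall>x\<in>C. \<forall>y\<in>W - C. \<not> E x y)"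

text \<open>Connectedness by cuts instead of paths: components become the minimal nonempty closed
  sets. The same form is used for \<open>thin\<close>, and is turned into paths only in
  \<open>connected_graphI\<close>.\<close>

definition conn :: "'b set \<Rightarrow> bool" where
  "conn C \<longleftrightarrow> C \<noteq> {} \<and> (\<forall>D. D \<noteq> {} \<longrightarrow> closed_in C D \<longrightarrow> D = C)"

definition comps :: "'b set \<Rightarrow> 'b set set" where
  "comps W = {C. closed_in W C \<and> conn C}"

definition odd_comps :: "'b set \<Rightarrow> 'b set set" where
  "odd_comps W = {C \<in> comps W. odd (card C)}"

definition perfect_matching :: "'b set \<Rightarrow> ('b \<Rightarrow> 'b) \<Rightarrow> bool" where
  "perfect_matching V p \<longleftrightarrow> (\<forall>v\<in>V. p v \<in> V \<and> p v \<noteq> v \<and> p (p v) = v \<and> E v (p v))"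

lemma closed_in_trans: "closed_in W C \<Longrightarrow> closed_in C D \<Longrightarrow> closed_in W D"
  unfolding closed_in_def by blast

lemma closed_in_Diff: "closed_in W C \<Longrightarrow> closed_in W (W - C)"
  unfolding closed_in_def using sym by blast

lemma comps_subset: "C \<in> comps W \<Longrightarrow> C \<subseteq> W"
  and comps_nonempty: "C \<in> comps W \<Longrightarrow> C \<noteq> {}"
  unfolding comps_def closed_in_def conn_def by auto

lemma comps_eq_if_meet:
  assumes "C \<in> comps W" "D \<in> comps W" "C \<inter> D \<noteq> {}"
  shows "C = D"
proof -
  have "closed_in C (C \<inter> D)" "closed_in D (C \<inter> D)"
    using assms(1,2) unfolding comps_def closed_in_def by blast+
  moreover have "conn C" "conn D" using assms(1,2) unfolding comps_def by auto
  ultimately have "C \<inter> D = C" "C \<inter> D = D" using assms(3) unfolding conn_def by auto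
  then show ?thesis by simp
qed

lemma comp_of_exists:
  assumes "finite W" "v \<in> W"
  shows "\<exists>C\<in>comps W. v \<in> C"
proof -
  have "closed_in W W \<and> v \<in> W" using assms unfolding closed_in_def by auto
  \<comment> \<open>The component of \<open>v\<close> is a closed set around \<open>v\<close> of
    least size: a proper closed part of it and the complement of that part in it are both closed in
    \<open>W\<close>, and one of them contains \<open>v\<close>.\<close>
  then obtain C where C: "closed_in W C \<and> v \<in> C"
    and min: "\<And>D. closed_in W D \<and> v \<in> D \<Longrightarrow> card C \<le> card D"
    using ex_has_least_nat[of "\<lambda>C. closed_in W C \<and> v \<in> C" W card] by blast
  have fin: "finite C" using C assms finite_subset unfolding closed_in_def by blast
  have "D = C" if D: "D \<noteq> {}" "closed_in C D" for D
  proof (rule ccontr)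
    assume "D \<noteq> C"
    moreover have "D \<subseteq> C" using D unfolding closed_in_def by simp
    ultimately have lt: "card D < card C" "card (C - D) < card C"
      using fin D by (auto intro!: psubset_card_mono)
    show False
    proof (cases "v \<in> D")
      case True
      then show False using min[of D] closed_in_trans[OF conjunct1[OF C] D(2)] lt by simp
    next
      case False
      then show False using min[of "C - D"] closed_in_trans[OF conjunct1[OF C] closed_in_Diff[OF D(2)]] C lt by simp
    qed
  qed
  then have "C \<in> comps W" using C unfolding comps_def conn_def by auto
  then show ?thesis using C by blast
qed

lemma Union_comps: "finite W \<Longrightarrow> \<Union>(comps W) = W"
  using comp_of_exists comps_subset by blast

lemma finite_comps: "finite W \<Longrightarrow> finite (comps W)"
  by (rule finite_subset[of _ "Pow W"]) (auto dest: comps_subset)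

lemma finite_odd_comps: "finite W \<Longrightarrow> finite (odd_comps W)"
  unfolding odd_comps_def using finite_comps by simp

lemma even_card_odd_comps:
  assumes "finite W"
  shows "even (card (odd_comps W)) \<longleftrightarrow> even (card W)"
proof -
  have "card W = card (\<Union>(comps W))" using Union_comps assms by simp
  also have "\<dots> = sum card (comps W)"
  proof (rule card_Union_disjoint)
    show "pairwise disjnt (comps W)"
      using comps_eq_if_meet unfolding pairwise_def disjnt_def by blast
    show "finite C" if "C \<in> comps W" for C
      using finite_subset[OF comps_subset[OF that] assms] .
  qed
  finally show ?thesis
    using even_sum_iff[OF finite_comps[OF assms], of card] unfolding odd_comps_def by simp
qed

lemma comps_Diff_within:
  assumes fin: "finite W" and C: "C \<in> comps W" and X: "X \<subseteq> C"
  shows "comps (W - X) = comps W - {C} \<union> comps (C - X)"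
proof
  have *: "comps W - {C} \<subseteq> comps (W - X)"
  proof
    fix D assume D: "D \<in> comps W - {C}"
    then have "D \<inter> C = {}" using comps_eq_if_meet C by blast
    then show "D \<in> comps (W - X)" using D X unfolding comps_def closed_in_def by blast
  qed
  moreover have **: "comps (C - X) \<subseteq> comps (W - X)"
    using C unfolding comps_def closed_in_def by blast
  ultimately show "comps W - {C} \<union> comps (C - X) \<subseteq> comps (W - X)" by blast
  show "comps (W - X) \<subseteq> comps W - {C} \<union> comps (C - X)"
  proof
    fix D assume D: "D \<in> comps (W - X)"
    then obtain v where v: "v \<in> D" "v \<in> W - X" using comps_nonempty comps_subset by blast
    then obtain D' where D': "D' \<in> comps W" "v \<in> D'" using comp_of_exists[OF fin] by blast
    show "D \<in> comps W - {C} \<union> comps (C - X)"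
    proof (cases "D' = C")
      case True
      have "finite (C - X)" using fin C comps_subset finite_subset by (metis finite_Diff)
      then obtain D'' where "D'' \<in> comps (C - X)" "v \<in> D''"
        using comp_of_exists v D' True by blast
      then show ?thesis using ** D v comps_eq_if_meet[of D "W - X" D''] by blast
    next
      case False
      then show ?thesis using * D D' v comps_eq_if_meet[of D "W - X" D'] by blast
    qed
  qed
qed

lemma card_odd_comps_Diff_within:
  assumes fin: "finite W" and C: "C \<in> comps W" and X: "X \<subseteq> C"
  shows "card (odd_comps (W - X)) = card (odd_comps W - {C}) + card (odd_comps (C - X))"
proof -
  have "finite C" using fin C comps_subset finite_subset by metis
  have "odd_comps (W - X) = (odd_comps W - {C}) \<union> odd_comps (C - X)"
    using comps_Diff_within[OF assms] unfolding odd_comps_def by blast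
  moreover have "(odd_comps W - {C}) \<inter> odd_comps (C - X) = {}"
  proof -
    have "D = C" if "D \<in> comps W" "D \<in> comps (C - X)" for D
      using comps_eq_if_meet[OF that(1) C] comps_subset[OF that(2)] comps_nonempty[OF that(2)] by blast
    then show ?thesis unfolding odd_comps_def by blast
  qed
  ultimately show ?thesis using fin \<open>finite C\<close> finite_odd_comps
    by (simp add: card_Un_disjoint)
qed

lemma perfect_matching_UN:
  assumes "\<And>i. i \<in> I \<Longrightarrow> perfect_matching (A i) (q i)"
    and "\<And>i j. i \<in> I \<Longrightarrow> j \<in> I \<Longrightarrow> i \<noteq> j \<Longrightarrow> A i \<inter> A j = {}"
  shows "\<exists>p. perfect_matching (\<Union>i\<in>I. A i) p"
proof -
  define ix where "ix v = (SOME i. i \<in> I \<and> v \<in> A i)" for v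
  have ix: "ix v = i" if "i \<in> I" "v \<in> A i" for i v
  proof -
    have "ix v \<in> I \<and> v \<in> A (ix v)" unfolding ix_def by (rule someI[of _ i]) (use that in auto)
    then show ?thesis using assms(2) that by blast
  qed
  have "perfect_matching (\<Union>i\<in>I. A i) (\<lambda>v. q (ix v) v)"
    unfolding perfect_matching_def
  proof
    fix v assume "v \<in> (\<Union>i\<in>I. A i)"
    then obtain i where i: "i \<in> I" "v \<in> A i" by auto
    then have "q i v \<in> A i" using assms(1) unfolding perfect_matching_def by blast
    then show "q (ix v) v \<in> (\<Union>i\<in>I. A i) \<and> q (ix v) v \<noteq> v \<and> q (ix (q (ix v) v)) (q (ix v) v) = v
        \<and> E v (q (ix v) v)"
      using ix[OF i] ix[OF i(1), of "q i v"] i assms(1)[OF i(1)] unfolding perfect_matching_def by auto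
  qed
  then show ?thesis by blast
qed

lemma perfect_matching_insert2:
  assumes "perfect_matching V p" "x \<notin> V" "y \<notin> V" "x \<noteq> y" "E x y"
  shows "perfect_matching (insert x (insert y V)) (p(x := y, y := x))"
  using assms sym unfolding perfect_matching_def by auto

theorem tutte:
  assumes "finite V" "\<And>S. S \<subseteq> V \<Longrightarrow> card (odd_comps (V - S)) \<le> card S"
  shows "\<exists>p. perfect_matching V p"
  using assms
proof (induct "card V" arbitrary: V rule: less_induct)
  case less
  \<comment> \<open>For a largest barrier \<open>S\<close> all components are odd and have a perfect matching after the
    deletion of any one vertex; Hall's theorem then matches them with \<open>S\<close>.\<close>
  note fin = less.prems(1)
  have "card (odd_comps V) = 0" using less.prems(2)[of "{}"] by simp
  then have evenV: "even (card V)" using even_card_odd_comps[OF fin] by simp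
  have par: "even (card (odd_comps (V - S))) \<longleftrightarrow> even (card S)" if "S \<subseteq> V" for S
    using even_card_odd_comps[of "V - S"] evenV fin that
    card_mono[OF fin that]
    by (simp add: card_Diff_subset finite_subset)
  let ?P = "\<lambda>S. S \<subseteq> V \<and> card (odd_comps (V - S)) = card S"
  have "?P {}" using \<open>card (odd_comps V) = 0\<close> by simp
  moreover have "\<forall>S. ?P S \<longrightarrow> card S < Suc (card V)" using card_mono[OF fin] by (simp add: less_Suc_eq_le)
  ultimately obtain S where S: "?P S" and max: "\<And>S'. ?P S' \<Longrightarrow> card S' \<le> card S"
    using ex_has_greatest_nat[of ?P "{}" card "Suc (card V)"] by blast
  have finS: "finite S" using S fin finite_subset by blast
  have max': "card (odd_comps (V - S')) < card S'" if "S' \<subseteq> V" "card S < card S'" for S'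
    using max[of S'] less.prems(2)[of S'] that by fastforce
  let ?W = "V - S"
  have finW: "finite ?W" using fin by simp
  \<comment> \<open>An even component minus a vertex \<open>c\<close> has odd order and hence an odd
    component, so \<open>insert c S\<close> would be a larger barrier.\<close>
  have all_odd: "odd_comps ?W = comps ?W"
  proof (rule ccontr)
    assume "\<not> ?thesis"
    then obtain D where D: "D \<in> comps ?W" "even (card D)" unfolding odd_comps_def by auto
    obtain c where c: "c \<in> D" using comps_nonempty D by blast
    have finD: "finite D" using D comps_subset finW finite_subset by metis
    have DW: "D \<subseteq> ?W" by (rule comps_subset[OF D(1)])
    have "card D > 0" using c finD by (auto simp: card_gt_0_iff)
    then have "odd (card (D - {c}))" using D(2) c finD by auto
    then have "odd (card (odd_comps (D - {c})))" using even_card_odd_comps[of "D - {c}"] finD by simp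
    then have "card (odd_comps (D - {c})) \<ge> 1" by (simp add: Suc_le_eq odd_pos)
    moreover have "odd_comps ?W - {D} = odd_comps ?W" using D unfolding odd_comps_def by auto
    moreover have "V - insert c S = ?W - {c}" by auto
    ultimately have "card (odd_comps (V - insert c S)) \<ge> card S + 1"
      using card_odd_comps_Diff_within[OF finW D(1), of "{c}"] c S by simp
    moreover have "c \<notin> S" "c \<in> V" using c DW by auto
    ultimately show False using max'[of "insert c S"] S finS by simp
  qed
  have critical: "\<exists>p. perfect_matching (C - {c}) p" if C: "C \<in> comps ?W" and c: "c \<in> C" for C c
  proof (rule less.hyps)
    have CW: "C \<subseteq> ?W" by (rule comps_subset[OF C])
    then have finC: "finite C" using finW finite_subset by blast
    show "finite (C - {c})" using finC by simp
    show "card (C - {c}) < card V" using CW c fin by (intro psubset_card_mono) auto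
    fix S' assume S': "S' \<subseteq> C - {c}"
    show "card (odd_comps (C - {c} - S')) \<le> card S'"
    proof (rule ccontr)
      assume gt: "\<not> ?thesis"
      have finS': "finite S'" using S' finC finite_subset by (metis finite_Diff)
      have "odd (card C)" using C all_odd unfolding odd_comps_def by auto
      then have "even (card (C - {c}))" using c finC by simp
      then have "even (card (C - {c} - S')) \<longleftrightarrow> even (card S')"
        using S' finC finS' card_mono[of "C - {c}" S'] by (subst card_Diff_subset) auto
      then have "even (card (odd_comps (C - {c} - S'))) \<longleftrightarrow> even (card S')"
        using even_card_odd_comps finC by simp
      then have ge: "card (odd_comps (C - {c} - S')) \<ge> card S' + 2" using gt by (intro same_parity_gap) auto
      \<comment> \<open>Parity has raised the excess of \<open>S'\<close> from one to two. With the
        \<open>card S - 1\<close> odd components other than \<open>C\<close>, this makes at least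
        \<open>card S + card S' + 1\<close> odd components, so \<open>S \<union> ?X\<close> would be
        a larger barrier.\<close>
      let ?X = "insert c S'"
      have X: "?X \<subseteq> C" using S' c by auto
      have "V - (S \<union> ?X) = ?W - ?X" "C - ?X = C - {c} - S'" by auto
      then have "card (odd_comps (V - (S \<union> ?X))) \<ge> card (odd_comps ?W - {C}) + (card S' + 2)"
        using card_odd_comps_Diff_within[OF finW C X] ge by simp
      moreover have "card (odd_comps ?W - {C}) + 1 = card S"
        using C all_odd S finite_comps[OF finW] by (metis Suc_eq_plus1 card_Suc_Diff1)
      moreover have "card (S \<union> ?X) = card S + (card S' + 1)"
      proof -
        have "S \<inter> ?X = {}" using X CW by auto
        moreover have "c \<notin> S'" using S' by auto
        ultimately show ?thesis using finS finS' by (simp add: card_Un_disjoint)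
      qed
      moreover have "S \<union> ?X \<subseteq> V" using X CW S by auto
      ultimately show False using max'[of "S \<union> ?X"] by simp
    qed
  qed
  have "\<exists>m. inj_on m (comps ?W) \<and> (\<forall>C\<in>comps ?W. m C \<in> {s \<in> S. \<exists>x\<in>C. E x s})"
  proof (rule hall)
    fix A assume A: "A \<subseteq> comps ?W"
    let ?N = "\<Union>C\<in>A. {s \<in> S. \<exists>x\<in>C. E x s}"
    have "?N \<subseteq> V" using S by auto
    \<comment> \<open>Members of \<open>A\<close> have no neighbours in \<open>S - ?N\<close>, so
      they remain components when only \<open>?N\<close> is deleted; the hypothesis for
      \<open>?N\<close> is then Hall's condition.\<close>
    have "A \<subseteq> odd_comps (V - ?N)"
    proof
      fix C assume C: "C \<in> A"
      then have "C \<in> odd_comps ?W" using A all_odd by auto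
      moreover have "closed_in (V - ?N) C"
        using C A unfolding comps_def closed_in_def by blast
      ultimately show "C \<in> odd_comps (V - ?N)" unfolding odd_comps_def comps_def by auto
    qed
    then have "card A \<le> card (odd_comps (V - ?N))"
      using fin finite_odd_comps by (intro card_mono) auto
    also have "\<dots> \<le> card ?N" by (rule less.prems(2)[OF \<open>?N \<subseteq> V\<close>])
    finally show "card A \<le> card ?N" .
  qed (use finite_comps[OF finW] finS in auto)
  then obtain m where m: "inj_on m (comps ?W)" "\<And>C. C \<in> comps ?W \<Longrightarrow> m C \<in> S"
    "\<And>C. C \<in> comps ?W \<Longrightarrow> \<exists>x\<in>C. E x (m C)" by blast
  have mS: "m ` comps ?W = S"
  proof (rule card_subset_eq[OF finS])
    show "m ` comps ?W \<subseteq> S" using m by auto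
    show "card (m ` comps ?W) = card S" using card_image[OF m(1)] all_odd S by simp
  qed
  have "\<exists>q. perfect_matching (insert (m C) C) q" if C: "C \<in> comps ?W" for C
  proof -
    obtain x where x: "x \<in> C" "E x (m C)" using m(3)[OF C] by blast
    obtain p where "perfect_matching (C - {x}) p" using critical[OF C x(1)] by blast
    moreover have "m C \<notin> C" using m(2)[OF C] comps_subset[OF C] by auto
    ultimately have "perfect_matching (insert x (insert (m C) (C - {x}))) (p(x := m C, m C := x))"
      using x by (intro perfect_matching_insert2) auto
    moreover have "insert x (insert (m C) (C - {x})) = insert (m C) C" using x by auto
    ultimately show ?thesis by auto
  qed
  then obtain q where q: "\<And>C. C \<in> comps ?W \<Longrightarrow> perfect_matching (insert (m C) C) (q C)" by metis
  have "\<exists>p. perfect_matching (\<Union>C\<in>comps ?W. insert (m C) C) p"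
  proof (rule perfect_matching_UN[OF q])
    fix C D assume CD: "C \<in> comps ?W" "D \<in> comps ?W" "C \<noteq> D"
    then have "C \<inter> D = {}" "m C \<noteq> m D" using comps_eq_if_meet m(1) by (auto dest: inj_onD)
    moreover have "m C \<notin> D" "m D \<notin> C" using CD m(2) comps_subset by blast+
    ultimately show "insert (m C) C \<inter> insert (m D) D = {}" by auto
  qed
  moreover have "(\<Union>C\<in>comps ?W. insert (m C) C) = V"
  proof -
    have "(\<Union>C\<in>comps ?W. insert (m C) C) = m ` comps ?W \<union> \<Union>(comps ?W)" by auto
    then show ?thesis using mS Union_comps[OF finW] S by auto
  qed
  ultimately show ?case by simp
qed

text \<open>Putting \<open>s\<close> back disturbs only the components adjacent to it. If these were
  at most two, at least \<open>card S\<close> odd components would survive against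
  \<open>S - {s}\<close>, contrary to minimality.\<close>

lemma small_barrier_vertex_has_three_odd_comps:
  assumes fin: "finite W" and S: "S \<subseteq> W" "card S + 2 \<le> card (odd_comps (W - S))"
    and min: "\<And>S'. S' \<subset> S \<Longrightarrow> card (odd_comps (W - S')) \<le> card S'" and s: "s \<in> S"
  shows "3 \<le> card {D \<in> odd_comps (W - S). \<exists>x\<in>D. E s x}"
proof (rule ccontr)
  let ?A = "{D \<in> odd_comps (W - S). \<exists>x\<in>D. E s x}"
  assume "\<not> 3 \<le> card ?A"
  have finS: "finite S" using S fin finite_subset by blast
  have fo: "finite (odd_comps (W - S))" using finite_odd_comps fin by simp
  have "odd_comps (W - S) - ?A \<subseteq> odd_comps (W - (S - {s}))"
  proof
    fix D assume D: "D \<in> odd_comps (W - S) - ?A"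
    then have "\<not> E x s" if "x \<in> D" for x using sym that by blast
    then have "closed_in (W - (S - {s})) D"
      using D unfolding odd_comps_def comps_def closed_in_def by blast
    then show "D \<in> odd_comps (W - (S - {s}))" using D unfolding odd_comps_def comps_def by auto
  qed
  then have "card (odd_comps (W - S) - ?A) \<le> card (odd_comps (W - (S - {s})))"
    using finite_odd_comps fin by (intro card_mono) auto
  also have "\<dots> \<le> card (S - {s})" using s by (intro min) auto
  also have "\<dots> < card S" using s finS by (intro psubset_card_mono) auto
  finally have "card (odd_comps (W - S) - ?A) < card S" .
  moreover have "card (odd_comps (W - S) - ?A) = card (odd_comps (W - S)) - card ?A"
    using fo by (intro card_Diff_subset) auto
  ultimately show False using S(2) \<open>\<not> 3 \<le> card ?A\<close> by linarith
qed

lemma card_comps_le_if_meet: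
  assumes "finite X" and A: "A \<subseteq> comps W" and "\<And>D. D \<in> A \<Longrightarrow> D \<inter> X \<noteq> {}"
  shows "card A \<le> card X"
proof -
  have "\<forall>D\<in>A. \<exists>x. x \<in> D \<and> x \<in> X" using assms(3) by blast
  then obtain g where g: "\<And>D. D \<in> A \<Longrightarrow> g D \<in> D \<and> g D \<in> X" by metis
  have "inj_on g A"
  proof (rule inj_onI)
    fix C D assume "C \<in> A" "D \<in> A" "g C = g D"
    then have "g C \<in> C \<inter> D" using g[of C] g[of D] by auto
    then show "C = D" using comps_eq_if_meet A \<open>C \<in> A\<close> \<open>D \<in> A\<close> by blast
  qed
  then show ?thesis using g assms(1) by (intro card_inj_on_le[of g]) auto
qed

text \<open>Here a violating set of least size is taken, in contrast to the largest barrier in the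
  proof of \<open>tutte\<close>; even order lifts its excess from one to two.\<close>

lemma barrier_exists:
  assumes fin: "finite W" and ev: "even (card W)" and no: "\<not> (\<exists>p. perfect_matching W p)"
  obtains S where "S \<subseteq> W" "card S + 2 \<le> card (odd_comps (W - S))"
    "\<And>s. s \<in> S \<Longrightarrow> 3 \<le> card {D \<in> odd_comps (W - S). \<exists>x\<in>D. E s x}"
proof -
  let ?P = "\<lambda>S. S \<subseteq> W \<and> card S < card (odd_comps (W - S))"
  obtain S0 where "?P S0" using tutte[OF fin] no by (meson not_less)
  then obtain S where S: "?P S" and min: "\<And>S'. ?P S' \<Longrightarrow> card S \<le> card S'"
    using ex_has_least_nat[of ?P S0 card] by blast
  have finS: "finite S" using S fin finite_subset by blast
  have "even (card (W - S)) \<longleftrightarrow> even (card S)"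
    using ev S finS card_mono[OF fin, of S] by (subst card_Diff_subset) auto
  then have gap: "card S + 2 \<le> card (odd_comps (W - S))"
    using S even_card_odd_comps[of "W - S"] fin by (intro same_parity_gap) auto
  have "card (odd_comps (W - S')) \<le> card S'" if "S' \<subset> S" for S'
    using min[of S'] S that psubset_card_mono[OF finS that] by fastforce
  then show thesis
    using that S gap small_barrier_vertex_has_three_odd_comps[OF fin _ gap] by blast
qed

end

subsection \<open>The gadget graph of a factor\<close>

definition nbrs :: "'a ugraph \<Rightarrow> 'a \<Rightarrow> 'a set" where
  "nbrs X u = {v. {u, v} \<in> edges X}"

text \<open>Ordered pairs make the count additive in each argument, and an edge inside
  \<open>A \<inter> B\<close> counts twice, as in a degree sum.\<close>

definition pairs :: "'a ugraph \<Rightarrow> 'a set \<Rightarrow> 'a set \<Rightarrow> ('a \<times> 'a) set" where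
  "pairs X A B = {(u, v). u \<in> A \<and> v \<in> B \<and> {u, v} \<in> edges X}"

lemma edge_verts:
  assumes "simple_graph X" "{u, v} \<in> edges X"
  shows "u \<in> verts X" "v \<in> verts X" "u \<noteq> v"
proof -
  have "{u, v} \<subseteq> verts X" "card {u, v} = 2" using assms unfolding simple_graph_def by blast+
  then show "u \<in> verts X" "v \<in> verts X" "u \<noteq> v" by auto
qed

lemma nbrs_subset: "simple_graph X \<Longrightarrow> nbrs X u \<subseteq> verts X"
  by (auto simp: nbrs_def dest: edge_verts(2))

lemma finite_nbrs: "simple_graph X \<Longrightarrow> finite (nbrs X u)"
  by (rule finite_subset[OF nbrs_subset]) (auto simp: simple_graph_def)

lemma card_nbrs:
  assumes "simple_graph X"
  shows "card (nbrs X u) = vdegree X u"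
proof -
  have "bij_betw (\<lambda>v. {u, v}) (nbrs X u) {e \<in> edges X. u \<in> e}"
    unfolding bij_betw_def
  proof
    show "inj_on (\<lambda>v. {u, v}) (nbrs X u)" by (auto simp: inj_on_def doubleton_eq_iff)
    have "e \<in> (\<lambda>v. {u, v}) ` nbrs X u" if e: "e \<in> edges X" "u \<in> e" for e
    proof -
      have "card e = 2" using assms e(1) unfolding simple_graph_def by blast
      then obtain v where "e = {u, v}" using e(2) by (auto simp: card_2_iff)
      then show ?thesis using e(1) unfolding nbrs_def by blast
    qed
    then show "(\<lambda>v. {u, v}) ` nbrs X u = {e \<in> edges X. u \<in> e}" unfolding nbrs_def by auto
  qed
  then show ?thesis unfolding vdegree_def by (rule bij_betw_same_card)
qed

lemma finite_edges:
  assumes "simple_graph X" shows "finite (edges X)"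
proof (rule finite_subset)
  show "edges X \<subseteq> Pow (verts X)" using assms unfolding simple_graph_def by blast
  show "finite (Pow (verts X))" using assms unfolding simple_graph_def by simp
qed

lemma finite_pairs: "finite A \<Longrightarrow> finite B \<Longrightarrow> finite (pairs X A B)"
  by (rule finite_subset[of _ "A \<times> B"]) (auto simp: pairs_def)

lemma card_pairs_commute: "card (pairs X A B) = card (pairs X B A)"
proof -
  have "pairs X B A = prod.swap ` pairs X A B" unfolding pairs_def by (auto simp: insert_commute)
  then show ?thesis by (simp add: card_image)
qed

lemma card_pairs_Un:
  assumes "finite A" "finite B" "finite C" "B \<inter> C = {}"
  shows "card (pairs X A (B \<union> C)) = card (pairs X A B) + card (pairs X A C)"
proof -
  have "pairs X A (B \<union> C) = pairs X A B \<union> pairs X A C" unfolding pairs_def by auto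
  moreover have "pairs X A B \<inter> pairs X A C = {}" using assms(4) unfolding pairs_def by auto
  ultimately show ?thesis using card_Un_disjoint[OF finite_pairs finite_pairs] assms(1-3) by simp
qed

lemma card_pairs_UN:
  assumes "finite A" "finite I" "\<And>i. i \<in> I \<Longrightarrow> finite (U i)"
    and "\<And>i j. i \<in> I \<Longrightarrow> j \<in> I \<Longrightarrow> i \<noteq> j \<Longrightarrow> U i \<inter> U j = {}"
  shows "card (pairs X A (\<Union>i\<in>I. U i)) = (\<Sum>i\<in>I. card (pairs X A (U i)))"
proof -
  have "pairs X A (\<Union>i\<in>I. U i) = (\<Union>i\<in>I. pairs X A (U i))" unfolding pairs_def by auto
  moreover have "card (\<Union>i\<in>I. pairs X A (U i)) = (\<Sum>i\<in>I. card (pairs X A (U i)))"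
  proof (rule card_UN_disjoint[OF assms(2)])
    show "\<forall>i\<in>I. finite (pairs X A (U i))" using assms(1,3) finite_pairs by blast
    show "\<forall>i\<in>I. \<forall>j\<in>I. i \<noteq> j \<longrightarrow> pairs X A (U i) \<inter> pairs X A (U j) = {}"
      using assms(4) unfolding pairs_def by blast
  qed
  ultimately show ?thesis by simp
qed

lemma card_pairs_verts:
  assumes X: "simple_graph X" and reg: "regular_graph r X" and A: "A \<subseteq> verts X"
  shows "card (pairs X A (verts X)) = r * card A"
proof -
  have finA: "finite A" using X A finite_subset unfolding simple_graph_def by blast
  have "pairs X A (verts X) = Sigma A (nbrs X)"
    using nbrs_subset[OF X] unfolding pairs_def nbrs_def by auto
  then have "card (pairs X A (verts X)) = (\<Sum>u\<in>A. card (nbrs X u))"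
    using finA finite_nbrs[OF X] by simp
  also have "\<dots> = (\<Sum>u\<in>A. r)"
    using reg A unfolding card_nbrs[OF X] regular_graph_def by (intro sum.cong) auto
  finally show ?thesis by simp
qed

lemma card_pairs_self:
  assumes X: "simple_graph X"
  shows "card (pairs X A A) = 2 * card {e \<in> edges X. e \<subseteq> A}"
proof -
  let ?Es = "{e \<in> edges X. e \<subseteq> A}"
  have fin: "finite ?Es" using finite_edges[OF X] by simp
  have two: "\<exists>u v. e = {u, v} \<and> u \<noteq> v" if "e \<in> ?Es" for e
  proof -
    have "card e = 2" using that X unfolding simple_graph_def by blast
    then show ?thesis by (auto simp: card_2_iff)
  qed
  have "pairs X A A = (\<Union>e\<in>?Es. {(u, v). e = {u, v}})" unfolding pairs_def by auto
  also have "card \<dots> = (\<Sum>e\<in>?Es. card {(u, v). e = {u, v}})"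
  proof (rule card_UN_disjoint[OF fin])
    show "\<forall>e\<in>?Es. finite {(u, v). e = {u, v}}"
    proof
      fix e assume "e \<in> ?Es"
      then obtain u v where "e = {u, v}" using two by blast
      then have "{(u, v). e = {u, v}} \<subseteq> {u, v} \<times> {u, v}" by auto
      then show "finite {(u, v). e = {u, v}}" by (rule finite_subset) auto
    qed
  qed auto
  also have "\<dots> = (\<Sum>e\<in>?Es. 2)"
  proof (rule sum.cong[OF refl])
    fix e assume "e \<in> ?Es"
    then obtain u v where uv: "e = {u, v}" "u \<noteq> v" using two by blast
    then have "{(u, v). e = {u, v}} = {(u, v), (v, u)}" by (auto simp: doubleton_eq_iff)
    then show "card {(u, v). e = {u, v}} = 2" using uv by simp
  qed
  finally show ?thesis by simp
qed

text \<open>Every vertex \<open>u\<close> is replaced by a complete bipartite graph between its ports \<open>Inl (u, v)\<close>, one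
  for each edge at \<open>u\<close>, and \<open>l\<close> cores \<open>Inr (u, i)\<close>; the two ports of an edge are joined. In a perfect
  matching the cores use up \<open>l\<close> ports of every vertex, so the remaining ports form a factor of
  degree \<open>r - l\<close>.\<close>

type_synonym 'a gadget = "'a \<times> 'a + 'a \<times> nat"

fun gadget_adj :: "'a ugraph \<Rightarrow> 'a gadget \<Rightarrow> 'a gadget \<Rightarrow> bool" where
  "gadget_adj X (Inl (u, v)) (Inl (u', v')) \<longleftrightarrow> u' = v \<and> v' = u \<and> {u, v} \<in> edges X"
| "gadget_adj X (Inl (u, v)) (Inr (w, i)) \<longleftrightarrow> w = u"
| "gadget_adj X (Inr (w, i)) (Inl (u, v)) \<longleftrightarrow> w = u"
| "gadget_adj X (Inr _) (Inr _) \<longleftrightarrow> False"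

definition ports :: "'a ugraph \<Rightarrow> 'a \<Rightarrow> 'a gadget set" where
  "ports X u = (\<lambda>v. Inl (u, v)) ` nbrs X u"

definition cores :: "nat \<Rightarrow> 'a \<Rightarrow> 'a gadget set" where
  "cores l u = (\<lambda>i. Inr (u, i)) ` {..<l}"

definition gadget_verts :: "'a ugraph \<Rightarrow> nat \<Rightarrow> 'a gadget set" where
  "gadget_verts X l = (\<Union>u\<in>verts X. ports X u \<union> cores l u)"

interpretation gadget: sym_graph "gadget_adj X" for X :: "'a ugraph"
proof
  fix x y assume "gadget_adj X x y"
  then show "gadget_adj X y x"
    by (induct X x y rule: gadget_adj.induct) (simp_all add: insert_commute)
qed

lemma mem_ports: "x \<in> ports X u \<longleftrightarrow> (\<exists>v. x = Inl (u, v) \<and> {u, v} \<in> edges X)"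
  and mem_cores: "x \<in> cores l u \<longleftrightarrow> (\<exists>i<l. x = Inr (u, i))"
  unfolding ports_def cores_def nbrs_def by auto

lemma Inl_gadget_verts: "simple_graph X \<Longrightarrow> Inl (u, v) \<in> gadget_verts X l \<longleftrightarrow> {u, v} \<in> edges X"
  and Inr_gadget_verts: "Inr (u, i) \<in> gadget_verts X l \<longleftrightarrow> u \<in> verts X \<and> i < l"
  unfolding gadget_verts_def by (auto simp: mem_ports mem_cores dest: edge_verts)

lemma card_ports: "simple_graph X \<Longrightarrow> card (ports X u) = vdegree X u"
  unfolding ports_def by (subst card_image) (auto simp: inj_on_def card_nbrs)

lemma card_cores: "card (cores l u) = l"
  unfolding cores_def by (subst card_image) (auto simp: inj_on_def)

lemma finite_ports: "simple_graph X \<Longrightarrow> finite (ports X u)"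
  and finite_cores: "finite (cores l u)"
  unfolding ports_def cores_def by (auto simp: finite_nbrs)

lemma finite_gadget_verts: "simple_graph X \<Longrightarrow> finite (gadget_verts X l)"
  unfolding gadget_verts_def
  by (intro finite_UN_I finite_UnI finite_ports finite_cores) (auto simp: simple_graph_def)

lemma card_gadgets:
  assumes X: "simple_graph X" and reg: "regular_graph r X" and A: "A \<subseteq> verts X"
  shows "card (\<Union>u\<in>A. ports X u \<union> cores l u) = (r + l) * card A"
proof -
  have "finite A" using X A finite_subset unfolding simple_graph_def by blast
  then have "card (\<Union>u\<in>A. ports X u \<union> cores l u) = (\<Sum>u\<in>A. card (ports X u \<union> cores l u))"
    using finite_ports[OF X] finite_cores
    by (intro card_UN_disjoint) (auto simp: mem_ports mem_cores)
  also have "\<dots> = (\<Sum>u\<in>A. r + l)"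
  proof (rule sum.cong[OF refl])
    fix u assume "u \<in> A"
    then have "vdegree X u = r" using reg A unfolding regular_graph_def by blast
    moreover have "ports X u \<inter> cores l u = {}" by (auto simp: mem_ports mem_cores)
    ultimately show "card (ports X u \<union> cores l u) = r + l"
      using card_Un_disjoint[OF finite_ports[OF X, of u] finite_cores[of l u]] card_ports[OF X, of u]
        card_cores[of l u] by simp
  qed
  finally show ?thesis by simp
qed

lemma factor_if_gadget_matching:
  assumes X: "simple_graph X" and reg: "regular_graph r X" and l: "l \<le> r"
    and p: "gadget.perfect_matching X (gadget_verts X l) p"
  shows "\<exists>F. is_factor (r - l) X F"
proof -
  let ?W = "gadget_verts X l"
  have pm: "p x \<in> ?W" "p (p x) = x" "gadget_adj X x (p x)" if "x \<in> ?W" for x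
    using p that unfolding gadget.perfect_matching_def by blast+
  have sym: "p (Inl (v, u)) = Inl (u, v)" if "{u, v} \<in> edges X" "p (Inl (u, v)) = Inl (v, u)" for u v
    using pm(2)[of "Inl (u, v)"] that Inl_gadget_verts[OF X] by simp
  define F where "F = (verts X, {{u, v} | u v. {u, v} \<in> edges X \<and> p (Inl (u, v)) = Inl (v, u)})"
  have F_edge: "{u, v} \<in> edges F \<longleftrightarrow> {u, v} \<in> edges X \<and> p (Inl (u, v)) = Inl (v, u)" for u v
  proof
    assume "{u, v} \<in> edges F"
    then obtain a b where "{u, v} = {a, b}" "{a, b} \<in> edges X" "p (Inl (a, b)) = Inl (b, a)"
      unfolding F_def by auto
    then show "{u, v} \<in> edges X \<and> p (Inl (u, v)) = Inl (v, u)" by (metis doubleton_eq_iff sym)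
  qed (auto simp: F_def)
  have sub: "edges F \<subseteq> edges X" "verts F = verts X" unfolding F_def by auto
  then have simF: "simple_graph F" using X unfolding simple_graph_def by auto
  have "vdegree F u = r - l" if u: "u \<in> verts X" for u
  proof -
    let ?B = "nbrs X u - nbrs F u"
    have core: "\<exists>v. p (Inr (u, i)) = Inl (u, v) \<and> v \<in> ?B" if "i < l" for i
    proof -
      have W: "Inr (u, i) \<in> ?W" using u that by (simp add: Inr_gadget_verts)
      obtain v where v: "p (Inr (u, i)) = Inl (u, v)"
        using pm(3)[OF W] by (cases "p (Inr (u, i))") auto
      have "{u, v} \<in> edges X" using pm(1)[OF W] unfolding v by (simp add: Inl_gadget_verts[OF X])
      moreover have "p (Inl (u, v)) = Inr (u, i)" using pm(2)[OF W] v by simp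
      ultimately show ?thesis using v F_edge unfolding nbrs_def by auto
    qed
    \<comment> \<open>A port outside \<open>F\<close> can only be matched to a core of its own
      vertex, and every core to such a port; so \<open>p\<close>, read in both directions, is the
      bijection.\<close>
    have "bij_betw (\<lambda>v. snd (projr (p (Inl (u, v))))) ?B {..<l}"
    proof (rule bij_betw_byWitness[where f' = "\<lambda>i. snd (projl (p (Inr (u, i))))"])
      have port: "\<exists>i<l. p (Inl (u, v)) = Inr (u, i) \<and> p (Inr (u, i)) = Inl (u, v)" if v: "v \<in> ?B" for v
      proof -
        have W: "Inl (u, v) \<in> ?W" using v by (simp add: Inl_gadget_verts[OF X] nbrs_def)
        have "p (Inl (u, v)) \<noteq> Inl (v, u)" using v F_edge[of u v] by (simp add: nbrs_def)
        then obtain i where i: "p (Inl (u, v)) = Inr (u, i)"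
          using pm(3)[OF W] by (cases "p (Inl (u, v))") auto
        then have "i < l" using pm(1)[OF W] by (simp add: Inr_gadget_verts)
        then show ?thesis using i pm(2)[OF W] by auto
      qed
      show "\<forall>v\<in>?B. snd (projl (p (Inr (u, snd (projr (p (Inl (u, v)))))))) = v" using port by fastforce
      show "(\<lambda>v. snd (projr (p (Inl (u, v))))) ` ?B \<subseteq> {..<l}" using port by fastforce
      show "(\<lambda>i. snd (projl (p (Inr (u, i))))) ` {..<l} \<subseteq> ?B" using core by fastforce
      show "\<forall>i\<in>{..<l}. snd (projr (p (Inl (u, snd (projl (p (Inr (u, i)))))))) = i"
      proof
        fix i assume "i \<in> {..<l}"
        then have "i < l" by simp
        then have "p (p (Inr (u, i))) = Inr (u, i)" using pm(2)[of "Inr (u, i)"] u by (simp add: Inr_gadget_verts)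
        then show "snd (projr (p (Inl (u, snd (projl (p (Inr (u, i)))))))) = i" using core[OF \<open>i < l\<close>] by auto
      qed
    qed
    then have "card ?B = l" using bij_betw_same_card by fastforce
    moreover have "nbrs F u \<subseteq> nbrs X u" using sub unfolding nbrs_def by auto
    ultimately have "card (nbrs X u) - card (nbrs F u) = l" "card (nbrs F u) \<le> card (nbrs X u)"
      using finite_nbrs[OF X] by (auto simp: card_Diff_subset finite_nbrs[OF simF] card_mono)
    then show ?thesis
      using reg u l unfolding card_nbrs[OF X] card_nbrs[OF simF] regular_graph_def by auto
  qed
  then have "regular_graph (r - l) F" using sub unfolding regular_graph_def by simp
  then show ?thesis using simF sub unfolding is_factor_def by blast
qed

subsection \<open>Barriers of the gadget graph\<close>

text \<open>With \<open>l = r - k\<close>, the assumption \<open>par\<close> is the evenness of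
  \<open>k\<close>, and \<open>three\<close> is the gain from a barrier of least size.\<close>

locale gadget_barrier =
  fixes X :: "'a ugraph" and r l :: nat and B :: "'a gadget set"
  assumes X: "simple_graph X" and reg: "regular_graph r X"
    and l: "0 < l" "l \<le> r" and par: "even (r + l)"
    and B: "B \<subseteq> gadget_verts X l"
    and gap: "card B + 2 \<le> card (gadget.odd_comps X (gadget_verts X l - B))"
    and three: "\<And>s. s \<in> B \<Longrightarrow>
      3 \<le> card {D \<in> gadget.odd_comps X (gadget_verts X l - B). \<exists>x\<in>D. gadget_adj X s x}"
begin

abbreviation W where "W \<equiv> gadget_verts X l"
abbreviation cc where "cc \<equiv> gadget.comps X (W - B)"
abbreviation oc where "oc \<equiv> gadget.odd_comps X (W - B)"

lemma fin: "finite W" "finite B" "finite (verts X)" "finite oc" "finite cc"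
proof -
  show W: "finite W" by (rule finite_gadget_verts[OF X])
  then show "finite B" using B by (rule rev_finite_subset)
  show "finite (verts X)" using X unfolding simple_graph_def by simp
  show "finite oc" "finite cc"
    using W by (simp_all add: gadget.finite_odd_comps gadget.finite_comps)
qed

lemma oc_cc: "D \<in> oc \<Longrightarrow> D \<in> cc"
  unfolding gadget.odd_comps_def by simp

lemma comp_mem: "D \<in> cc \<Longrightarrow> x \<in> D \<Longrightarrow> x \<in> W \<and> x \<notin> B"
  using gadget.comps_subset by fastforce

lemma comp_step: "D \<in> cc \<Longrightarrow> x \<in> D \<Longrightarrow> gadget_adj X x y \<Longrightarrow> y \<in> W \<Longrightarrow> y \<notin> B \<Longrightarrow> y \<in> D"
  unfolding gadget.comps_def gadget.closed_in_def by auto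

lemma port_nonempty:
  assumes "u \<in> verts X" obtains v where "{u, v} \<in> edges X"
proof -
  have "card (nbrs X u) > 0" using card_nbrs[OF X] reg l assms unfolding regular_graph_def by simp
  then have "nbrs X u \<noteq> {}" by auto
  then show thesis using that unfolding nbrs_def by auto
qed

text \<open>If \<open>Inl (u, w)\<close> survives, all surviving cores of \<open>u\<close> lie in
  its component. The only other neighbour of \<open>Inl (u, v)\<close> is its partner port, so it
  sees at most two components instead of three.\<close>

lemma port_in_B:
  assumes "Inl (u, v) \<in> B" "{u, w} \<in> edges X"
  shows "Inl (u, w) \<in> B"
proof (rule ccontr)
  assume nB: "Inl (u, w) \<notin> B"
  let ?A = "{D \<in> oc. \<exists>x\<in>D. gadget_adj X (Inl (u, v)) x}"
  have "D \<inter> {Inl (u, w), Inl (v, u)} \<noteq> {}" if D: "D \<in> ?A" for D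
  proof -
    obtain x where x: "x \<in> D" "gadget_adj X (Inl (u, v)) x" and Dc: "D \<in> cc" using D oc_cc by auto
    show ?thesis
    proof (cases x)
      case (Inl p)
      then have "x = Inl (v, u)" using x(2) by (cases p) auto
      then show ?thesis using x(1) by auto
    next
      case (Inr p)
      then obtain i where "x = Inr (u, i)" using x(2) by (cases p) auto
      then have "Inl (u, w) \<in> D" using comp_step[OF Dc x(1)] nB assms(2) by (simp add: Inl_gadget_verts[OF X])
      then show ?thesis by auto
    qed
  qed
  then have "card ?A \<le> card {Inl (u, w), Inl (v, u) :: 'a gadget}"
    by (intro gadget.card_comps_le_if_meet[of _ _ X "W - B"]) (auto dest: oc_cc)
  also have "\<dots> \<le> 2" by (simp add: card_insert_if)
  finally show False using three[OF assms(1)] by simp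
qed

text \<open>A surviving core is adjacent to all surviving ports of its vertex, so these lie in one
  component, and a removed core of the vertex sees no other.\<close>

lemma core_in_B:
  assumes "Inr (u, i) \<in> B" "j < l"
  shows "Inr (u, j) \<in> B"
proof (rule ccontr)
  assume nB: "Inr (u, j) \<notin> B"
  let ?A = "{D \<in> oc. \<exists>x\<in>D. gadget_adj X (Inr (u, i)) x}"
  have u: "u \<in> verts X" using assms(1) B Inr_gadget_verts[of u i X l] by auto
  have "D \<inter> {Inr (u, j)} \<noteq> {}" if D: "D \<in> ?A" for D
  proof -
    obtain x where x: "x \<in> D" "gadget_adj X (Inr (u, i)) x" and Dc: "D \<in> cc" using D oc_cc by auto
    obtain v where "x = Inl (u, v)" using x(2) by (cases x) auto
    then have "Inr (u, j) \<in> D" using comp_step[OF Dc x(1)] nB assms(2) u by (simp add: Inr_gadget_verts)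
    then show ?thesis by auto
  qed
  then have "card ?A \<le> card {Inr (u, j) :: 'a gadget}"
    by (intro gadget.card_comps_le_if_meet[of _ _ X "W - B"]) (auto dest: oc_cc)
  then show False using three[OF assms(1)] by simp
qed

text \<open>By \<open>port_in_B\<close> all ports of \<open>u\<close> would be in \<open>B\<close>,
  leaving the core without any neighbour. This makes \<open>S\<close> and \<open>T\<close>
  disjoint.\<close>

lemma core_port_B:
  assumes "Inr (u, i) \<in> B" shows "Inl (u, v) \<notin> B"
proof
  assume "Inl (u, v) \<in> B"
  let ?A = "{D \<in> oc. \<exists>x\<in>D. gadget_adj X (Inr (u, i)) x}"
  have "D \<notin> ?A" for D
  proof
    assume D: "D \<in> ?A"
    then obtain x where x: "x \<in> D" "gadget_adj X (Inr (u, i)) x" and Dc: "D \<in> cc" using oc_cc by auto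
    obtain w where w: "x = Inl (u, w)" using x(2) by (cases x) auto
    then have "{u, w} \<in> edges X" using comp_mem[OF Dc x(1)] Inl_gadget_verts[OF X] by auto
    then show False using port_in_B[OF \<open>Inl (u, v) \<in> B\<close>] comp_mem[OF Dc x(1)] w by auto
  qed
  then have "?A = {}" by auto
  then show False using three[OF assms] by (metis card.empty not_numeral_le_zero)
qed

text \<open>\<open>S\<close> and \<open>T\<close> are the disjoint sets of Tutte's \<open>k\<close>-factor theorem; \<open>U D\<close> is the component of
  \<open>X - (S \<union> T)\<close> that corresponds to the gadget component \<open>D\<close>, empty if there is none.\<close>

definition S where "S = {u \<in> verts X. \<exists>v. Inl (u, v) \<in> B}"
definition T where "T = {u \<in> verts X. \<exists>i. Inr (u, i) \<in> B}"
definition R where "R = verts X - S - T"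
definition U :: "'a gadget set \<Rightarrow> 'a set" where "U D = {u \<in> R. Inr (u, 0) \<in> D}"

lemma Inl_B: "Inl (u, v) \<in> B \<longleftrightarrow> u \<in> S \<and> {u, v} \<in> edges X"
  using B Inl_gadget_verts[OF X, of u v l] port_in_B edge_verts(1)[OF X, of u v] unfolding S_def by auto

lemma Inr_B: "Inr (u, i) \<in> B \<longleftrightarrow> u \<in> T \<and> i < l"
  using B Inr_gadget_verts[of u i X l] core_in_B unfolding T_def by auto

lemma ST: "S \<subseteq> verts X" "T \<subseteq> verts X" "S \<inter> T = {}" "finite S" "finite T" "finite R" "R \<subseteq> verts X"
  "R \<inter> S = {}" "R \<inter> T = {}"
  using core_port_B fin(3) unfolding S_def T_def R_def by auto

text \<open>Outside \<open>S\<close> and \<open>T\<close> the gadget of a vertex is intact: a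
  complete bipartite graph with both sides nonempty, hence connected.\<close>

lemma R_gadget:
  assumes D: "D \<in> cc" and u: "u \<in> R" and x: "x \<in> D" "x \<in> ports X u \<union> cores l u"
  shows "ports X u \<union> cores l u \<subseteq> D"
proof -
  have uV: "u \<in> verts X" and nST: "u \<notin> S" "u \<notin> T" using u unfolding R_def by auto
  have P: "Inl (u, v) \<in> D" if "Inr (u, i) \<in> D" "{u, v} \<in> edges X" for i v
    using comp_step[OF D that(1)] that(2) nST by (simp add: Inl_gadget_verts[OF X] Inl_B)
  have C: "Inr (u, i) \<in> D" if "Inl (u, v) \<in> D" "i < l" for i v
    using comp_step[OF D that(1)] that(2) nST uV by (simp add: Inr_gadget_verts Inr_B)
  obtain v where v: "{u, v} \<in> edges X" using port_nonempty[OF uV] by auto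
  have "Inr (u, 0) \<in> D"
  proof (cases x)
    case (Inl p) then show ?thesis using x C l by (auto simp: mem_ports mem_cores)
  next
    case (Inr p)
    then obtain i where "Inr (u, i) \<in> D" using x by (auto simp: mem_ports mem_cores)
    then show ?thesis using P[OF _ v] C[OF _ l(1)] by auto
  qed
  then have "Inl (u, w) \<in> D" if "{u, w} \<in> edges X" for w using P that by simp
  moreover from this[OF v] have "Inr (u, i) \<in> D" if "i < l" for i using C that by simp
  ultimately show ?thesis by (auto simp: mem_ports mem_cores)
qed

lemma U_gadget:
  assumes D: "D \<in> cc" and u: "u \<in> U D"
  shows "ports X u \<union> cores l u \<subseteq> D"
  using R_gadget[OF D, of u "Inr (u, 0)"] u l unfolding U_def by (auto simp: mem_cores)

lemma U_I:
  assumes D: "D \<in> cc" and u: "u \<in> R" and x: "x \<in> D" "x \<in> ports X u \<union> cores l u"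
  shows "u \<in> U D"
  using R_gadget[OF assms] u l unfolding U_def by (auto simp: mem_cores)

lemma U_R: "U D \<subseteq> R" "finite (U D)" "U D \<subseteq> verts X" "U D \<inter> S = {}" "U D \<inter> T = {}"
  using ST unfolding U_def by auto

lemma U_disjoint:
  assumes "D \<in> cc" "D' \<in> cc" "D \<noteq> D'" shows "U D \<inter> U D' = {}"
  using gadget.comps_eq_if_meet[OF assms(1,2)] assms(3) unfolding U_def by auto

lemma U_closed:
  assumes D: "D \<in> cc" and u: "u \<in> U D" and e: "{u, v} \<in> edges X" and v: "v \<in> R"
  shows "v \<in> U D"
proof -
  have e': "{v, u} \<in> edges X" using e by (simp add: insert_commute)
  have "Inl (u, v) \<in> D" using U_gadget[OF D u] e by (auto simp: mem_ports)
  then have "Inl (v, u) \<in> D"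
    using comp_step[OF D] e e' v by (simp add: Inl_gadget_verts[OF X] Inl_B R_def)
  then show ?thesis using U_I[OF D v] e' by (auto simp: mem_ports)
qed

text \<open>A port at a vertex of \<open>T\<close> has lost all its cores and hangs on its partner
  port only. So a component over \<open>Z\<close> has one vertex beyond the gadgets of
  \<open>Z\<close> for each edge from \<open>Z\<close> to \<open>T\<close>; these vertices decide
  its parity.\<close>

definition ext where
  "ext Z = (\<Union>u\<in>Z. ports X u \<union> cores l u) \<union> (\<lambda>(u, v). Inl (v, u)) ` pairs X Z T"

text \<open>\<open>ext Z\<close> is closed in the connected set \<open>D\<close>. Taking
  \<open>Z = U D\<close> yields the shape and the order of \<open>D\<close>; a general
  \<open>Z\<close> yields the connectedness of \<open>U D\<close>.\<close>

lemma comp_eq_ext: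
  assumes D: "D \<in> cc" and Z: "Z \<subseteq> U D" "Z \<noteq> {}"
    and cl: "\<And>u v. u \<in> Z \<Longrightarrow> v \<in> U D \<Longrightarrow> {u, v} \<in> edges X \<Longrightarrow> v \<in> Z"
  shows "D = ext Z"
proof -
  have sub: "ext Z \<subseteq> D"
  proof
    fix x assume "x \<in> ext Z"
    then consider u where "u \<in> Z" "x \<in> ports X u \<union> cores l u"
      | u v where "u \<in> Z" "v \<in> T" "{u, v} \<in> edges X" "x = Inl (v, u)"
      unfolding ext_def pairs_def by auto
    then show "x \<in> D"
    proof cases
      case 1 then show ?thesis using U_gadget[OF D] Z by auto
    next
      case 2
      have e: "{v, u} \<in> edges X" using 2 by (simp add: insert_commute)
      have "u \<in> U D" using 2 Z(1) by auto
      then have "Inl (u, v) \<in> D" using U_gadget[OF D, of u] 2 by (auto simp: mem_ports)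
      moreover have "v \<notin> S" using 2 ST by auto
      ultimately show ?thesis
        using comp_step[OF D, of "Inl (u, v)" x] 2 e by (simp add: Inl_gadget_verts[OF X] Inl_B)
    qed
  qed
  have "\<not> gadget_adj X x y" if x: "x \<in> ext Z" and y: "y \<in> D - ext Z" for x y
  proof
    assume adj: "gadget_adj X x y"
    have yW: "y \<in> W" "y \<notin> B" using comp_mem[OF D] y by auto
    show False
    proof (cases y)
      case (Inl p)
      obtain v w where p: "p = (v, w)" by (cases p) auto
      have vw: "{v, w} \<in> edges X" "v \<notin> S" "v \<in> verts X"
        using yW Inl_gadget_verts[OF X] edge_verts(1)[OF X] unfolding Inl p by (auto simp: Inl_B)
      have vZ: "v \<notin> Z" using y vw(1) unfolding Inl p ext_def by (auto simp: mem_ports)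
      have "\<not> (v \<in> T \<and> w \<in> Z)"
      proof
        assume "v \<in> T \<and> w \<in> Z"
        then have "(w, v) \<in> pairs X Z T" using vw(1) unfolding pairs_def by (auto simp: insert_commute)
        then have "y \<in> ext Z" unfolding ext_def Inl p by force
        then show False using y by simp
      qed
      moreover have "w \<in> Z"
      proof (cases x)
        case xl: (Inl q)
        then have "x = Inl (w, v)" using adj unfolding Inl p by (cases q) auto
        then have "Inl (w, v) \<in> ext Z" using x by simp
        then consider "w \<in> Z" | "v \<in> Z" unfolding ext_def pairs_def by (auto simp: mem_ports mem_cores)
        then show ?thesis using vZ by cases auto
      next
        case xr: (Inr q)
        then obtain i where "x = Inr (v, i)" using adj unfolding Inl p by (cases q) auto
        then have "v \<in> Z" using x unfolding ext_def by (auto simp: mem_ports mem_cores)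
        then show ?thesis using vZ by simp
      qed
      ultimately have "v \<in> R" using vw unfolding R_def by auto
      moreover have "{w, v} \<in> edges X" using vw(1) by (simp add: insert_commute)
      ultimately show False using cl[OF \<open>w \<in> Z\<close>] U_closed[OF D, of w v] Z \<open>w \<in> Z\<close> vZ by auto
    next
      case (Inr p)
      obtain v i where p: "p = (v, i)" by (cases p) auto
      have v: "v \<notin> T" "i < l" using yW Inr_gadget_verts[of v i X l] unfolding Inr p by (auto simp: Inr_B)
      obtain w where "x = Inl (v, w)" using adj unfolding Inr p by (cases x) auto
      then have "v \<in> Z" using x v unfolding ext_def pairs_def by (auto simp: mem_ports mem_cores)
      then have "y \<in> ext Z" using v unfolding ext_def Inr p by (auto simp: mem_cores)
      then show False using y by simp
    qed
  qed
  then have "gadget.closed_in X D (ext Z)" using sub unfolding gadget.closed_in_def by simp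
  moreover have "ext Z \<noteq> {}"
  proof -
    obtain u where "u \<in> Z" using Z by auto
    then have "Inr (u, 0) \<in> ext Z" using l unfolding ext_def by (auto simp: mem_cores)
    then show ?thesis by auto
  qed
  moreover have "gadget.conn X D" using D unfolding gadget.comps_def by simp
  ultimately show ?thesis unfolding gadget.conn_def by metis
qed

lemma U_connected:
  assumes D: "D \<in> cc" and Z: "Z \<subseteq> U D" "Z \<noteq> {}"
    and cl: "\<And>u v. u \<in> Z \<Longrightarrow> v \<in> U D \<Longrightarrow> {u, v} \<in> edges X \<Longrightarrow> v \<in> Z"
  shows "Z = U D"
proof -
  have "u \<in> Z" if "u \<in> U D" for u
  proof -
    have "Inr (u, 0) \<in> ext Z" using comp_eq_ext[OF assms] that unfolding U_def by simp
    then show ?thesis unfolding ext_def by (auto simp: mem_cores mem_ports)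
  qed
  then show ?thesis using Z by auto
qed

lemma card_comp:
  assumes D: "D \<in> cc" and ne: "U D \<noteq> {}"
  shows "card D = (r + l) * card (U D) + card (pairs X (U D) T)"
proof -
  let ?G = "\<Union>u\<in>U D. ports X u \<union> cores l u" and ?P = "(\<lambda>(u, v). Inl (v, u)) ` pairs X (U D) T :: 'a gadget set"
  have D_eq: "D = ?G \<union> ?P" using comp_eq_ext[OF D _ ne] unfolding ext_def by simp
  have "?G \<inter> ?P = {}" using U_R(5)[of D] unfolding pairs_def by (auto simp: mem_ports mem_cores)
  moreover have "finite ?P" using finite_pairs[where X = X] U_R ST by auto
  moreover have "finite ?G" using U_R finite_ports[OF X] finite_cores by auto
  ultimately have "card D = card ?G + card ?P" using card_Un_disjoint[of ?G ?P] unfolding D_eq[symmetric] by simp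
  moreover have "card ?P = card (pairs X (U D) T)" by (rule card_image) (auto simp: inj_on_def)
  moreover have "card ?G = (r + l) * card (U D)" by (rule card_gadgets[OF X reg U_R(3)])
  ultimately show ?thesis by simp
qed

lemma odd_boundary:
  assumes "D \<in> oc" "U D \<noteq> {}" shows "odd (card (pairs X (U D) T))"
proof -
  have "odd (card D)" using assms(1) unfolding gadget.odd_comps_def by simp
  then show ?thesis using card_comp[OF oc_cc[OF assms(1)] assms(2)] par by simp
qed

text \<open>Without an intact gadget only two kinds of elements remain: cores at \<open>S\<close>,
  and ports at \<open>T\<close>. The partner of such a port is not in the gadget of a vertex of
  \<open>R\<close>, and two partner ports at \<open>T\<close> form a component of even order 2; so
  the partner belongs to \<open>S\<close> and is deleted.\<close>

lemma small_comp_meets: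
  assumes D: "D \<in> oc" and U: "U D = {}"
  shows "D \<inter> ((\<Union>u\<in>S. cores l u) \<union> Inl ` pairs X T S) \<noteq> {}"
proof -
  have Dc: "D \<in> cc" by (rule oc_cc[OF D])
  obtain x where x: "x \<in> D" using gadget.comps_nonempty[OF Dc] by auto
  have xW: "x \<in> W" "x \<notin> B" using comp_mem[OF Dc x] by auto
  show ?thesis
  proof (cases x)
    case (Inr p)
    obtain u i where p: "p = (u, i)" by (cases p) auto
    have u: "u \<in> verts X" "i < l" "u \<notin> T" using xW Inr_gadget_verts[of u i X l] unfolding Inr p by (auto simp: Inr_B)
    have "u \<notin> R" using U_I[OF Dc _ x, of u] U u(2) unfolding Inr p by (auto simp: mem_cores)
    then have "u \<in> S" using u unfolding R_def by simp
    then have "x \<in> (\<Union>u\<in>S. cores l u)" using u(2) unfolding Inr p by (auto simp: mem_cores)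
    then show ?thesis using x by auto
  next
    case (Inl p)
    obtain v u where p: "p = (v, u)" by (cases p) auto
    have e: "{v, u} \<in> edges X" "{u, v} \<in> edges X" "v \<notin> S"
      using xW Inl_gadget_verts[OF X] unfolding Inl p by (auto simp: Inl_B insert_commute)
    note vV = edge_verts[OF X e(1)]
    have "v \<notin> R" using U_I[OF Dc _ x, of v] U e(1) unfolding Inl p by (auto simp: mem_ports)
    then have v: "v \<in> T" using vV e unfolding R_def by simp
    have "u \<in> S"
    proof (rule ccontr)
      assume uS: "u \<notin> S"
      have uD: "Inl (u, v) \<in> D" using comp_step[OF Dc x, of "Inl (u, v)"] e uS unfolding Inl p
        by (simp add: Inl_gadget_verts[OF X] Inl_B)
      then have "u \<notin> R" using U_I[OF Dc, of u] U e(2) by (auto simp: mem_ports)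
      then have u: "u \<in> T" using uS vV unfolding R_def by simp
      let ?E = "{Inl (v, u), Inl (u, v)} :: 'a gadget set"
      have "\<not> gadget_adj X a b" if "a \<in> ?E" "b \<in> D - ?E" for a b
      proof (cases b)
        case (Inl q) then show ?thesis using that by (cases q) auto
      next
        case (Inr q)
        obtain w i where q: "q = (w, i)" by (cases q) auto
        have "w \<notin> T" using comp_mem[OF Dc, of b] that Inr_gadget_verts[of w i X l] unfolding Inr q by (auto simp: Inr_B)
        then show ?thesis using that u v unfolding Inr q by auto
      qed
      then have "gadget.closed_in X D ?E" using x uD unfolding gadget.closed_in_def Inl p by simp
      moreover have "gadget.conn X D" using Dc unfolding gadget.comps_def by simp
      ultimately have "?E = D" unfolding gadget.conn_def by (metis insert_not_empty)
      moreover have "card ?E = 2" using vV(3) by simp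
      moreover have "odd (card D)" using D unfolding gadget.odd_comps_def by simp
      ultimately show False by simp
    qed
    then have "(v, u) \<in> pairs X T S" using v e(1) unfolding pairs_def by simp
    then have "x \<in> Inl ` pairs X T S" unfolding Inl p by simp
    then show ?thesis using x by auto
  qed
qed

definition big where "big = {D \<in> oc. U D \<noteq> {}}"

lemma big: "finite big" "\<And>D. D \<in> big \<Longrightarrow> D \<in> cc" "\<And>D. D \<in> big \<Longrightarrow> D \<in> oc" "\<And>D. D \<in> big \<Longrightarrow> U D \<noteq> {}"
  using fin oc_cc unfolding big_def by auto

section \<open>Counting the edges at \<open>S\<close> and \<open>T\<close>\<close>

lemma card_B: "card B = r * card S + l * card T"
proof -
  let ?P = "Inl ` pairs X S (verts X) :: 'a gadget set" and ?C = "\<Union>u\<in>T. cores l u"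
  have "x \<in> B \<longleftrightarrow> x \<in> ?P \<union> ?C" for x
  proof (cases x)
    case (Inl p)
    then show ?thesis using edge_verts(2)[OF X]
      by (cases p) (auto simp: Inl_B pairs_def mem_cores)
  next
    case (Inr p)
    then show ?thesis by (cases p) (auto simp: Inr_B mem_cores)
  qed
  then have "B = ?P \<union> ?C" by blast
  moreover have "card (?P \<union> ?C) = card ?P + card ?C"
  proof (rule card_Un_disjoint)
    show "finite ?P" using ST(4) fin(3) by (intro finite_imageI finite_pairs)
    show "finite ?C" using ST(5) finite_cores by (intro finite_UN_I)
  qed (auto simp: mem_cores)
  moreover have "card ?P = r * card S"
    using card_pairs_verts[OF X reg ST(1)] by (subst card_image) auto
  moreover have "card ?C = l * card T"
    using ST finite_cores by (subst card_UN_disjoint) (auto simp: mem_cores card_cores)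
  ultimately show ?thesis by simp
qed

lemma card_oc_le: "card oc \<le> l * card S + card (pairs X T S) + card big"
proof -
  let ?Y = "(\<Union>u\<in>S. cores l u) \<union> Inl ` pairs X T S"
  have fY: "finite ?Y" using ST finite_pairs[where X = X] finite_cores by auto
  have "card (oc - big) \<le> card ?Y"
    using small_comp_meets oc_cc
    by (intro gadget.card_comps_le_if_meet[OF fY, of _ X "W - B"]) (auto simp: big_def)
  also have "\<dots> \<le> card (\<Union>u\<in>S. cores l u) + card (Inl ` pairs X T S :: 'a gadget set)"
    by (rule card_Un_le)
  also have "card (\<Union>u\<in>S. cores l u) = l * card S"
    using ST finite_cores by (subst card_UN_disjoint) (auto simp: mem_cores card_cores)
  also have "card (Inl ` pairs X T S :: 'a gadget set) = card (pairs X T S)"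
    by (rule card_image) auto
  finally have "card (oc - big) \<le> l * card S + card (pairs X T S)" .
  moreover have "card (oc - big) = card oc - card big"
    using big by (intro card_Diff_subset) auto
  ultimately show ?thesis by linarith
qed

lemma degree_sum_ge:
  assumes A: "A \<subseteq> verts X" and C: "C \<subseteq> verts X" "C \<inter> R = {}"
  shows "card (pairs X A C) + (\<Sum>D\<in>big. card (pairs X A (U D))) \<le> r * card A"
proof -
  have fA: "finite A" "finite C"
    using A C(1) fin(3) by (auto intro: rev_finite_subset)
  have UU: "finite (\<Union>D\<in>big. U D)" "(\<Union>D\<in>big. U D) \<subseteq> R" using big(1) U_R by auto
  have "(\<Sum>D\<in>big. card (pairs X A (U D))) = card (pairs X A (\<Union>D\<in>big. U D))"
    using card_pairs_UN[OF fA(1) big(1), of U X] U_R U_disjoint big by simp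
  moreover have "card (pairs X A C) + card (pairs X A (\<Union>D\<in>big. U D)) = card (pairs X A (C \<union> (\<Union>D\<in>big. U D)))"
  proof -
    have "C \<inter> (\<Union>D\<in>big. U D) = {}" using C(2) UU(2) by auto
    then show ?thesis using card_pairs_Un[OF fA UU(1), of X] by simp
  qed
  moreover have "\<dots> \<le> card (pairs X A (verts X))"
    using finite_pairs[OF fA(1) fin(3)] C UU ST by (intro card_mono) (auto simp: pairs_def)
  ultimately show ?thesis using card_pairs_verts[OF X reg A] by simp
qed

text \<open>As \<open>l = r - k\<close>, these are the components with a positive summand
  \<open>r - k a - (r - k) b\<close>.\<close>

definition light where
  "light = {D \<in> big. (r - l) * card (pairs X (U D) S) + l * card (pairs X (U D) T) < r}"

lemma card_light: "3 \<le> card light"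
proof (rule ccontr)
  assume "\<not> 3 \<le> card light"
  define a b where "a D = int (card (pairs X (U D) S))" and "b D = int (card (pairs X (U D) T))" for D
  define e where "e = int (card (pairs X T S))"
  define k where "k = int r - int l"
  let ?r = "int r" and ?l = "int l"
  have k0: "k \<ge> 0" using l unfolding k_def by simp
  have S_ge: "e + (\<Sum>D\<in>big. a D) \<le> ?r * int (card S)"
    using degree_sum_ge[OF ST(1,2)] ST(9)
    unfolding a_def e_def card_pairs_commute[of X _ S]
    by (simp add: Int_commute flip: of_nat_sum of_nat_add of_nat_mult)
  have T_ge: "e + (\<Sum>D\<in>big. b D) \<le> ?r * int (card T)"
    using degree_sum_ge[OF ST(2,1)] ST(8)
    unfolding b_def e_def card_pairs_commute[of X _ T]
    by (simp add: Int_commute card_pairs_commute[of X S T] flip: of_nat_sum of_nat_add of_nat_mult)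
  have "?r * int (card S) + ?l * int (card T) + 2 \<le> ?l * int (card S) + e + int (card big)"
  proof -
    have "r * card S + l * card T + 2 \<le> l * card S + card (pairs X T S) + card big"
      using gap card_oc_le card_B by linarith
    then have "int (r * card S + l * card T + 2) \<le> int (l * card S + card (pairs X T S) + card big)"
      by (simp only: of_nat_le_iff)
    then show ?thesis unfolding e_def by simp
  qed
  then have "k * int (card S) + ?l * int (card T) + 2 \<le> e + int (card big)"
    unfolding k_def by (simp add: left_diff_distrib)
  \<comment> \<open>The barrier inequality is scaled by \<open>r\<close>, the edge counts at
    \<open>S\<close> and \<open>T\<close> by \<open>k\<close> and \<open>l\<close>; since
    \<open>k + l = r\<close>, the edges between \<open>S\<close> and \<open>T\<close> cancel in the
    sum.\<close>
  then have "?r * (k * int (card S) + ?l * int (card T) + 2) \<le> ?r * (e + int (card big))"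
    by (rule mult_left_mono) simp
  moreover have "k * (e + (\<Sum>D\<in>big. a D)) \<le> k * (?r * int (card S))"
    using S_ge k0 by (rule mult_left_mono)
  moreover have "?l * (e + (\<Sum>D\<in>big. b D)) \<le> ?l * (?r * int (card T))"
    using T_ge by (rule mult_left_mono) simp
  moreover have "k * e + ?l * e = ?r * e" unfolding k_def by (simp add: left_diff_distrib)
  ultimately have "k * (\<Sum>D\<in>big. a D) + ?l * (\<Sum>D\<in>big. b D) + 2 * ?r \<le> ?r * int (card big)"
    by (simp add: algebra_simps)
  then have ge: "2 * ?r \<le> (\<Sum>D\<in>big. ?r - k * a D - ?l * b D)"
    by (simp add: sum_subtractf sum_distrib_left mult.commute)
  have "(\<Sum>D\<in>big. ?r - k * a D - ?l * b D) \<le> (\<Sum>D\<in>big. if D \<in> light then ?r - 1 else 0)"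
  proof (rule sum_mono)
    fix D assume D: "D \<in> big"
    have "odd (card (pairs X (U D) T))" using odd_boundary big D by auto
    then have "b D \<ge> 1" unfolding b_def by (cases "card (pairs X (U D) T)") auto
    then have "?l * b D \<ge> 1" using l by (simp add: int_one_le_iff_zero_less)
    moreover have "k * a D \<ge> 0" using k0 unfolding a_def by simp
    moreover have "D \<in> light \<longleftrightarrow> k * a D + ?l * b D < ?r"
      using D l unfolding light_def a_def b_def k_def
      by (simp flip: of_nat_diff of_nat_mult of_nat_add)
    ultimately show "?r - k * a D - ?l * b D \<le> (if D \<in> light then ?r - 1 else 0)" by auto
  qed
  also have "\<dots> = int (card light) * (?r - 1)"
    using big(1) by (simp add: sum.If_cases light_def Int_def conj_commute)
  also have "\<dots> \<le> 2 * (?r - 1)"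
    using \<open>\<not> 3 \<le> card light\<close> l by (intro mult_right_mono) auto
  finally show False using ge by simp
qed

text \<open>An edge to \<open>S\<close>, together with the edge to \<open>T\<close> that oddness
  provides, would contribute at least \<open>(r - l) + l = r\<close>.\<close>

lemma light:
  assumes "D \<in> light"
  shows "card (pairs X (U D) S) = 0" "odd (card (pairs X (U D) T))" "l * card (pairs X (U D) T) < r"
proof -
  have D: "D \<in> big" and lt: "(r - l) * card (pairs X (U D) S) + l * card (pairs X (U D) T) < r"
    using assms unfolding light_def by auto
  show od: "odd (card (pairs X (U D) T))" using odd_boundary big D by auto
  show "l * card (pairs X (U D) T) < r" using lt by simp
  show "card (pairs X (U D) S) = 0"
  proof (rule ccontr)
    assume "card (pairs X (U D) S) \<noteq> 0"
    then have "r - l \<le> (r - l) * card (pairs X (U D) S)" by simp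
    moreover have "l \<le> l * card (pairs X (U D) T)" using od odd_pos[OF od] by simp
    ultimately show False using lt l by linarith
  qed
qed

lemma light_boundary:
  assumes "D \<in> light"
  shows "card (pairs X (U D) (verts X - U D)) = card (pairs X (U D) T)"
proof -
  have D: "D \<in> cc" using assms big unfolding light_def by auto
  have "finite (pairs X (U D) S)" using finite_pairs[where X = X] U_R ST by auto
  then have "pairs X (U D) S = {}" using light(1)[OF assms] by simp
  then have "u \<in> U D \<Longrightarrow> {u, v} \<in> edges X \<Longrightarrow> v \<notin> S" for u v unfolding pairs_def by auto
  then have "pairs X (U D) (verts X - U D) = pairs X (U D) T"
    using U_closed[OF D] U_R[of D] ST(2) unfolding pairs_def R_def by auto
  then show ?thesis by simp
qed

end

text \<open>What remains of a light component once the barrier is forgotten: no edge goes to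
  \<open>S\<close>, so the edges to \<open>T\<close> are its whole boundary. The middle condition is
  connectedness in the form of \<open>conn\<close>.\<close>

definition thin :: "'a ugraph \<Rightarrow> nat \<Rightarrow> nat \<Rightarrow> 'a set \<Rightarrow> bool" where
  "thin X r l U \<longleftrightarrow> U \<subseteq> verts X \<and> U \<noteq> {} \<and>
    (\<forall>Z\<subseteq>U. Z \<noteq> {} \<longrightarrow> (\<forall>u\<in>Z. \<forall>v\<in>U. {u, v} \<in> edges X \<longrightarrow> v \<in> Z) \<longrightarrow> Z = U) \<and>
    odd (card (pairs X U (verts X - U))) \<and> l * card (pairs X U (verts X - U)) < r"

definition separated :: "'a ugraph \<Rightarrow> 'a set \<Rightarrow> 'a set \<Rightarrow> bool" where
  "separated X A B \<longleftrightarrow> A \<inter> B = {} \<and> pairs X A B = {}"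

theorem three_thin_sets_if_no_factor:
  assumes X: "simple_graph X" and reg: "regular_graph r X" and k: "even k" "k < r"
    and no: "\<not> (\<exists>F. is_factor k X F)"
  obtains A B C where "thin X r (r - k) A" "thin X r (r - k) B" "thin X r (r - k) C"
    "separated X A B" "separated X A C" "separated X B C"
proof -
  let ?l = "r - k"
  have "card (gadget_verts X ?l) = (r + ?l) * card (verts X)"
    unfolding gadget_verts_def by (rule card_gadgets[OF X reg order_refl])
  moreover have par: "even (r + ?l)" using k by simp
  ultimately have ev: "even (card (gadget_verts X ?l))" by simp
  have "\<not> (\<exists>p. gadget.perfect_matching X (gadget_verts X ?l) p)"
    using factor_if_gadget_matching[OF X reg, of ?l] no k by auto
  then obtain B where "B \<subseteq> gadget_verts X ?l"
    "card B + 2 \<le> card (gadget.odd_comps X (gadget_verts X ?l - B))"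
    "\<And>s. s \<in> B \<Longrightarrow>
      3 \<le> card {D \<in> gadget.odd_comps X (gadget_verts X ?l - B). \<exists>x\<in>D. gadget_adj X s x}"
    using gadget.barrier_exists[OF finite_gadget_verts[OF X] ev] by blast
  then interpret gadget_barrier X r ?l B using X reg k par by unfold_locales auto
  obtain L where "L \<subseteq> light" "card L = 3" using card_light by (meson obtain_subset_with_card_n)
  then obtain D1 D2 D3 where D: "D1 \<in> light" "D2 \<in> light" "D3 \<in> light" "D1 \<noteq> D2" "D1 \<noteq> D3" "D2 \<noteq> D3"
    by (auto simp: card_3_iff)
  have cc: "D \<in> cc" and ne: "U D \<noteq> {}" if "D \<in> light" for D
    using that big unfolding light_def by auto
  have "thin X r ?l (U D)" if "D \<in> light" for D
    unfolding thin_def light_boundary[OF that]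
    using U_R(3) ne[OF that] light[OF that] U_connected[OF cc[OF that]] by simp
  moreover have "separated X (U D) (U D')" if "D \<in> light" "D' \<in> light" "D \<noteq> D'" for D D'
  proof -
    have dis: "U D \<inter> U D' = {}" using U_disjoint[OF cc cc] that by simp
    have "pairs X (U D) (U D') = {}"
    proof (rule ccontr)
      assume "pairs X (U D) (U D') \<noteq> {}"
      then obtain u v where "u \<in> U D" "v \<in> U D'" "{u, v} \<in> edges X" unfolding pairs_def by auto
      then show False using U_closed[OF cc[OF that(1)], of u v] U_R(1)[of D'] dis by auto
    qed
    then show ?thesis using dis unfolding separated_def by simp
  qed
  ultimately show thesis using D by (intro that[of "U D1" "U D2" "U D3"]) simp_all
qed

subsection \<open>Spectra of real symmetric matrices and graphs\<close>

lemma mult_mat_vec_sum: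
  assumes "A \<in> carrier_mat n n" "v \<in> carrier_vec n" "i < n"
  shows "(A *\<^sub>v v) $ i = (\<Sum>j<n. A $$ (i, j) * v $ j)"
  using assms by (auto simp: scalar_prod_def atLeast0LessThan intro!: sum.cong)

lemma scalar_prod_self:
  "v \<in> carrier_vec n \<Longrightarrow> v \<bullet> v = (\<Sum>i<n. (v $ i)\<^sup>2)" for v :: "real vec"
  by (auto simp: scalar_prod_def atLeast0LessThan power2_eq_square)

text \<open>For a complex eigenvector \<open>v\<close> to \<open>a\<close>, the Hermitian form
  \<open>Q\<close> equals \<open>a * S\<close>, where \<open>S\<close> is the squared norm of
  \<open>v\<close>. Symmetry makes \<open>Q\<close> invariant under conjugation and \<open>S\<close>
  is real and nonzero, so \<open>a\<close> is real.\<close>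

lemma real_sym_char_poly_splits:
  fixes A :: "real mat"
  assumes A: "A \<in> carrier_mat n n" and sym: "\<And>i j. i < n \<Longrightarrow> j < n \<Longrightarrow> A $$ (i, j) = A $$ (j, i)"
  shows "\<exists>es. char_poly A = (\<Prod>e\<leftarrow>es. [:- e, 1:]) \<and> length es = n"
proof -
  let ?C = "map_mat complex_of_real A"
  have C: "?C \<in> carrier_mat n n" using A by auto
  obtain as where as: "char_poly ?C = (\<Prod>a\<leftarrow>as. [:- a, 1:])" "length as = n"
    using char_poly_factorized[OF C] by auto
  have real: "a \<in> \<real>" if "a \<in> set as" for a
  proof -
    have "poly (char_poly ?C) a = 0"
      unfolding as(1) using that by (induct as) auto
    then have "eigenvalue ?C a" using eigenvalue_root_char_poly[OF C] by simp
    then obtain v where v: "v \<in> carrier_vec n" "v \<noteq> 0\<^sub>v n" "?C *\<^sub>v v = a \<cdot>\<^sub>v v"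
      using C unfolding eigenvalue_def eigenvector_def by auto
    have row: "(\<Sum>j<n. complex_of_real (A $$ (i, j)) * v $ j) = a * v $ i" if "i < n" for i
    proof -
      have "(?C *\<^sub>v v) $ i = (\<Sum>j<n. complex_of_real (A $$ (i, j)) * v $ j)"
        using mult_mat_vec_sum[OF C v(1) that] that A by (auto intro!: sum.cong)
      then show ?thesis using v that by auto
    qed
    define S where "S = (\<Sum>i<n. cnj (v $ i) * v $ i)"
    define Q where "Q = (\<Sum>i<n. cnj (v $ i) * (\<Sum>j<n. complex_of_real (A $$ (i, j)) * v $ j))"
    have Q1: "Q = a * S" unfolding Q_def S_def sum_distrib_left
      by (rule sum.cong) (auto simp: row sum_distrib_left[symmetric])
    have "cnj Q = (\<Sum>i<n. \<Sum>j<n. v $ i * (complex_of_real (A $$ (i, j)) * cnj (v $ j)))"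
      unfolding Q_def by (simp add: sum_distrib_left)
    also have "\<dots> = (\<Sum>j<n. \<Sum>i<n. v $ i * (complex_of_real (A $$ (i, j)) * cnj (v $ j)))"
      by (rule sum.swap)
    also have "\<dots> = Q"
      unfolding Q_def sum_distrib_left using sym by (auto intro!: sum.cong)
    finally have "cnj Q = Q" .
    have Sr: "S = of_real (\<Sum>i<n. (cmod (v $ i))\<^sup>2)"
      unfolding S_def of_real_sum
      by (rule sum.cong) (auto simp: complex_norm_square mult.commute simp del: of_real_power)
    obtain i where i: "i < n" "v $ i \<noteq> 0" using v(1,2) by (metis carrier_vecD eq_vecI index_zero_vec)
    have "(\<Sum>i<n. (cmod (v $ i))\<^sup>2) > 0"
      by (rule sum_pos2[of _ i]) (use i in auto)
    then have "S \<noteq> 0" unfolding Sr of_real_eq_0_iff by simp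
    moreover have "cnj S = S" unfolding Sr by simp
    ultimately have "cnj a = a" using \<open>cnj Q = Q\<close> unfolding Q1 by simp
    then show "a \<in> \<real>" by (simp add: Reals_cnj_iff)
  qed
  define es where "es = map Re as"
  have as_es: "as = map complex_of_real es" unfolding es_def map_map
    by (rule map_idI[symmetric]) (use real in \<open>auto simp: of_real_Re\<close>)
  have "map_poly complex_of_real (char_poly A) = char_poly ?C"
    by (rule of_real_hom.char_poly_hom[OF A, symmetric])
  also have "\<dots> = (\<Prod>e\<leftarrow>es. map_poly complex_of_real [:- e, 1:])"
    unfolding as(1) as_es map_map by (intro arg_cong[of _ _ prod_list] map_cong) auto
  also have "\<dots> = map_poly complex_of_real (\<Prod>e\<leftarrow>es. [:- e, 1:])"
    by (induct es) (auto intro!: poly_eqI simp: coeff_map_poly coeff_pCons split: nat.split)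
  finally have "char_poly A = (\<Prod>e\<leftarrow>es. [:- e, 1:])"
    by (simp add: poly_eq_iff coeff_map_poly)
  moreover have "length es = n" using as(2) es_def by simp
  ultimately show ?thesis by blast
qed

lemma jordan_matrix_size_one:
  assumes "\<forall>(k, e)\<in>set n_as. k = 1"
  shows "i < length n_as \<Longrightarrow> j < length n_as \<Longrightarrow>
    jordan_matrix n_as $$ (i, j) = (if i = j then snd (n_as ! i) else 0)"
  using assms
proof (induct n_as arbitrary: i j)
  case (Cons ne n_as)
  obtain e where ne: "ne = (1, e)" using Cons(4) by (cases ne) auto
  have "sum_list (map fst n_as) = (\<Sum>_\<leftarrow>n_as. 1)"
    using Cons(4) by (intro arg_cong[of _ _ sum_list] map_cong) auto
  then have len: "sum_list (map fst n_as) = length n_as" by (simp only: sum_list_triv) simp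
  have "jordan_matrix n_as $$ (i', j') = (if i' = j' then snd (n_as ! i') else 0)"
    if "i' < length n_as" "j' < length n_as" for i' j'
    using Cons(1)[OF that] Cons(4) by auto
  then show ?case unfolding ne jordan_matrix_Cons
    using Cons(2,3) by (auto simp: len jordan_block_def nth_Cons' split: if_splits)
qed simp

text \<open>The squared length of \<open>M *\<^sub>v x\<close> is the scalar product of
  \<open>M * M *\<^sub>v x\<close> with \<open>x\<close>. Applied to \<open>A - e\<close> this
  excludes Jordan blocks of size above 1.\<close>

lemma real_sym_kernel_square:
  fixes M :: "real mat"
  assumes M: "M \<in> carrier_mat n n" and sym: "transpose_mat M = M"
  shows "mat_kernel (M * M) = mat_kernel M"
proof -
  have "M *\<^sub>v x = 0\<^sub>v n" if x: "x \<in> carrier_vec n" "M * M *\<^sub>v x = 0\<^sub>v n" for x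
  proof -
    have Mx: "M *\<^sub>v x \<in> carrier_vec n" using M x by auto
    have "(M *\<^sub>v x) \<bullet> (M *\<^sub>v x) = (transpose_mat M *\<^sub>v (M *\<^sub>v x)) \<bullet> x"
      using transpose_vec_mult_scalar[OF M x(1) Mx] by simp
    also have "\<dots> = 0" unfolding sym assoc_mult_mat_vec[OF M M x(1), symmetric] x(2) using x by simp
    finally have "(\<Sum>i<n. ((M *\<^sub>v x) $ i)\<^sup>2) = 0"
      using scalar_prod_self[OF Mx] by simp
    then have "\<forall>i<n. (M *\<^sub>v x) $ i = 0" by (subst (asm) sum_nonneg_eq_0_iff) auto
    then show ?thesis using Mx M by (intro eq_vecI) auto
  qed
  then show ?thesis using M unfolding mat_kernel_def
    by (auto simp: assoc_mult_mat_vec[OF M M])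
qed

text \<open>The kernels of the first and second power of \<open>A - e\<close> have as dimensions the
  sums of \<open>min 1\<close> and \<open>min 2\<close> over the sizes of the Jordan blocks to
  \<open>e\<close>. They agree by \<open>real_sym_kernel_square\<close>, so all blocks have size 1.
  The matrix \<open>P\<close> need not be orthogonal.\<close>

lemma real_sym_diagonalization:
  fixes A :: "real mat"
  assumes A: "A \<in> carrier_mat n n" and sym: "transpose_mat A = A"
  obtains es P Q where "char_poly A = (\<Prod>e\<leftarrow>es. [:- e, 1:])" "length es = n"
    "similar_mat_wit A (mat n n (\<lambda>(i, j). if i = j then es ! i else 0)) P Q"
proof -
  have sym': "A $$ (i, j) = A $$ (j, i)" if "i < n" "j < n" for i j
    using arg_cong[OF sym, of "\<lambda>M. M $$ (i, j)"] A that by auto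
  obtain n_as where jnf: "jordan_nf A n_as"
    using real_sym_char_poly_splits[OF A sym'] jordan_nf_exists[OF A] by blast
  have one: "k = 1" if ke: "(k, e) \<in> set n_as" for k e
  proof (rule ccontr)
    assume "k \<noteq> 1"
    define M where "M = char_matrix A e"
    define L where "L = map fst (filter (\<lambda>(k, e'). e' = e) n_as)"
    have M: "M \<in> carrier_mat n n" using A unfolding M_def by auto
    have "transpose_mat M = M" unfolding M_def char_matrix_def using A sym'
      by (intro eq_matI) auto
    then have "mat_kernel (M * M) = mat_kernel M" by (rule real_sym_kernel_square[OF M])
    moreover have "M ^\<^sub>m 1 = M" "M ^\<^sub>m 2 = M * M" using M by (auto simp: numeral_2_eq_2)
    ultimately have "dim_gen_eigenspace A e 1 = dim_gen_eigenspace A e 2"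
      unfolding dim_gen_eigenspace_def M_def[symmetric] kernel_dim_def using M by simp
    then have "sum_list (map (min 1) L) = sum_list (map (min 2) L)"
      unfolding dim_gen_eigenspace[OF jnf] L_def by simp
    moreover have "sum_list (map (min 1) L) < sum_list (map (min 2) L)"
    proof -
      have "k \<in> set L" using ke unfolding L_def by force
      moreover have "k \<noteq> 0" using jnf ke unfolding jordan_nf_def by force
      ultimately have "k \<ge> 2" using \<open>k \<noteq> 1\<close> by simp
      obtain as bs where L: "L = as @ k # bs" using \<open>k \<in> set L\<close> by (meson split_list)
      have "sum_list (map (min 1) L) \<le> sum_list (map (min 2) L)" for L :: "nat list"
        by (rule sum_list_mono) auto
      from this[of as] this[of bs] show ?thesis using \<open>k \<ge> 2\<close> unfolding L by simp
    qed
    ultimately show False by simp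
  qed
  let ?es = "map snd n_as"
  obtain P Q where wit: "similar_mat_wit A (jordan_matrix n_as) P Q"
    using jnf unfolding jordan_nf_def similar_mat_def by auto
  have dim: "jordan_matrix n_as \<in> carrier_mat n n" using similar_mat_witD2[OF A wit] by auto
  have "sum_list (map fst n_as) = (\<Sum>_\<leftarrow>n_as. 1)"
    using one by (intro arg_cong[of _ _ sum_list] map_cong) auto
  then have "sum_list (map fst n_as) = length n_as" by (simp only: sum_list_triv) simp
  then have len: "length n_as = n" using dim by auto
  have "jordan_matrix n_as = mat n n (\<lambda>(i, j). if i = j then ?es ! i else 0)"
    using dim len jordan_matrix_size_one[of n_as] one by (intro eq_matI) fastforce+
  moreover have "char_poly A = (\<Prod>e\<leftarrow>?es. [:- e, 1:])"
    unfolding jordan_nf_char_poly[OF jnf] map_map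
    using one by (intro arg_cong[of _ _ prod_list] map_cong) fastforce+
  ultimately show thesis using that[of ?es P Q] wit len by simp
qed

lemma scalar_prod_mult_mat_vec:
  fixes P :: "real mat"
  assumes P: "P \<in> carrier_mat n n" and "y \<in> carrier_vec n" "z \<in> carrier_vec n"
  shows "(P *\<^sub>v y) \<bullet> (P *\<^sub>v z) = (\<Sum>i<n. \<Sum>j<n. y $ i * z $ j * (transpose_mat P * P) $$ (i, j))"
proof -
  have "(P *\<^sub>v y) \<bullet> (P *\<^sub>v z) = y \<bullet> (transpose_mat P *\<^sub>v (P *\<^sub>v z))"
    using transpose_vec_mult_scalar[of "P" n n y "P *\<^sub>v z"] assms
    by (metis comm_scalar_prod mult_mat_vec_carrier transpose_carrier_mat)
  also have "\<dots> = y \<bullet> ((transpose_mat P * P) *\<^sub>v z)" using assms by auto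
  also have "\<dots> = (\<Sum>i<n. y $ i * (\<Sum>j<n. (transpose_mat P * P) $$ (i, j) * z $ j))"
    using assms mult_mat_vec_sum[of "transpose_mat P * P" n z]
    by (auto simp: scalar_prod_def[of y] atLeast0LessThan intro!: sum.cong)
  finally show ?thesis by (simp add: sum_distrib_left mult_ac)
qed

text \<open>The weights \<open>c - es ! j\<close> can be split symmetrically as products of square roots because
  eigenvectors to different eigenvalues are orthogonal; no orthonormal basis is needed.\<close>

lemma quadratic_form_less_if_small_eigenvalues:
  fixes A :: "real mat"
  assumes A: "A \<in> carrier_mat n n" and sym: "transpose_mat A = A"
    and wit: "similar_mat_wit A (mat n n (\<lambda>(i, j). if i = j then es ! i else 0)) P Q"
    and x: "x \<in> carrier_vec n" "x \<noteq> 0\<^sub>v n"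
    and zero: "\<And>i. i < n \<Longrightarrow> es ! i \<ge> c \<Longrightarrow> (Q *\<^sub>v x) $ i = 0"
  shows "x \<bullet> (A *\<^sub>v x) < c * (x \<bullet> x)"
proof -
  define D where "D = mat n n (\<lambda>(i, j). if i = j then es ! i else 0)"
  note wit = wit[folded D_def]
  have P: "P \<in> carrier_mat n n" and Q: "Q \<in> carrier_mat n n" and D: "D \<in> carrier_mat n n"
    and PQ: "P * Q = 1\<^sub>m n" and QP: "Q * P = 1\<^sub>m n" and APDQ: "A = P * D * Q"
    using similar_mat_witD2[OF A wit] by auto
  have Pt: "transpose_mat P \<in> carrier_mat n n" using P by auto
  define B where "B = transpose_mat P * P"
  have B: "B \<in> carrier_mat n n" using P unfolding B_def by auto
  have AP: "A * P = P * D"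
  proof -
    have "A * P = P * D * (Q * P)" unfolding APDQ using P Q D by (intro assoc_mult_mat) auto
    then show ?thesis using QP P D by simp
  qed
  have BD: "B * D = transpose_mat P * (A * P)" unfolding B_def AP using P D Pt by simp
  have "transpose_mat (B * D) = transpose_mat (transpose_mat P * A * P)"
    unfolding BD using A P Pt by simp
  also have "\<dots> = transpose_mat P * (A * P)"
    using A P Pt sym by (simp add: transpose_mult[of _ n n _ n])
  \<comment> \<open>Symmetry of \<open>A\<close> makes the Gram matrix \<open>B\<close> commute with
    \<open>D\<close> entrywise: \<open>B $$ (i, j)\<close> times \<open>es ! j\<close> equals
    \<open>B $$ (i, j)\<close> times \<open>es ! i\<close>, which is orthogonality for different
    eigenvalues.\<close>
  finally have tBD: "transpose_mat (B * D) = B * D" unfolding BD .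
  have BDij: "(B * D) $$ (i, j) = B $$ (i, j) * es ! j" if "i < n" "j < n" for i j
  proof -
    have "(B * D) $$ (i, j) = (\<Sum>l<n. B $$ (i, l) * (if l = j then es ! l else 0))"
      using that B unfolding D_def by (auto simp: scalar_prod_def atLeast0LessThan)
    also have "\<dots> = B $$ (i, j) * es ! j" using that by (subst sum.remove[of _ j]) auto
    finally show ?thesis .
  qed
  have Bsym: "B $$ (i, j) = B $$ (j, i)" if "i < n" "j < n" for i j
    using that P unfolding B_def by (simp add: comm_scalar_prod[of _ n])
  have orth: "B $$ (i, j) = 0" if "i < n" "j < n" "es ! i \<noteq> es ! j" for i j
  proof -
    have "B $$ (i, j) * es ! j = B $$ (j, i) * es ! i"
      using arg_cong[OF tBD, of "\<lambda>M. M $$ (i, j)"] that BDij B D by simp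
    then show ?thesis using that Bsym by auto
  qed
  define y where "y = Q *\<^sub>v x"
  have y: "y \<in> carrier_vec n" using Q x unfolding y_def by auto
  have Py: "x = P *\<^sub>v y" unfolding y_def using P Q x PQ by (metis assoc_mult_mat_vec one_mult_mat_vec)
  have Dy: "D *\<^sub>v y \<in> carrier_vec n" using D y by auto
  have Dyi: "(D *\<^sub>v y) $ i = es ! i * y $ i" if "i < n" for i
  proof -
    have "(D *\<^sub>v y) $ i = (\<Sum>l<n. (if i = l then es ! i else 0) * y $ l)"
      using mult_mat_vec_sum[OF D y that] that unfolding D_def by simp
    also have "\<dots> = es ! i * y $ i" using that by (subst sum.remove[of _ i]) auto
    finally show ?thesis .
  qed
  have Ax: "A *\<^sub>v x = P *\<^sub>v (D *\<^sub>v y)"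
    unfolding Py using A P D y AP by (metis assoc_mult_mat_vec)
  \<comment> \<open>Chosen so that the squared length of \<open>P *\<^sub>v z\<close> is
    \<open>c * (x \<bullet> x) - x \<bullet> (A *\<^sub>v x)\<close>. Where
    \<open>c - es ! i\<close> is negative the value of \<open>sqrt\<close> is harmless, because
    \<open>y $ i = 0\<close> there.\<close>
  define z where "z = vec n (\<lambda>i. y $ i * sqrt (c - es ! i))"
  have z: "z \<in> carrier_vec n" unfolding z_def by auto
  have "(P *\<^sub>v z) \<bullet> (P *\<^sub>v z) = (\<Sum>i<n. \<Sum>j<n. c * (y $ i * y $ j * B $$ (i, j)) - y $ i * (D *\<^sub>v y) $ j * B $$ (i, j))"
    unfolding scalar_prod_mult_mat_vec[OF P z z, folded B_def]
  proof (intro sum.cong refl, goal_cases)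
    case (1 i j)
    then have ij: "i < n" "j < n" by auto
    show ?case
    proof (cases "es ! i = es ! j \<and> es ! i < c")
      case True
      then have "sqrt (c - es ! i) * sqrt (c - es ! j) = c - es ! j" by simp
      then have zz: "z $ i * z $ j = (c - es ! j) * (y $ i * y $ j)"
        unfolding z_def using ij by (simp add: mult.assoc mult.left_commute)
      show ?thesis unfolding Dyi[OF ij(2)] zz by (simp add: algebra_simps)
    next
      case False
      then have "B $$ (i, j) = 0 \<or> y $ i = 0" using orth[OF ij] zero[OF ij(1)] unfolding y_def by force
      then show ?thesis using ij unfolding z_def by auto
    qed
  qed
  also have "\<dots> = c * (x \<bullet> x) - x \<bullet> (A *\<^sub>v x)"
    unfolding Ax unfolding Py scalar_prod_mult_mat_vec[OF P y y, folded B_def]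
      scalar_prod_mult_mat_vec[OF P y Dy, folded B_def]
    by (simp add: sum_subtractf sum_distrib_left)
  finally have eq: "c * (x \<bullet> x) - x \<bullet> (A *\<^sub>v x) = (P *\<^sub>v z) \<bullet> (P *\<^sub>v z)" by simp
  have "P *\<^sub>v z \<noteq> 0\<^sub>v n"
  proof
    assume "P *\<^sub>v z = 0\<^sub>v n"
    then have "Q *\<^sub>v (P *\<^sub>v z) = 0\<^sub>v n" using Q by auto
    then have z0: "z = 0\<^sub>v n" using Q P z QP by (metis assoc_mult_mat_vec one_mult_mat_vec)
    have "y $ i = 0" if "i < n" for i
    proof (cases "es ! i \<ge> c")
      case True then show ?thesis using zero that unfolding y_def by simp
    next
      case False
      have "y $ i * sqrt (c - es ! i) = 0"
        using arg_cong[OF z0, of "\<lambda>v. v $ i"] that unfolding z_def by simp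
      then show ?thesis using False by simp
    qed
    then have "y = 0\<^sub>v n" using y by (intro eq_vecI) auto
    then show False using x(2) P unfolding Py by auto
  qed
  then have "(P *\<^sub>v z) \<bullet> (P *\<^sub>v z) > 0"
  proof -
    obtain i where i: "i < n" "(P *\<^sub>v z) $ i \<noteq> 0"
      using \<open>P *\<^sub>v z \<noteq> 0\<^sub>v n\<close> P z by (metis carrier_matD(1) dim_mult_mat_vec eq_vecI index_zero_vec)
    have "(\<Sum>i<n. ((P *\<^sub>v z) $ i)\<^sup>2) > 0" by (rule sum_pos2[of _ i]) (use i in auto)
    then show ?thesis using scalar_prod_self[of "P *\<^sub>v z" n] P z by simp
  qed
  then show ?thesis using eq by simp
qed

section \<open>Eigenvalues of graphs and test functions\<close>

lemma proots_linear_factors: "proots (\<Prod>e\<leftarrow>es. [:- e, 1:]) = mset es" for es :: "real list"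
proof (induct es)
  case (Cons e es)
  have "(\<Prod>e\<leftarrow>es. [:- e, 1:]) \<noteq> (0 :: real poly)" by (auto simp: prod_list_zero_iff)
  then show ?case using Cons by (simp add: proots_mult del: mult_pCons_left)
qed simp

text \<open>If entry \<open>j\<close> of the descending list were below \<open>c\<close>, so would
  be all later ones, leaving at most the \<open>j\<close> entries before it. Positions count from 0,
  so the third eigenvalue is \<open>j = 2\<close>.\<close>

lemma nth_rev_sort_ge:
  fixes es :: "'b::linorder list"
  assumes "card {i. i < length es \<and> es ! i \<ge> c} > j"
  shows "rev (sort es) ! j \<ge> c"
proof (rule ccontr)
  let ?L = "rev (sort es)"
  assume "\<not> ?L ! j \<ge> c"
  moreover have "sorted_wrt (\<ge>) ?L" by (simp add: sorted_wrt_rev)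
  ultimately have "l < j" if "l < length es" "?L ! l \<ge> c" for l
    using that sorted_wrt_nth_less[of "(\<ge>)" ?L j l]
    by (metis dual_order.trans length_rev length_sort linorder_neqE_nat)
  then have "{i. i < length ?L \<and> ?L ! i \<ge> c} \<subseteq> {..<j}" by auto
  then have "card {i. i < length ?L \<and> ?L ! i \<ge> c} \<le> j"
    using card_mono[of "{..<j}"] by fastforce
  moreover have "card {i. i < length ?L \<and> ?L ! i \<ge> c} = card {i. i < length es \<and> es ! i \<ge> c}"
  proof -
    have "mset (filter (\<lambda>e. e \<ge> c) ?L) = mset (filter (\<lambda>e. e \<ge> c) es)" by simp
    then have "length (filter (\<lambda>e. e \<ge> c) ?L) = length (filter (\<lambda>e. e \<ge> c) es)"
      by (metis size_mset)
    then show ?thesis unfolding length_filter_conv_card .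
  qed
  ultimately show False using assms by simp
qed

definition adj_form :: "'a ugraph \<Rightarrow> ('a \<Rightarrow> real) \<Rightarrow> real" where
  "adj_form X f = (\<Sum>u\<in>verts X. \<Sum>v\<in>verts X. if {u, v} \<in> edges X then f u * f v else 0)"

lemma sum_nth_distinct:
  assumes "distinct vs" shows "(\<Sum>i<length vs. g (vs ! i)) = (\<Sum>v\<in>set vs. g v)"
  by (rule sum.reindex_bij_betw[OF bij_betw_nth[OF assms refl refl]])

lemma vertex_list:
  assumes "finite (verts X)"
  shows "distinct (vertex_list X)" "set (vertex_list X) = verts X"
proof -
  have "distinct (vertex_list X) \<and> set (vertex_list X) = verts X"
    unfolding vertex_list_def by (rule someI_ex) (use finite_distinct_list[OF assms] in auto)
  then show "distinct (vertex_list X)" "set (vertex_list X) = verts X" by auto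
qed

lemma adj_matrix_sym: "transpose_mat (adj_matrix vs X) = adj_matrix vs X"
  unfolding adj_matrix_def by (intro eq_matI) (auto simp: insert_commute)

text \<open>Hides the matrices: row \<open>i\<close> of \<open>Q\<close> is the coordinate
  functional of the \<open>i\<close>-th eigenvector. Lower bounds for eigenvalues then reduce to
  solving homogeneous linear equations, one for each eigenvalue that is at least
  \<open>c\<close>.\<close>

lemma graph_spectrum:
  assumes fin: "finite (verts X)"
  obtains es and Q :: "nat \<Rightarrow> nat \<Rightarrow> real" and vs where
    "adj_char_poly X = (\<Prod>e\<leftarrow>es. [:- e, 1:])"
    "length es = graph_order X" "length vs = graph_order X" "graph_eigenvalues X = rev (sort es)"
    "\<forall>f c. (\<exists>v\<in>verts X. f v \<noteq> 0) \<longrightarrow>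
      (\<forall>i<length es. es ! i \<ge> c \<longrightarrow> (\<Sum>l<length vs. Q i l * f (vs ! l)) = 0) \<longrightarrow>
      adj_form X f < c * (\<Sum>v\<in>verts X. (f v)\<^sup>2)"
proof -
  let ?vs = "vertex_list X" let ?n = "length ?vs" let ?A = "adj_matrix ?vs X"
  note vs = vertex_list[OF fin]
  have n: "?n = graph_order X" using distinct_card[OF vs(1)] unfolding graph_order_def vs(2) by simp
  have A: "?A \<in> carrier_mat ?n ?n" unfolding adj_matrix_def by auto
  obtain es P Q where cp: "char_poly ?A = (\<Prod>e\<leftarrow>es. [:- e, 1:])" and len: "length es = ?n"
    and wit: "similar_mat_wit ?A (mat ?n ?n (\<lambda>(i, j). if i = j then es ! i else 0)) P Q"
    using real_sym_diagonalization[OF A adj_matrix_sym] by blast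
  have Q: "Q \<in> carrier_mat ?n ?n" using similar_mat_witD2[OF A wit] by auto
  have eig: "graph_eigenvalues X = rev (sort es)"
    unfolding graph_eigenvalues_def adj_char_poly_def cp proots_linear_factors by simp
  have form: "adj_form X f < c * (\<Sum>v\<in>verts X. (f v)\<^sup>2)"
    if nz: "\<exists>v\<in>verts X. f v \<noteq> 0"
      and z: "\<And>i. i < length es \<Longrightarrow> es ! i \<ge> c \<Longrightarrow> (\<Sum>l<?n. Q $$ (i, l) * f (?vs ! l)) = 0" for f c
  proof -
    define x where "x = vec ?n (\<lambda>i. f (?vs ! i))"
    have x: "x \<in> carrier_vec ?n" unfolding x_def by auto
    obtain i where i: "i < ?n" "f (?vs ! i) \<noteq> 0"
    proof -
      obtain v where "v \<in> set ?vs" "f v \<noteq> 0" using nz vs(2) by auto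
      then show thesis using that unfolding in_set_conv_nth by auto
    qed
    then have "x $ i \<noteq> 0" unfolding x_def by simp
    then have x0: "x \<noteq> 0\<^sub>v ?n" using i by auto
    have "x \<bullet> (?A *\<^sub>v x) < c * (x \<bullet> x)"
    proof (rule quadratic_form_less_if_small_eigenvalues[OF A adj_matrix_sym wit x x0])
      fix i assume "i < ?n" "es ! i \<ge> c"
      then show "(Q *\<^sub>v x) $ i = 0"
        using z[of i] mult_mat_vec_sum[OF Q x] len unfolding x_def by simp
    qed
    moreover have "x \<bullet> x = (\<Sum>v\<in>verts X. (f v)\<^sup>2)"
      unfolding scalar_prod_self[OF x] using sum_nth_distinct[OF vs(1), of "\<lambda>v. (f v)\<^sup>2"] vs(2)
      by (simp add: x_def)
    moreover have "x \<bullet> (?A *\<^sub>v x) = adj_form X f"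
    proof -
      have Ax: "?A *\<^sub>v x \<in> carrier_vec ?n" using A x by simp
      have row: "x $ i * (?A *\<^sub>v x) $ i
          = (\<Sum>j<?n. if {?vs ! i, ?vs ! j} \<in> edges X then f (?vs ! i) * f (?vs ! j) else 0)"
        if i: "i < ?n" for i
        unfolding mult_mat_vec_sum[OF A x i] sum_distrib_left
        by (rule sum.cong) (use i in \<open>simp_all add: adj_matrix_def x_def\<close>)
      have "x \<bullet> (?A *\<^sub>v x) = (\<Sum>i<?n. x $ i * (?A *\<^sub>v x) $ i)"
        unfolding scalar_prod_def carrier_vecD[OF Ax] atLeast0LessThan ..
      also have "\<dots> = (\<Sum>i<?n. \<Sum>j<?n.
          if {?vs ! i, ?vs ! j} \<in> edges X then f (?vs ! i) * f (?vs ! j) else 0)"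
        by (rule sum.cong) (use row in auto)
      also have "\<dots> = (\<Sum>u\<in>set ?vs. \<Sum>v\<in>set ?vs. if {u, v} \<in> edges X then f u * f v else 0)"
        by (simp only: sum_nth_distinct[OF vs(1), symmetric])
      finally show ?thesis unfolding adj_form_def vs(2) .
    qed
    ultimately show ?thesis by simp
  qed
  show thesis
    by (rule that[of es ?vs "\<lambda>i l. Q $$ (i, l)"]) (use cp len n eig form in \<open>auto simp: adj_char_poly_def\<close>)
qed

lemma graph_lambda_1_ge:
  assumes fin: "finite (verts X)" and f: "v \<in> verts X" "f v \<noteq> 0"
    and ge: "adj_form X f \<ge> c * (\<Sum>v\<in>verts X. (f v)\<^sup>2)"
  shows "graph_lambda 1 X \<ge> c"
proof -
  obtain es and Q :: "nat \<Rightarrow> nat \<Rightarrow> real" and vs where eig: "graph_eigenvalues X = rev (sort es)" and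
    form: "\<forall>f c. (\<exists>v\<in>verts X. f v \<noteq> 0) \<longrightarrow>
      (\<forall>i<length es. es ! i \<ge> c \<longrightarrow> (\<Sum>l<length vs. Q i l * f (vs ! l)) = 0) \<longrightarrow>
      adj_form X f < c * (\<Sum>v\<in>verts X. (f v)\<^sup>2)"
    by (rule graph_spectrum[OF fin]) (rule that)
  obtain i where "i < length es" "es ! i \<ge> c" using form[rule_format, of f c] f ge by fastforce
  then have "{i. i < length es \<and> es ! i \<ge> c} \<noteq> {}" by auto
  then have "card {i. i < length es \<and> es ! i \<ge> c} > 0" by (subst card_gt_0_iff) auto
  then show ?thesis unfolding graph_lambda_def eig using nth_rev_sort_ge by force
qed

lemma two_equations_three_unknowns:
  fixes a1 a2 a3 b1 b2 b3 :: real
  shows "\<exists>x y z. (x, y, z) \<noteq> (0, 0, 0) \<and> a1 * x + a2 * y + a3 * z = 0 \<and> b1 * x + b2 * y + b3 * z = 0"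
proof (cases "a1 * b2 = a2 * b1 \<and> a1 * b3 = a3 * b1 \<and> a2 * b3 = a3 * b2")
  case False
  \<comment> \<open>The coefficient vectors are not parallel, so their cross product is a nonzero
    solution.\<close>
  then show ?thesis
    by (intro exI[of _ "a2 * b3 - a3 * b2"] exI[of _ "a3 * b1 - a1 * b3"] exI[of _ "a1 * b2 - a2 * b1"])
      (auto simp: algebra_simps)
next
  case par: True
  show ?thesis
  proof (cases "a1 = 0 \<and> a2 = 0 \<and> a3 = 0")
    case True
    show ?thesis
    proof (cases "b1 = 0")
      case True with \<open>a1 = 0 \<and> a2 = 0 \<and> a3 = 0\<close> show ?thesis
        by (intro exI[of _ 1] exI[of _ 0]) auto
    next
      case False with True show ?thesis
        by (intro exI[of _ "- b2"] exI[of _ b1] exI[of _ 0]) auto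
    qed
  next
    case False
    consider "a1 \<noteq> 0" | "a1 = 0" "a2 \<noteq> 0" | "a1 = 0" "a2 = 0" "a3 \<noteq> 0" using False by auto
    then show ?thesis
    proof cases
      case 1 with par show ?thesis
        by (intro exI[of _ "- a2"] exI[of _ a1] exI[of _ 0]) (auto simp: algebra_simps)
    next
      case 2 with par show ?thesis by (intro exI[of _ 1] exI[of _ 0]) (auto simp: algebra_simps)
    next
      case 3 with par show ?thesis by (intro exI[of _ 1] exI[of _ 0]) (auto simp: algebra_simps)
    qed
  qed
qed

text \<open>One half of Courant-Fischer. Two or fewer eigenvalues \<open>\<ge> c\<close> would
  impose at most two linear conditions on three coefficients, and a nontrivial solution violates
  \<open>ge\<close>. The count also shows that the graph has at least three eigenvalues, so the
  index is meaningful.\<close>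

lemma graph_lambda_3_ge:
  assumes fin: "finite (verts X)"
    and nz: "\<And>a b d. (a, b, d) \<noteq> (0, 0, 0) \<Longrightarrow> \<exists>v\<in>verts X. a * f v + b * g v + d * h v \<noteq> 0"
    and ge: "\<And>a b d. adj_form X (\<lambda>v. a * f v + b * g v + d * h v)
      \<ge> c * (\<Sum>v\<in>verts X. (a * f v + b * g v + d * h v)\<^sup>2)"
  shows "graph_lambda 3 X \<ge> c"
proof -
  obtain es and Q :: "nat \<Rightarrow> nat \<Rightarrow> real" and vs where eig: "graph_eigenvalues X = rev (sort es)" and
    form: "\<forall>f c. (\<exists>v\<in>verts X. f v \<noteq> 0) \<longrightarrow>
      (\<forall>i<length es. es ! i \<ge> c \<longrightarrow> (\<Sum>l<length vs. Q i l * f (vs ! l)) = 0) \<longrightarrow>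
      adj_form X f < c * (\<Sum>v\<in>verts X. (f v)\<^sup>2)"
    by (rule graph_spectrum[OF fin]) (rule that)
  let ?I = "{i. i < length es \<and> es ! i \<ge> c}"
  have "card ?I > 2"
  proof (rule ccontr)
    assume "\<not> card ?I > 2"
    then have "card ?I \<le> 2" by simp
    then obtain p q where pq: "?I \<subseteq> {p, q}"
    proof -
      obtain xs where xs: "set xs = ?I" "distinct xs" using finite_distinct_list[of ?I] by auto
      then have "length xs \<le> 2" using \<open>card ?I \<le> 2\<close> distinct_card by metis
      then consider "xs = []" | p where "xs = [p]" | p q where "xs = [p, q]"
        by (cases xs rule: list.exhaust; cases "tl xs") (auto simp: neq_Nil_conv)
      then show thesis by cases (use that xs(1) in auto)
    qed
    let ?S = "\<lambda>i f. \<Sum>l<length vs. Q i l * f (vs ! l)"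
    obtain a b d where abd: "(a, b, d) \<noteq> (0, 0, 0)"
      "?S p f * a + ?S p g * b + ?S p h * d = 0" "?S q f * a + ?S q g * b + ?S q h * d = 0"
      using two_equations_three_unknowns by blast
    have lin: "?S i (\<lambda>v. a * f v + b * g v + d * h v) = ?S i f * a + ?S i g * b + ?S i h * d" for i
      by (simp add: sum.distrib sum_distrib_left algebra_simps)
    have "?S i (\<lambda>v. a * f v + b * g v + d * h v) = 0" if "i < length es" "es ! i \<ge> c" for i
      unfolding lin using pq abd(2,3) that by auto
    then have "adj_form X (\<lambda>v. a * f v + b * g v + d * h v)
        < c * (\<Sum>v\<in>verts X. (a * f v + b * g v + d * h v)\<^sup>2)"
      using form[rule_format, of "\<lambda>v. a * f v + b * g v + d * h v" c] nz[OF abd(1)] by simp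
    then show False using ge[of a b d] by simp
  qed
  then show ?thesis unfolding graph_lambda_def eig using nth_rev_sort_ge[of 2 es c] by simp
qed

lemma graph_lambda_1_eigenfunction:
  assumes fin: "finite (verts X)" and ne: "verts X \<noteq> {}"
  obtains f where "\<exists>v\<in>verts X. f v \<noteq> 0"
    "\<And>v. v \<in> verts X \<Longrightarrow>
      (\<Sum>u\<in>verts X. if {v, u} \<in> edges X then f u else 0) = graph_lambda 1 X * f v"
proof -
  let ?vs = "vertex_list X" let ?n = "length ?vs" let ?A = "adj_matrix ?vs X"
  note vs = vertex_list[OF fin]
  have A: "?A \<in> carrier_mat ?n ?n" unfolding adj_matrix_def by auto
  obtain es where es: "adj_char_poly X = (\<Prod>e\<leftarrow>es. [:- e, 1:])" "length es = graph_order X"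
    "graph_eigenvalues X = rev (sort es)" by (rule graph_spectrum[OF fin]) (rule that)
  have "length es > 0" using ne fin unfolding es(2) graph_order_def by auto
  then have "graph_lambda 1 X \<in> set (rev (sort es))"
    unfolding graph_lambda_def es(3) by (intro nth_mem) simp
  then have "graph_lambda 1 X \<in> set es" by simp
  then have "poly (char_poly ?A) (graph_lambda 1 X) = 0"
    unfolding adj_char_poly_def[symmetric] es(1) by (induct es) auto
  then have "eigenvalue ?A (graph_lambda 1 X)" using eigenvalue_root_char_poly[OF A] by simp
  then obtain w where w: "w \<in> carrier_vec ?n" "w \<noteq> 0\<^sub>v ?n" "?A *\<^sub>v w = graph_lambda 1 X \<cdot>\<^sub>v w"
    using A unfolding eigenvalue_def eigenvector_def by auto
  define f where "f v = w $ (the_inv_into {..<?n} ((!) ?vs) v)" for v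
  have inj: "inj_on ((!) ?vs) {..<?n}" using inj_on_nth[OF vs(1)] by auto
  have fw: "f (?vs ! i) = w $ i" if "i < ?n" for i
    unfolding f_def using the_inv_into_f_f[OF inj] that by simp
  show thesis
  proof (rule that[of f])
    obtain i where "i < ?n" "w $ i \<noteq> 0" using w(1,2) by (metis carrier_vecD eq_vecI index_zero_vec)
    then show "\<exists>v\<in>verts X. f v \<noteq> 0" using fw[of i] vs(2) nth_mem by metis
  next
    fix v assume "v \<in> verts X"
    then obtain i where i: "i < ?n" "v = ?vs ! i" using vs(2) by (metis in_set_conv_nth)
    have "graph_lambda 1 X * f v = (?A *\<^sub>v w) $ i" using w i fw by simp
    also have "\<dots> = (\<Sum>j<?n. ?A $$ (i, j) * w $ j)" by (rule mult_mat_vec_sum[OF A w(1) i(1)])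
    also have "\<dots> = (\<Sum>j<?n. if {v, ?vs ! j} \<in> edges X then f (?vs ! j) else 0)"
      using i fw by (intro sum.cong refl) (auto simp: adj_matrix_def)
    also have "\<dots> = (\<Sum>u\<in>verts X. if {v, u} \<in> edges X then f u else 0)"
      unfolding vs(2)[symmetric] by (rule sum_nth_distinct[OF vs(1)])
    finally show "(\<Sum>u\<in>verts X. if {v, u} \<in> edges X then f u else 0) = graph_lambda 1 X * f v" ..
  qed
qed

text \<open>There may be infinitely many such graphs, but their adjacency matrices are among the
  finitely many \<open>n\<close> by \<open>n\<close> matrices with entries 0 and 1.\<close>

lemma finite_graph_lambda_of_order:
  "finite {graph_lambda i H | H :: 'b ugraph. finite (verts H) \<and> graph_order H = n}"
proof -
  let ?L = "\<lambda>A. rev (sorted_list_of_multiset (proots (char_poly A))) ! (i - 1)"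
  let ?M = "(\<lambda>g. mat n n g) ` (({0..<n} \<times> {0..<n}) \<rightarrow>\<^sub>E {0, 1 :: real})"
  have "graph_lambda i H \<in> ?L ` ?M" if "finite (verts H)" "graph_order H = n" for H :: "'b ugraph"
  proof -
    have len: "length (vertex_list H) = n"
      using distinct_card[OF vertex_list(1)[OF that(1)]] that(2) unfolding graph_order_def vertex_list(2)[OF that(1)] by simp
    let ?g = "restrict (\<lambda>(i, j). if {vertex_list H ! i, vertex_list H ! j} \<in> edges H then 1 else 0 :: real)
      ({0..<n} \<times> {0..<n})"
    have "adj_matrix (vertex_list H) H = mat n n ?g"
      unfolding adj_matrix_def len by (intro eq_matI) auto
    moreover have "?g \<in> ({0..<n} \<times> {0..<n}) \<rightarrow>\<^sub>E {0, 1}" by (auto split: if_splits)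
    ultimately have "adj_matrix (vertex_list H) H \<in> ?M" by blast
    then show ?thesis unfolding graph_lambda_def graph_eigenvalues_def adj_char_poly_def by blast
  qed
  then have "{graph_lambda i H | H :: 'b ugraph. finite (verts H) \<and> graph_order H = n} \<subseteq> ?L ` ?M"
    by blast
  moreover have "finite ?M" by (intro finite_imageI finite_PiE) auto
  ultimately show ?thesis by (rule finite_subset[OF _ finite_imageI])
qed

subsection \<open>Bounds for eigenvalues of graphs\<close>

lemma adj_form_ge:
  assumes "\<And>u. u \<in> verts X \<Longrightarrow>
    h u * (\<Sum>v\<in>verts X. if {u, v} \<in> edges X then h v else 0) \<ge> c * (h u)\<^sup>2"
  shows "adj_form X h \<ge> c * (\<Sum>v\<in>verts X. (h v)\<^sup>2)"
proof -
  have "adj_form X h = (\<Sum>u\<in>verts X. h u * (\<Sum>v\<in>verts X. if {u, v} \<in> edges X then h v else 0))"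
    unfolding adj_form_def sum_distrib_left by (intro sum.cong refl) simp
  then show ?thesis unfolding sum_distrib_left[of c] using assms by (auto intro: sum_mono)
qed

lemma sum_adj_eq_sum_nbrs:
  assumes "simple_graph X"
  shows "(\<Sum>v\<in>verts X. if {u, v} \<in> edges X then h v else (0 :: real)) = (\<Sum>v\<in>nbrs X u. h v)"
proof -
  have "finite (verts X)" using assms unfolding simple_graph_def by simp
  moreover have "verts X \<inter> {v. {u, v} \<in> edges X} = nbrs X u"
    using nbrs_subset[OF assms, of u] unfolding nbrs_def by auto
  ultimately show ?thesis by (simp add: sum.If_cases)
qed

lemma graph_lambda_1_eigenfunction_nbrs:
  assumes X: "simple_graph X" and ne: "verts X \<noteq> {}"
  shows "\<exists>f. (\<exists>v\<in>verts X. f v \<noteq> 0) \<and>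
    (\<forall>v\<in>verts X. (\<Sum>u\<in>nbrs X v. f u) = graph_lambda 1 X * f v)"
proof -
  have fin: "finite (verts X)" using X unfolding simple_graph_def by simp
  show ?thesis
  proof (rule graph_lambda_1_eigenfunction[OF fin ne])
    fix f assume "\<exists>v\<in>verts X. f v \<noteq> 0"
      "\<And>v. v \<in> verts X \<Longrightarrow>
        (\<Sum>u\<in>verts X. if {v, u} \<in> edges X then f u else 0) = graph_lambda 1 X * f v"
    then show ?thesis unfolding sum_adj_eq_sum_nbrs[OF X] by (intro exI[of _ f]) simp
  qed
qed

lemma finite_ex_max:
  fixes q :: "'b \<Rightarrow> real"
  assumes "finite A" "A \<noteq> {}" shows "\<exists>v\<in>A. \<forall>u\<in>A. q u \<le> q v"
proof -
  have "Max (q ` A) \<in> q ` A" using assms by (intro Max_in) auto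
  then obtain v where "v \<in> A" "Max (q ` A) = q v" by auto
  then show ?thesis using assms(1) by (metis Max_ge finite_imageI imageI)
qed

section \<open>Interlacing for separated induced subgraphs\<close>

definition induced :: "'a ugraph \<Rightarrow> 'a set \<Rightarrow> 'a ugraph" where
  "induced X U = (U, {e \<in> edges X. e \<subseteq> U})"

lemma induced: "verts (induced X U) = U" "edges (induced X U) = {e \<in> edges X. e \<subseteq> U}"
  unfolding induced_def by auto

lemma induced_edge: "u \<in> U \<Longrightarrow> v \<in> U \<Longrightarrow> {u, v} \<in> edges (induced X U) \<longleftrightarrow> {u, v} \<in> edges X"
  by (simp add: induced)

lemma simple_graph_induced:
  assumes "simple_graph X" "U \<subseteq> verts X"
  shows "simple_graph (induced X U)"
  using assms unfolding simple_graph_def induced by (auto intro: rev_finite_subset)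

lemma nbrs_induced: "u \<in> U \<Longrightarrow> nbrs (induced X U) u = nbrs X u \<inter> U"
  unfolding nbrs_def induced by auto

text \<open>The eigenfunctions of the three induced subgraphs, extended by zero, span a space on which the
  quadratic form is bounded below, since no edge joins two of the supports.\<close>

lemma graph_lambda_3_ge_induced:
  assumes X: "simple_graph X"
    and sub: "A \<subseteq> verts X" "B \<subseteq> verts X" "C \<subseteq> verts X" and ne: "A \<noteq> {}" "B \<noteq> {}" "C \<noteq> {}"
    and sep: "separated X A B" "separated X A C" "separated X B C"
    and ge: "c \<le> graph_lambda 1 (induced X A)" "c \<le> graph_lambda 1 (induced X B)"
      "c \<le> graph_lambda 1 (induced X C)"
  shows "c \<le> graph_lambda 3 X"
proof -
  have finX: "finite (verts X)" using X unfolding simple_graph_def by simp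
  have ext: "\<exists>f. (\<exists>v\<in>A. f v \<noteq> 0) \<and> (\<forall>v. v \<notin> A \<longrightarrow> f v = 0) \<and>
      (\<forall>v\<in>A. (\<Sum>u\<in>A. if {v, u} \<in> edges X then f u else 0) = graph_lambda 1 (induced X A) * f v)"
    if A: "A \<subseteq> verts X" "A \<noteq> {}" for A
  proof -
    note Y = simple_graph_induced[OF X A(1)]
    obtain f where f: "\<exists>v\<in>A. f v \<noteq> 0"
      "\<forall>v\<in>A. (\<Sum>u\<in>A. if {v, u} \<in> edges (induced X A) then f u else 0) = graph_lambda 1 (induced X A) * f v"
      using graph_lambda_1_eigenfunction_nbrs[OF Y] A(2)
      unfolding sum_adj_eq_sum_nbrs[OF Y, symmetric] induced(1) by auto
    let ?f = "\<lambda>v. if v \<in> A then f v else 0"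
    have "(\<Sum>u\<in>A. if {v, u} \<in> edges X then ?f u else 0) = graph_lambda 1 (induced X A) * ?f v"
      if "v \<in> A" for v
    proof -
      have "(\<Sum>u\<in>A. if {v, u} \<in> edges X then ?f u else 0)
          = (\<Sum>u\<in>A. if {v, u} \<in> edges (induced X A) then f u else 0)"
        by (rule sum.cong) (use that in \<open>simp_all add: induced_edge\<close>)
      then show ?thesis using f(2) that by simp
    qed
    then show ?thesis using f(1) by (intro exI[of _ ?f]) auto
  qed
  have finA: "finite A" "finite B" "finite C" using rev_finite_subset[OF finX] sub by auto
  have dis: "A \<inter> B = {}" "A \<inter> C = {}" "B \<inter> C = {}" using sep unfolding separated_def by auto
  have n: "{a, b} \<notin> edges X" "{b, a} \<notin> edges X" if "a \<in> P" "b \<in> Q" "separated X P Q" for a b P Q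
    using that unfolding insert_commute[of b a] separated_def pairs_def by auto
  have nadj: "{u, v} \<notin> edges X"
    if "u \<in> A \<and> v \<in> B \<or> u \<in> A \<and> v \<in> C \<or> u \<in> B \<and> v \<in> C
      \<or> v \<in> A \<and> u \<in> B \<or> v \<in> A \<and> u \<in> C \<or> v \<in> B \<and> u \<in> C" for u v
    using that n[OF _ _ sep(1)] n[OF _ _ sep(2)] n[OF _ _ sep(3)] by metis
  obtain f where f: "\<exists>v\<in>A. f v \<noteq> 0" "\<And>v. v \<notin> A \<Longrightarrow> f v = 0"
    "\<And>v. v \<in> A \<Longrightarrow> (\<Sum>u\<in>A. if {v, u} \<in> edges X then f u else 0) = graph_lambda 1 (induced X A) * f v"
    using ext[OF sub(1) ne(1)] by auto
  obtain g where g: "\<exists>v\<in>B. g v \<noteq> 0" "\<And>v. v \<notin> B \<Longrightarrow> g v = 0"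
    "\<And>v. v \<in> B \<Longrightarrow> (\<Sum>u\<in>B. if {v, u} \<in> edges X then g u else 0) = graph_lambda 1 (induced X B) * g v"
    using ext[OF sub(2) ne(2)] by auto
  obtain h where h: "\<exists>v\<in>C. h v \<noteq> 0" "\<And>v. v \<notin> C \<Longrightarrow> h v = 0"
    "\<And>v. v \<in> C \<Longrightarrow> (\<Sum>u\<in>C. if {v, u} \<in> edges X then h u else 0) = graph_lambda 1 (induced X C) * h v"
    using ext[OF sub(3) ne(3)] by auto
  \<comment> \<open>The inequality is checked vertex by vertex. At \<open>u \<in> D\<close> the
    neighbours outside \<open>D\<close> lie in neither of the other two supports, so
    \<open>y\<close> vanishes there (\<open>off\<close>) and is locally an eigenfunction to
    \<open>\<mu>\<close>.\<close>
  have part: "y u * (\<Sum>v\<in>verts X. if {u, v} \<in> edges X then y v else 0) \<ge> c * (y u)\<^sup>2"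
    if D: "D \<subseteq> verts X" "u \<in> D" and y: "\<And>v. v \<in> D \<Longrightarrow> y v = s * w v"
      and off: "\<And>v. v \<in> verts X - D \<Longrightarrow> {u, v} \<in> edges X \<Longrightarrow> y v = 0"
      and w: "(\<Sum>v\<in>D. if {u, v} \<in> edges X then w v else 0) = \<mu> * w u" "c \<le> \<mu>"
    for y w :: "'a \<Rightarrow> real" and D u s \<mu>
  proof -
    have "(\<Sum>v\<in>verts X. if {u, v} \<in> edges X then y v else 0) = (\<Sum>v\<in>D. if {u, v} \<in> edges X then y v else 0)"
      by (rule sum.mono_neutral_right[OF finX D(1)]) (use off in auto)
    also have "\<dots> = (\<Sum>v\<in>D. s * (if {u, v} \<in> edges X then w v else 0))"
      by (rule sum.cong) (use y in simp_all)
    also have "\<dots> = \<mu> * y u" unfolding sum_distrib_left[symmetric] w(1) y[OF D(2)] by simp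
    finally have "(\<Sum>v\<in>verts X. if {u, v} \<in> edges X then y v else 0) = \<mu> * y u" .
    moreover have "c * (y u)\<^sup>2 \<le> \<mu> * (y u)\<^sup>2" using w(2) by (rule mult_right_mono) simp
    ultimately show ?thesis by (simp add: power2_eq_square mult.left_commute)
  qed
  show ?thesis
  proof (rule graph_lambda_3_ge[OF finX, of f g h])
    fix a b d :: real assume "(a, b, d) \<noteq> (0, 0, 0)"
    then consider "a \<noteq> 0" | "b \<noteq> 0" | "d \<noteq> 0" by auto
    then show "\<exists>v\<in>verts X. a * f v + b * g v + d * h v \<noteq> 0"
    proof cases
      case 1
      obtain v where "v \<in> A" "f v \<noteq> 0" using f(1) by auto
      moreover have "v \<notin> B" "v \<notin> C" using dis \<open>v \<in> A\<close> by auto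
      ultimately show ?thesis using 1 sub g(2) h(2) by (intro bexI[of _ v]) auto
    next
      case 2
      obtain v where "v \<in> B" "g v \<noteq> 0" using g(1) by auto
      moreover have "v \<notin> A" "v \<notin> C" using dis \<open>v \<in> B\<close> by auto
      ultimately show ?thesis using 2 sub f(2) h(2) by (intro bexI[of _ v]) auto
    next
      case 3
      obtain v where "v \<in> C" "h v \<noteq> 0" using h(1) by auto
      moreover have "v \<notin> A" "v \<notin> B" using dis \<open>v \<in> C\<close> by auto
      ultimately show ?thesis using 3 sub f(2) g(2) by (intro bexI[of _ v]) auto
    qed
  next
    fix a b d :: real
    let ?y = "\<lambda>v. a * f v + b * g v + d * h v"
    have yA: "?y v = a * f v" if "v \<in> A" for v
    proof -
      have "v \<notin> B" "v \<notin> C" using that dis by auto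
      then show ?thesis using g(2)[of v] h(2)[of v] by simp
    qed
    have yB: "?y v = b * g v" if "v \<in> B" for v
    proof -
      have "v \<notin> A" "v \<notin> C" using that dis by auto
      then show ?thesis using f(2)[of v] h(2)[of v] by simp
    qed
    have yC: "?y v = d * h v" if "v \<in> C" for v
    proof -
      have "v \<notin> A" "v \<notin> B" using that dis by auto
      then show ?thesis using f(2)[of v] g(2)[of v] by simp
    qed
    have y0: "?y v = 0" if "v \<notin> A" "v \<notin> B" "v \<notin> C" for v using that f(2) g(2) h(2) by simp
    show "c * (\<Sum>v\<in>verts X. (?y v)\<^sup>2) \<le> adj_form X ?y"
    proof (rule adj_form_ge)
      fix u assume "u \<in> verts X"
      consider "u \<in> A" | "u \<in> B" | "u \<in> C" | "u \<notin> A" "u \<notin> B" "u \<notin> C" by auto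
      then show "c * (?y u)\<^sup>2 \<le> ?y u * (\<Sum>v\<in>verts X. if {u, v} \<in> edges X then ?y v else 0)"
      proof cases
        case 1
        show ?thesis
          by (rule part[OF sub(1) 1 yA _ f(3)[OF 1] ge(1)]) (use 1 nadj y0 in blast)+
      next
        case 2
        show ?thesis
          by (rule part[OF sub(2) 2 yB _ g(3)[OF 2] ge(2)]) (use 2 nadj y0 in blast)+
      next
        case 3
        show ?thesis
          by (rule part[OF sub(3) 3 yC _ h(3)[OF 3] ge(3)]) (use 3 nadj y0 in blast)+
      next
        case 4
        then show ?thesis using y0[OF 4] by simp
      qed
    qed
  qed
qed

section \<open>Bounds for the largest eigenvalue\<close>

lemma sum_card_nbrs:
  assumes X: "simple_graph X"
  shows "(\<Sum>v\<in>verts X. card (nbrs X v)) = 2 * graph_size X"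
proof -
  have "(\<Sum>v\<in>verts X. card (nbrs X v)) = card (Sigma (verts X) (nbrs X))"
    using X finite_nbrs[OF X] unfolding simple_graph_def by simp
  also have "Sigma (verts X) (nbrs X) = pairs X (verts X) (verts X)"
    using nbrs_subset[OF X] unfolding pairs_def nbrs_def by auto
  also have "{e \<in> edges X. e \<subseteq> verts X} = edges X" using X unfolding simple_graph_def by auto
  then have "card (pairs X (verts X) (verts X)) = 2 * graph_size X"
    using card_pairs_self[OF X, of "verts X"] unfolding graph_size_def by simp
  finally show ?thesis .
qed

lemma graph_lambda_1_ge_average_degree:
  assumes X: "simple_graph X" and ne: "verts X \<noteq> {}"
  shows "2 * real (graph_size X) / real (graph_order X) \<le> graph_lambda 1 X"
proof -
  have fin: "finite (verts X)" using X unfolding simple_graph_def by simp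
  obtain v where v: "v \<in> verts X" using ne by auto
  have n: "real (graph_order X) > 0" using fin ne unfolding graph_order_def by auto
  have "adj_form X (\<lambda>_. 1) = (\<Sum>u\<in>verts X. \<Sum>v\<in>nbrs X u. 1)"
    unfolding adj_form_def mult_1 by (simp only: sum_adj_eq_sum_nbrs[OF X])
  also have "\<dots> = real (\<Sum>u\<in>verts X. card (nbrs X u))" by simp
  also have "\<dots> = 2 * real (graph_size X)" unfolding sum_card_nbrs[OF X] by simp
  finally show ?thesis
    using graph_lambda_1_ge[OF fin v, of "\<lambda>_. 1" "2 * real (graph_size X) / real (graph_order X)"] n
    by (simp add: graph_order_def)
qed

text \<open>Collatz-Wielandt bound: the eigenvalue equation is compared with \<open>z\<close> at a
  vertex where \<open>\<bar>f v\<bar> / z v\<close> is largest. Absolute values make positivity of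
  the eigenfunction dispensable.\<close>

lemma graph_lambda_1_le_if_test_function:
  assumes X: "simple_graph X" and ne: "verts X \<noteq> {}"
    and z: "\<And>v. v \<in> verts X \<Longrightarrow> z v > 0" "\<And>v. v \<in> verts X \<Longrightarrow> (\<Sum>u\<in>nbrs X v. z u) \<le> c * z v"
  shows "graph_lambda 1 X \<le> c"
proof -
  have fin: "finite (verts X)" using X unfolding simple_graph_def by simp
  obtain f where f: "\<exists>v\<in>verts X. f v \<noteq> 0"
    "\<And>v. v \<in> verts X \<Longrightarrow> (\<Sum>u\<in>nbrs X v. f u) = graph_lambda 1 X * f v"
    using graph_lambda_1_eigenfunction_nbrs[OF X ne] by auto
  let ?q = "\<lambda>v. \<bar>f v\<bar> / z v"
  obtain v where v: "v \<in> verts X" "\<And>u. u \<in> verts X \<Longrightarrow> ?q u \<le> ?q v"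
    using finite_ex_max[OF fin ne, of ?q] by auto
  obtain w where w: "w \<in> verts X" "f w \<noteq> 0" using f(1) by auto
  have "?q w > 0" using w z(1) by simp
  then have q: "?q v > 0" using v(2)[OF w(1)] by linarith
  have fu: "\<bar>f u\<bar> \<le> ?q v * z u" if "u \<in> verts X" for u
    using v(2)[OF that] z(1)[OF that] by (simp add: pos_divide_le_eq)
  have "graph_lambda 1 X * \<bar>f v\<bar> \<le> \<bar>\<Sum>u\<in>nbrs X v. f u\<bar>"
    unfolding f(2)[OF v(1)] abs_mult by (intro mult_right_mono) auto
  also have "\<dots> \<le> (\<Sum>u\<in>nbrs X v. \<bar>f u\<bar>)" by (rule sum_abs)
  also have "\<dots> \<le> (\<Sum>u\<in>nbrs X v. ?q v * z u)"
    using nbrs_subset[OF X, of v] fu by (intro sum_mono) auto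
  also have "\<dots> \<le> ?q v * (c * z v)"
    unfolding sum_distrib_left[symmetric] using q z(2)[OF v(1)] by (intro mult_left_mono) auto
  also have "\<dots> = c * \<bar>f v\<bar>" using z(1)[OF v(1)] by simp
  finally show ?thesis using q z(1)[OF v(1)] by (simp add: zero_less_divide_iff)
qed

text \<open>If the eigenvalue were at least \<open>r\<close>, every vertex where
  \<open>\<bar>f v\<bar>\<close> is maximal would have degree \<open>r\<close> and only such
  vertices as neighbours. By connectedness the graph would be regular. The strict bound feeds
  \<open>Least_lambda_le\<close>.\<close>

lemma graph_lambda_1_less_if_irregular:
  assumes X: "simple_graph X" and ne: "verts X \<noteq> {}"
    and conn: "\<And>Z. Z \<subseteq> verts X \<Longrightarrow> Z \<noteq> {} \<Longrightarrow>
      (\<forall>u\<in>Z. \<forall>v\<in>verts X. {u, v} \<in> edges X \<longrightarrow> v \<in> Z) \<Longrightarrow> Z = verts X"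
    and deg: "\<And>v. v \<in> verts X \<Longrightarrow> card (nbrs X v) \<le> r"
    and irr: "w \<in> verts X" "card (nbrs X w) < r"
  shows "graph_lambda 1 X < real r"
proof (rule ccontr)
  assume "\<not> ?thesis"
  then have ge: "real r \<le> graph_lambda 1 X" by simp
  have fin: "finite (verts X)" using X unfolding simple_graph_def by simp
  obtain f where f: "\<exists>v\<in>verts X. f v \<noteq> 0"
    "\<And>v. v \<in> verts X \<Longrightarrow> (\<Sum>u\<in>nbrs X v. f u) = graph_lambda 1 X * f v"
    using graph_lambda_1_eigenfunction_nbrs[OF X ne] by auto
  obtain v0 where v0: "v0 \<in> verts X" "\<And>u. u \<in> verts X \<Longrightarrow> \<bar>f u\<bar> \<le> \<bar>f v0\<bar>"
    using finite_ex_max[OF fin ne, of "\<lambda>v. \<bar>f v\<bar>"] by auto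
  define M where "M = \<bar>f v0\<bar>"
  have M: "M > 0" using f(1) v0(2) unfolding M_def by force
  define Z where "Z = {v \<in> verts X. \<bar>f v\<bar> = M}"
  have key: "card (nbrs X v) = r \<and> nbrs X v \<subseteq> Z" if v: "v \<in> Z" for v
  proof -
    have vX: "v \<in> verts X" "\<bar>f v\<bar> = M" using v unfolding Z_def by auto
    have le: "\<bar>f u\<bar> \<le> M" if "u \<in> nbrs X v" for u
      using v0(2) nbrs_subset[OF X, of v] that unfolding M_def by auto
    have "real r * M \<le> graph_lambda 1 X * M" using ge M by (intro mult_right_mono) auto
    also have "\<dots> \<le> \<bar>graph_lambda 1 X * f v\<bar>" unfolding abs_mult vX(2) using M by (intro mult_right_mono) auto
    also have "\<dots> \<le> (\<Sum>u\<in>nbrs X v. \<bar>f u\<bar>)" unfolding f(2)[OF vX(1), symmetric] by (rule sum_abs)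
    finally have 1: "real r * M \<le> (\<Sum>u\<in>nbrs X v. \<bar>f u\<bar>)" .
    moreover have "\<dots> \<le> real (card (nbrs X v)) * M"
      using sum_bounded_above[of "nbrs X v" "\<lambda>u. \<bar>f u\<bar>" M] le by simp
    ultimately have "real r * M \<le> real (card (nbrs X v)) * M" by linarith
    then have "real r \<le> real (card (nbrs X v))" using M by (rule mult_right_le_imp_le)
    then have c: "card (nbrs X v) = r" using deg[OF vX(1)] by simp
    then have "(\<Sum>u\<in>nbrs X v. M - \<bar>f u\<bar>) \<le> 0" using 1 by (simp add: sum_subtractf)
    then have "(\<Sum>u\<in>nbrs X v. M - \<bar>f u\<bar>) = 0"
      using sum_nonneg[of "nbrs X v" "\<lambda>u. M - \<bar>f u\<bar>"] le by simp
    then have "\<forall>u\<in>nbrs X v. M - \<bar>f u\<bar> = 0"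
      using le by (subst (asm) sum_nonneg_eq_0_iff) (auto simp: finite_nbrs[OF X])
    then show ?thesis using c nbrs_subset[OF X, of v] unfolding Z_def by auto
  qed
  have "Z = verts X"
  proof (rule conn)
    show "Z \<subseteq> verts X" unfolding Z_def by auto
    show "Z \<noteq> {}" using v0(1) unfolding Z_def M_def by auto
    show "\<forall>u\<in>Z. \<forall>v\<in>verts X. {u, v} \<in> edges X \<longrightarrow> v \<in> Z" using key unfolding nbrs_def by auto
  qed
  then show False using key[of w] irr by simp
qed

section \<open>Transport to graphs on natural numbers, over which \<open>rho1\<close> and
  \<open>rho2\<close> range\<close>

definition map_graph :: "('a \<Rightarrow> 'b) \<Rightarrow> 'a ugraph \<Rightarrow> 'b ugraph" where
  "map_graph f X = (f ` verts X, (`) f ` edges X)"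

lemma map_graph: "verts (map_graph f X) = f ` verts X" "edges (map_graph f X) = (`) f ` edges X"
  unfolding map_graph_def by auto

context
  fixes X :: "'a ugraph" and f :: "'a \<Rightarrow> 'b"
  assumes X: "simple_graph X" and inj: "inj_on f (verts X)"
begin

lemma edge_subset_card: "e \<in> edges X \<Longrightarrow> e \<subseteq> verts X" "e \<in> edges X \<Longrightarrow> card e = 2"
  using X unfolding simple_graph_def by simp_all

lemma map_graph_edge:
  assumes "u \<in> verts X" "v \<in> verts X"
  shows "{f u, f v} \<in> edges (map_graph f X) \<longleftrightarrow> {u, v} \<in> edges X"
proof
  assume "{f u, f v} \<in> edges (map_graph f X)"
  then obtain e where e: "e \<in> edges X" "f ` {u, v} = f ` e" unfolding map_graph by auto
  then have "{u, v} = e" using inj_on_image_eq_iff[OF inj, of "{u, v}" e] edge_subset_card(1) assms by auto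
  then show "{u, v} \<in> edges X" using e by simp
next
  assume "{u, v} \<in> edges X"
  then have "f ` {u, v} \<in> (`) f ` edges X" by (rule imageI)
  then show "{f u, f v} \<in> edges (map_graph f X)" unfolding map_graph by simp
qed

lemma simple_map_graph: "simple_graph (map_graph f X)"
proof -
  have "f ` e \<subseteq> f ` verts X \<and> card (f ` e) = 2" if "e \<in> edges X" for e
    using edge_subset_card[OF that] card_image[OF inj_on_subset[OF inj]] by auto
  then show ?thesis using X unfolding simple_graph_def map_graph by auto
qed

lemma card_nbrs_map_graph:
  assumes u: "u \<in> verts X"
  shows "card (nbrs (map_graph f X) (f u)) = card (nbrs X u)"
proof -
  have "w \<in> nbrs (map_graph f X) (f u) \<longleftrightarrow> w \<in> f ` nbrs X u" for w
  proof
    assume w: "w \<in> nbrs (map_graph f X) (f u)"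
    then have "w \<in> f ` verts X" using nbrs_subset[OF simple_map_graph, of "f u"] unfolding map_graph by auto
    then show "w \<in> f ` nbrs X u" using w map_graph_edge[OF u] unfolding nbrs_def by auto
  next
    assume "w \<in> f ` nbrs X u"
    then obtain v where v: "v \<in> nbrs X u" "w = f v" by auto
    then have "v \<in> verts X" using nbrs_subset[OF X] by auto
    then show "w \<in> nbrs (map_graph f X) (f u)" using map_graph_edge[OF u] v unfolding nbrs_def by auto
  qed
  then have "nbrs (map_graph f X) (f u) = f ` nbrs X u" by auto
  then show ?thesis using card_image[OF inj_on_subset[OF inj nbrs_subset[OF X]]] by simp
qed

lemma graph_order_map_graph: "graph_order (map_graph f X) = graph_order X"
  unfolding graph_order_def map_graph by (rule card_image[OF inj])

lemma graph_size_map_graph: "graph_size (map_graph f X) = graph_size X"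
  unfolding graph_size_def map_graph
proof (rule card_image)
  show "inj_on ((`) f) (edges X)"
    using inj_on_image_eq_iff[OF inj] edge_subset_card(1) by (intro inj_onI) simp
qed

text \<open>The image of an enumeration gives the very same adjacency matrix; the rest is
  independence of the enumeration.\<close>

lemma graph_lambda_map_graph: "graph_lambda i (map_graph f X) = graph_lambda i X"
proof -
  have fin: "finite (verts X)" using X unfolding simple_graph_def by simp
  note vs = vertex_list[OF fin]
  let ?ws = "map f (vertex_list X)"
  have ws: "distinct ?ws" "set ?ws = verts (map_graph f X)"
    using vs inj by (simp_all add: distinct_map map_graph)
  have "adj_matrix ?ws (map_graph f X) = adj_matrix (vertex_list X) X"
    unfolding adj_matrix_def
    by (intro eq_matI) (use map_graph_edge vs(2) nth_mem[of _ "vertex_list X"] in auto)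
  then have "adj_char_poly (map_graph f X) = adj_char_poly X"
    using adj_char_poly_eq[OF ws] unfolding adj_char_poly_def by simp
  then show ?thesis unfolding graph_lambda_def graph_eigenvalues_def by simp
qed

end

text \<open>The cut condition is applied to the set of vertices reachable from
  \<open>u\<close>.\<close>

lemma connected_graphI:
  assumes ne: "verts X \<noteq> {}"
    and conn: "\<And>Z. Z \<subseteq> verts X \<Longrightarrow> Z \<noteq> {} \<Longrightarrow>
      (\<forall>u\<in>Z. \<forall>v\<in>verts X. {u, v} \<in> edges X \<longrightarrow> v \<in> Z) \<Longrightarrow> Z = verts X"
  shows "connected_graph X"
  unfolding connected_graph_def
proof (intro conjI ballI ne)
  fix u v assume u: "u \<in> verts X" and v: "v \<in> verts X"
  let ?E = "{(x, y). {x, y} \<in> edges X}"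
  have "{v \<in> verts X. (u, v) \<in> ?E\<^sup>*} = verts X"
    by (rule conn) (use u in \<open>auto intro: rtrancl_into_rtrancl\<close>)
  then show "(u, v) \<in> ?E\<^sup>*" using v by auto
qed

lemma irregular_class_mapI:
  fixes X :: "'a ugraph" and f :: "'a \<Rightarrow> nat"
  assumes X: "simple_graph X" and inj: "inj_on f (verts X)"
    and conn: "\<And>Z. Z \<subseteq> verts X \<Longrightarrow> Z \<noteq> {} \<Longrightarrow>
      (\<forall>u\<in>Z. \<forall>v\<in>verts X. {u, v} \<in> edges X \<longrightarrow> v \<in> Z) \<Longrightarrow> Z = verts X"
    and deg: "\<And>v. v \<in> verts X \<Longrightarrow> card (nbrs X v) \<le> r"
    and v: "v \<in> verts X" "card (nbrs X v) = r" and w: "w \<in> verts X" "card (nbrs X w) < r"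
    and size: "2 * int (graph_size X) \<ge> int r * int (graph_order X) - t"
  shows "irregular_class r t (map_graph f X)"
proof -
  let ?H = "map_graph f X"
  note H = simple_map_graph[OF X inj]
  have d: "vdegree ?H (f u) = card (nbrs X u)" if "u \<in> verts X" for u
    using card_nbrs_map_graph[OF X inj that] card_nbrs[OF H] by simp
  have "connected_graph ?H"
  proof (rule connected_graphI)
    show "verts ?H \<noteq> {}" using v unfolding map_graph by auto
    fix Z assume Z: "Z \<subseteq> verts ?H" "Z \<noteq> {}" "\<forall>u\<in>Z. \<forall>v\<in>verts ?H. {u, v} \<in> edges ?H \<longrightarrow> v \<in> Z"
    let ?Z = "{u \<in> verts X. f u \<in> Z}"
    have img: "f ` ?Z = Z" using Z(1) unfolding map_graph by auto
    have "?Z = verts X"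
    proof (rule conn)
      show "?Z \<noteq> {}" using img Z(2) by auto
      show "\<forall>u\<in>?Z. \<forall>v\<in>verts X. {u, v} \<in> edges X \<longrightarrow> v \<in> ?Z"
      proof (intro ballI impI)
        fix u v assume uv: "u \<in> ?Z" "v \<in> verts X" "{u, v} \<in> edges X"
        then have e: "{f u, f v} \<in> edges ?H" using map_graph_edge[OF X inj, of u v] by simp
        have "f u \<in> Z" "f v \<in> verts ?H" using uv unfolding map_graph(1) by simp_all
        then have "f v \<in> Z" using Z(3) e by simp
        then show "v \<in> ?Z" using uv(2) by simp
      qed
    qed auto
    then show "Z = verts ?H" using img unfolding map_graph by simp
  qed
  moreover have "irregular_graph ?H"
    unfolding irregular_graph_def regular_graph_def map_graph(1)
  proof
    assume "\<exists>e. \<forall>u\<in>f ` verts X. vdegree ?H u = e"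
    then obtain e where "\<forall>u\<in>f ` verts X. vdegree ?H u = e" ..
    then have "vdegree ?H (f v) = vdegree ?H (f w)" using v(1) w(1) by simp
    then show False using d[OF v(1)] d[OF w(1)] v(2) w(2) by simp
  qed
  moreover have "max_degree ?H = r"
    unfolding max_degree_def
  proof (rule Max_eqI)
    show "finite (vdegree ?H ` verts ?H)" using H unfolding simple_graph_def by simp
    show "y \<le> r" if y: "y \<in> vdegree ?H ` verts ?H" for y
    proof -
      obtain u where "u \<in> verts X" "y = vdegree ?H (f u)" using y unfolding map_graph(1) by auto
      then show ?thesis using d deg by simp
    qed
    show "r \<in> vdegree ?H ` verts ?H"
      unfolding map_graph(1) using v d[OF v(1)] by (intro image_eqI[of _ _ "f v"]) simp_all
  qed
  ultimately show ?thesis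
    using H size unfolding irregular_class_def graph_order_map_graph[OF X inj] graph_size_map_graph[OF X inj]
    by simp
qed

text \<open>\<open>LEAST\<close> on the reals obeys the expected bound only if the minimum exists.
  It does, since the values not exceeding that of \<open>H\<close> come from graphs of bounded order
  and are finite in number.\<close>

lemma Least_lambda_le:
  fixes P :: "nat ugraph \<Rightarrow> bool"
  assumes H: "irregular_class r t H" "P H" "graph_lambda 1 H < real r"
  shows "(LEAST x. \<exists>H. irregular_class r t H \<and> P H \<and> x = graph_lambda 1 H) \<le> graph_lambda 1 H"
proof -
  let ?Q = "\<lambda>x. \<exists>H. irregular_class r t H \<and> P H \<and> x = graph_lambda 1 H"
  let ?x = "graph_lambda 1 H"
  \<comment> \<open>From \<open>r * n - t \<le> 2 * e \<le> ?x * n\<close> for order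
    \<open>n\<close> and size \<open>e\<close>; the second inequality is the average degree bound,
    and \<open>?x < r\<close> permits the division.\<close>
  define N where "N = nat \<lceil>real_of_int t / (real r - ?x)\<rceil>"
  have bound: "graph_order K \<le> N" "finite (verts K)" if K: "irregular_class r t K" "graph_lambda 1 K \<le> ?x" for K
  proof -
    have sK: "simple_graph K" and cK: "connected_graph K"
      and e: "2 * int (graph_size K) \<ge> int r * int (graph_order K) - t"
      using K(1) unfolding irregular_class_def by auto
    have ne: "verts K \<noteq> {}" using cK unfolding connected_graph_def by simp
    show fin: "finite (verts K)" using sK unfolding simple_graph_def by simp
    then have n: "real (graph_order K) > 0" using ne unfolding graph_order_def by auto
    have "2 * real (graph_size K) / real (graph_order K) \<le> ?x"
      using graph_lambda_1_ge_average_degree[OF sK ne] K(2) by simp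
    then have "2 * real (graph_size K) \<le> ?x * real (graph_order K)"
      using n by (simp add: pos_divide_le_eq)
    moreover have "real r * real (graph_order K) - real_of_int t \<le> 2 * real (graph_size K)"
    proof -
      have "real_of_int (int r * int (graph_order K) - t) \<le> real_of_int (2 * int (graph_size K))"
        using e by (simp only: of_int_le_iff)
      then show ?thesis by simp
    qed
    ultimately have "real (graph_order K) * (real r - ?x) \<le> real_of_int t" by (simp add: algebra_simps)
    then have "real (graph_order K) \<le> real_of_int t / (real r - ?x)" using H(3) by (simp add: pos_le_divide_eq)
    then show "graph_order K \<le> N" unfolding N_def by linarith
  qed
  define F where "F = {y. ?Q y \<and> y \<le> ?x}"
  have F: "y \<in> F \<longleftrightarrow> ?Q y \<and> y \<le> ?x" for y unfolding F_def by simp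
  let ?L = "\<lambda>n. {graph_lambda 1 H | H :: nat ugraph. finite (verts H) \<and> graph_order H = n}"
  have "F \<subseteq> (\<Union>n\<in>{..N}. ?L n)"
  proof
    fix y assume "y \<in> F"
    then obtain K where K: "irregular_class r t K" "y = graph_lambda 1 K" "graph_lambda 1 K \<le> ?x"
      unfolding F by blast
    have "graph_order K \<in> {..N}" using bound(1)[OF K(1,3)] by simp
    moreover have "y \<in> ?L (graph_order K)"
      unfolding mem_Collect_eq using K(2) bound(2)[OF K(1,3)] by blast
    ultimately show "y \<in> (\<Union>n\<in>{..N}. ?L n)" by (rule UN_I)
  qed
  then have fin: "finite F"
    by (rule finite_subset) (intro finite_UN_I finite_atMost finite_graph_lambda_of_order)
  have xF: "?x \<in> F" unfolding F using H(1,2) by blast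
  then have m: "Min F \<in> F" "\<And>y. y \<in> F \<Longrightarrow> Min F \<le> y" using fin by (auto intro!: Min_in)
  have "(LEAST x. ?Q x) = Min F"
  proof (rule Least_equality)
    show "?Q (Min F)" using m(1) unfolding F by (rule conjunct1)
    fix y assume y: "?Q y"
    show "Min F \<le> y"
    proof (cases "y \<le> ?x")
      case True then show ?thesis using m(2)[of y] y unfolding F by simp
    next
      case False then show ?thesis using m(2)[OF xF] by linarith
    qed
  qed
  then show ?thesis using m(2)[OF xF] by simp
qed

subsection \<open>The three components\<close>

definition mate :: "nat \<Rightarrow> nat" where
  "mate v = (if even v then v + 1 else v - 1)"

text \<open>Order \<open>r + 1\<close> is the least that allows degree \<open>r\<close>, and its
  parity is the one \<open>rho1\<close> asks for. Removing \<open>j\<close> disjoint edges costs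
  \<open>2 * j\<close> in the degree sum, so \<open>j\<close> is tuned to the slack
  \<open>t\<close>.\<close>

definition complete_minus_matching :: "nat \<Rightarrow> nat \<Rightarrow> nat ugraph" where
  "complete_minus_matching r j = ({..r}, {e. e \<subseteq> {..r} \<and> card e = 2 \<and> (\<forall>i<j. e \<noteq> {2 * i, 2 * i + 1})})"

lemma complete_minus_matching_edge:
  "{u, v} \<in> edges (complete_minus_matching r j) \<longleftrightarrow>
    u \<le> r \<and> v \<le> r \<and> u \<noteq> v \<and> \<not> (u < 2 * j \<and> v = mate u)"
proof -
  have "(\<exists>i<j. {u, v} = {2 * i, 2 * i + 1}) \<longleftrightarrow> u < 2 * j \<and> v = mate u"
  proof
    assume "\<exists>i<j. {u, v} = {2 * i, 2 * i + 1}"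
    then show "u < 2 * j \<and> v = mate u" unfolding mate_def by (auto simp: doubleton_eq_iff)
  next
    assume uv: "u < 2 * j \<and> v = mate u"
    show "\<exists>i<j. {u, v} = {2 * i, 2 * i + 1}"
      by (rule exI[of _ "u div 2"])
        (use uv in \<open>auto simp: mate_def doubleton_eq_iff elim!: evenE oddE\<close>)
  qed
  then show ?thesis unfolding complete_minus_matching_def by (auto simp: card_2_iff)
qed

lemma mate: "2 * j \<le> r \<Longrightarrow> v < 2 * j \<Longrightarrow> mate v < 2 * j" "mate v \<noteq> v" for j r v :: nat
  unfolding mate_def by (auto elim!: evenE oddE)

context
  fixes r j :: nat
  assumes j: "1 \<le> j" "2 * j + 1 \<le> r"
begin

abbreviation K_minus where "K_minus \<equiv> complete_minus_matching r j"

lemma verts_K: "verts K_minus = {..r}" unfolding complete_minus_matching_def by simp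

lemma simple_K: "simple_graph K_minus"
  unfolding simple_graph_def complete_minus_matching_def by simp

lemma order_K: "graph_order K_minus = r + 1"
  unfolding graph_order_def verts_K by simp

lemma nbrs_K:
  assumes "v \<le> r"
  shows "nbrs K_minus v = (if v < 2 * j then {..r} - {v, mate v} else {..r} - {v})"
  using assms unfolding nbrs_def complete_minus_matching_edge by auto

lemma card_nbrs_K:
  assumes "v \<le> r"
  shows "card (nbrs K_minus v) = (if v < 2 * j then r - 1 else r)"
proof -
  have "mate v \<le> r" if "v < 2 * j" using mate(1)[of j r v] that j by simp
  then show ?thesis using nbrs_K[OF assms] assms mate(2)[of v] by (auto simp: card_Diff_subset)
qed

lemma sum_K: "(\<Sum>v\<le>r. if v < 2 * j then a else b) = of_nat (2 * j) * a + of_nat (r + 1 - 2 * j) * b"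
  for a b :: "'b::comm_semiring_1"
proof -
  have "{..r} \<inter> {v. v < 2 * j} = {..<2 * j}" "{..r} \<inter> - {v. v < 2 * j} = {2 * j..r}" using j by auto
  then show ?thesis by (simp add: sum.If_cases)
qed

lemma irregular_class_K:
  assumes "2 * int j \<le> t"
  shows "irregular_class r t K_minus"
proof -
  have "map_graph id K_minus = K_minus" unfolding map_graph_def by simp
  moreover have "irregular_class r t (map_graph id K_minus)"
  proof (rule irregular_class_mapI[OF simple_K, of _ r r 0])
    fix Z assume Z: "Z \<subseteq> verts K_minus" "Z \<noteq> {}" "\<forall>u\<in>Z. \<forall>v\<in>verts K_minus. {u, v} \<in> edges K_minus \<longrightarrow> v \<in> Z"
    obtain u where u: "u \<in> Z" using Z(2) by auto
    have ur: "u \<le> r" using u Z(1) unfolding verts_K by auto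
    have "mate u \<noteq> r" if "u < 2 * j" using mate(1)[of j r u] that j by simp
    then have rZ: "r \<in> Z"
      using Z(3) u ur unfolding verts_K complete_minus_matching_edge by (cases "u = r") auto
    have "v \<in> Z" if "v \<le> r" for v
      using Z(3) rZ that j unfolding verts_K complete_minus_matching_edge by (cases "v = r") auto
    then show "Z = verts K_minus" using Z(1) unfolding verts_K by auto
  next
    have "2 * graph_size K_minus = (\<Sum>v\<le>r. if v < 2 * j then r - 1 else r)"
      using sum_card_nbrs[OF simple_K] card_nbrs_K unfolding verts_K by simp
    also have "\<dots> = 2 * j * (r - 1) + (r + 1 - 2 * j) * r" unfolding sum_K by simp
    finally have "2 * int (graph_size K_minus) = int (2 * j * (r - 1) + (r + 1 - 2 * j) * r)" by linarith
    also have "\<dots> = 2 * int j * (int r - 1) + (int r + 1 - 2 * int j) * int r"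
      using j by (simp add: of_nat_diff)
    also have "\<dots> = int r * (int r + 1) - 2 * int j" by (simp add: algebra_simps)
    finally show "int r * int (graph_order K_minus) - t \<le> 2 * int (graph_size K_minus)"
      unfolding order_K using assms by (simp add: algebra_simps)
  qed (use j in \<open>auto simp: verts_K card_nbrs_K\<close>)
  ultimately show ?thesis by simp
qed

text \<open>On the complete graph minus a matching an eigenfunction to \<open>\<lambda>\<close> is proportional to \<open>\<lambda> + 1\<close> on
  the matched vertices and to \<open>\<lambda> + 2\<close> on the others, hence the test function.\<close>

lemma lambda_K: "graph_lambda 1 K_minus \<le> real r - (2 * real j - 1) / (real r + 2)"
proof -
  \<comment> \<open>For matched and unmatched vertices alike the test inequality says that the total
    of \<open>z\<close> is at most \<open>(L + 1) * (L + 2)\<close>, that is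
    \<open>q * (r + 2) - q * q \<le> 2 * j\<close>. The numerator \<open>2 * j - 1\<close> satisfies
    this with room to spare and is the bound for the boundaries in
    \<open>rho1_le_lambda_Y\<close>.\<close>
  define q where "q = (2 * real j - 1) / (real r + 2)"
  define L where "L = real r - q"
  define z where "z v = (if v < 2 * j then L + 1 else L + 2)" for v :: nat
  have qr: "q * (real r + 2) = 2 * real j - 1" unfolding q_def by simp
  have q1: "q < 1" unfolding q_def using j by (simp add: divide_less_eq)
  have L0: "L > 0" using q1 j unfolding L_def by linarith
  have "(\<Sum>v\<le>r. z v) = 2 * real j * (L + 1) + (real r + 1 - 2 * real j) * (L + 2)"
    unfolding z_def sum_K using j by (simp add: of_nat_diff)
  also have "\<dots> = (real r + 1) * (L + 2) - 2 * real j" by (simp add: algebra_simps)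
  also have "\<dots> = (L + 1) * (L + 2) + q * (L + 2) - 2 * real j"
    unfolding L_def by (simp add: algebra_simps)
  also have "q * (L + 2) = 2 * real j - 1 - q * q"
    using qr unfolding L_def by (simp add: algebra_simps)
  finally have tot: "(\<Sum>v\<le>r. z v) \<le> (L + 1) * (L + 2)" using zero_le_square[of q] by linarith
  have "graph_lambda 1 K_minus \<le> L"
  proof (rule graph_lambda_1_le_if_test_function[OF simple_K])
    show "verts K_minus \<noteq> {}" unfolding verts_K by simp
    show "z v > 0" for v using L0 unfolding z_def by simp
    fix v assume "v \<in> verts K_minus"
    then have v: "v \<le> r" unfolding verts_K by simp
    show "(\<Sum>u\<in>nbrs K_minus v. z u) \<le> L * z v"
    proof (cases "v < 2 * j")
      case True
      have m: "mate v < 2 * j" "mate v \<noteq> v" using mate(1)[of j r v] mate(2)[of v] True j by auto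
      then have "(\<Sum>u\<in>nbrs K_minus v. z u) = (\<Sum>v\<le>r. z v) - (\<Sum>u\<in>{v, mate v}. z u)"
        unfolding nbrs_K[OF v] using True v j by (simp only: if_True, intro sum_diff) auto
      also have "(\<Sum>u\<in>{v, mate v}. z u) = 2 * (L + 1)" using m True unfolding z_def by simp
      finally show ?thesis using tot True unfolding z_def by (simp add: algebra_simps)
    next
      case False
      have "(\<Sum>u\<in>nbrs K_minus v. z u) = (\<Sum>v\<le>r. z v) - z v"
        unfolding nbrs_K[OF v] using False v by (simp add: sum_diff1)
      then show ?thesis using tot False unfolding z_def by (simp add: algebra_simps)
    qed
  qed
  then show ?thesis unfolding L_def q_def .
qed

end

lemma rho1_le_complete_minus_matching:
  assumes r: "odd r" and j: "1 \<le> j" "2 * j + 1 \<le> r" and t: "2 * int j \<le> t"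
  shows "rho1 r t \<le> real r - (2 * real j - 1) / (real r + 2)"
proof -
  let ?K_minus = "complete_minus_matching r j"
  have le: "graph_lambda 1 ?K_minus \<le> real r - (2 * real j - 1) / (real r + 2)"
    by (rule lambda_K[OF j])
  have "(2 * real j - 1) / (real r + 2) > 0" using j by simp
  then have lt: "graph_lambda 1 ?K_minus < real r" using le by linarith
  have "rho1 r t \<le> graph_lambda 1 ?K_minus"
    unfolding rho1_def
  proof (rule Least_lambda_le[where P = "\<lambda>H. graph_order H mod 2 \<noteq> r mod 2", OF _ _ lt])
    show "irregular_class r t ?K_minus" by (rule irregular_class_K[OF j t])
    show "graph_order ?K_minus mod 2 \<noteq> r mod 2" unfolding order_K[OF j] using r by presburger
  qed
  then show ?thesis using le by linarith
qed

section \<open>Subgraphs induced by thin sets\<close>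

context
  fixes X :: "'a ugraph" and r l :: nat and U :: "'a set"
  assumes X: "simple_graph X" and reg: "regular_graph r X" and r: "odd r" and l: "0 < l"
    and U: "thin X r l U"
begin

abbreviation boundary where "boundary \<equiv> card (pairs X U (verts X - U))"
abbreviation X_U where "X_U \<equiv> induced X U"

lemma U_props: "U \<subseteq> verts X" "U \<noteq> {}" "finite U" "odd boundary" "boundary < r" "l * boundary < r"
proof -
  show sub: "U \<subseteq> verts X" "U \<noteq> {}" and ob: "odd boundary" and lt: "l * boundary < r"
    using U unfolding thin_def by simp_all
  show "finite U" using rev_finite_subset sub(1) X unfolding simple_graph_def by auto
  have "boundary \<le> l * boundary" using l by simp
  then show "boundary < r" using lt by linarith
qed

lemma simple_Y: "simple_graph X_U"
  by (rule simple_graph_induced[OF X U_props(1)])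

lemma degree_Y:
  assumes v: "v \<in> U"
  shows "card (nbrs X_U v) + card (nbrs X v - U) = r"
proof -
  have "card (nbrs X v) = r"
    using card_nbrs[OF X] reg v U_props(1) unfolding regular_graph_def by auto
  moreover have "card (nbrs X v) = card (nbrs X v \<inter> U) + card (nbrs X v - U)"
    using finite_nbrs[OF X] by (metis Int_Diff_Un Int_Diff_disjoint card_Un_disjoint finite_Diff finite_Int)
  ultimately show ?thesis unfolding nbrs_induced[OF v] by simp
qed

lemma sum_out: "(\<Sum>v\<in>U. card (nbrs X v - U)) = boundary"
proof -
  have "pairs X U (verts X - U) = Sigma U (\<lambda>v. nbrs X v - U)"
    using nbrs_subset[OF X] unfolding pairs_def nbrs_def by auto
  then show ?thesis using U_props(3) finite_nbrs[OF X] by simp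
qed

lemma size_Y: "2 * graph_size X_U + boundary = r * card U"
proof -
  have "2 * graph_size X_U + boundary = (\<Sum>v\<in>U. card (nbrs X_U v) + card (nbrs X v - U))"
    using sum_card_nbrs[OF simple_Y] sum_out unfolding induced(1) by (simp add: sum.distrib)
  also have "\<dots> = (\<Sum>v\<in>U. r)" using degree_Y by (intro sum.cong) auto
  finally show ?thesis by simp
qed

lemma odd_card_U: "odd (card U)"
proof
  assume "even (card U)"
  then have "even (r * card U)" by simp
  then show False using size_Y U_props(4) by (metis dvd_triv_left even_add)
qed

text \<open>With at most \<open>r\<close> vertices, each would send at least
  \<open>r + 1 - card U\<close> edges out, at least \<open>r\<close> in total, against
  \<open>boundary < r\<close>. Order \<open>r + 1\<close> is even and thus excluded by
  \<open>odd_card_U\<close>.\<close>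

lemma card_U: "r + 2 \<le> card U"
proof -
  have "card (nbrs X_U v) \<le> card U - 1" if "v \<in> U" for v
  proof -
    have "nbrs X_U v \<subseteq> U - {v}"
      using nbrs_subset[OF simple_Y, of v] edge_verts(3)[OF simple_Y, of v v] unfolding induced(1) nbrs_def by auto
    then have "card (nbrs X_U v) \<le> card (U - {v})" using U_props(3) by (intro card_mono) auto
    then show ?thesis using that U_props(3) by simp
  qed
  then have "2 * graph_size X_U \<le> card U * (card U - 1)"
    using sum_bounded_above[of U "\<lambda>v. card (nbrs X_U v)" "card U - 1"] sum_card_nbrs[OF simple_Y]
    unfolding induced(1) by simp
  then have le: "r * card U \<le> card U * (card U - 1) + boundary" using size_Y by linarith
  have "\<not> card U \<le> r"
  proof
    assume "card U \<le> r"
    obtain d where d: "r = card U + d" using \<open>card U \<le> r\<close> le_Suc_ex by blast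
    obtain c where c: "card U = Suc c" using U_props(2,3) by (cases "card U") auto
    \<comment> \<open>The edge count gives \<open>boundary \<ge> (c + 1) * (d + 1)\<close>, which is
      at least \<open>c + 1 + d = r\<close>.\<close>
    have "r \<le> boundary" using le unfolding d c by (simp add: algebra_simps)
    then show False using U_props(5) by simp
  qed
  moreover have "card U \<noteq> r + 1" using odd_card_U r by auto
  ultimately show ?thesis by linarith
qed

text \<open>There are fewer boundary edges than vertices. Such a vertex makes the maximum degree
  exactly \<open>r\<close>, as the class requires.\<close>

lemma full_vertex: obtains v where "v \<in> U" "card (nbrs X_U v) = r"
proof -
  have "\<exists>v\<in>U. card (nbrs X v - U) = 0"
  proof (rule ccontr)
    assume "\<not> ?thesis"
    then have "1 \<le> card (nbrs X v - U)" if "v \<in> U" for v using that by (metis One_nat_def Suc_leI gr0I)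
    then have "(\<Sum>v\<in>U. 1) \<le> boundary" unfolding sum_out[symmetric] by (rule sum_mono)
    then show False using card_U U_props(5) by simp
  qed
  then show thesis using degree_Y that by force
qed

lemma deficient_vertex: obtains w where "w \<in> U" "card (nbrs X_U w) < r"
proof -
  have "\<exists>v\<in>U. card (nbrs X v - U) \<noteq> 0"
  proof (rule ccontr)
    assume "\<not> ?thesis"
    then have "boundary = 0" unfolding sum_out[symmetric] by simp
    then show False using U_props(4) by simp
  qed
  then show thesis using degree_Y that by force
qed

lemma Y_connected:
  "Z \<subseteq> verts X_U \<Longrightarrow> Z \<noteq> {} \<Longrightarrow> \<forall>u\<in>Z. \<forall>v\<in>verts X_U. {u, v} \<in> edges X_U \<longrightarrow> v \<in> Z \<Longrightarrow> Z = verts X_U"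
proof -
  assume Z: "Z \<subseteq> verts X_U" "Z \<noteq> {}" "\<forall>u\<in>Z. \<forall>v\<in>verts X_U. {u, v} \<in> edges X_U \<longrightarrow> v \<in> Z"
  have "\<forall>u\<in>Z. \<forall>v\<in>U. {u, v} \<in> edges X \<longrightarrow> v \<in> Z"
  proof (intro ballI impI)
    fix u v assume uv: "u \<in> Z" "v \<in> U" "{u, v} \<in> edges X"
    then have "u \<in> U" using Z(1) unfolding induced(1) by auto
    then have "{u, v} \<in> edges X_U" using uv induced_edge[of u U v X] by simp
    then show "v \<in> Z" using Z(3) uv unfolding induced(1) by simp
  qed
  then show "Z = verts X_U" using U Z(1,2) unfolding thin_def induced(1) by simp
qed

lemma lambda_Y_less: "graph_lambda 1 X_U < real r"
proof -
  obtain w where w: "w \<in> verts X_U" "card (nbrs X_U w) < r"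
    using deficient_vertex unfolding induced(1) by auto
  show ?thesis
  proof (rule graph_lambda_1_less_if_irregular[OF simple_Y _ Y_connected _ w])
    show "card (nbrs X_U v) \<le> r" if "v \<in> verts X_U" for v
      using degree_Y[of v] that unfolding induced(1) by simp
  qed (use U_props(2) in \<open>simp_all add: induced(1)\<close>)
qed

lemma lambda_Y_ge: "real r - real boundary / real (card U) \<le> graph_lambda 1 X_U"
proof -
  have c: "real (card U) > 0" using card_U by simp
  have "2 * real (graph_size X_U) + real boundary = real r * real (card U)"
    using arg_cong[OF size_Y, of real] by simp
  then have "real r - real boundary / real (card U) = 2 * real (graph_size X_U) / real (card U)"
    using c by (simp add: field_simps)
  moreover have "graph_order X_U = card U" unfolding graph_order_def induced(1) ..
  ultimately show ?thesis using graph_lambda_1_ge_average_degree[OF simple_Y] U_props(2) unfolding induced(1) by simp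
qed

lemma rho2_le_lambda_Y:
  assumes "int boundary \<le> t"
  shows "rho2 r t \<le> graph_lambda 1 X_U"
proof -
  obtain f :: "'a \<Rightarrow> nat" where f: "inj_on f U" using finite_imp_inj_to_nat_seg[OF U_props(3)] by auto
  let ?H = "map_graph f X_U"
  have f': "inj_on f (verts X_U)" using f unfolding induced(1) .
  obtain v where v: "v \<in> verts X_U" "card (nbrs X_U v) = r" using full_vertex unfolding induced(1) by auto
  obtain w where w: "w \<in> verts X_U" "card (nbrs X_U w) < r" using deficient_vertex unfolding induced(1) by auto
  have ord: "graph_order X_U = card U" unfolding graph_order_def induced(1) ..
  have cls: "irregular_class r t ?H"
  proof (rule irregular_class_mapI[OF simple_Y f' Y_connected _ v w])
    show "card (nbrs X_U v) \<le> r" if "v \<in> verts X_U" for v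
      using degree_Y[of v] that unfolding induced(1) by simp
    have "2 * int (graph_size X_U) + int boundary = int r * int (card U)"
      using arg_cong[OF size_Y, of int] by simp
    then show "int r * int (graph_order X_U) - t \<le> 2 * int (graph_size X_U)" using assms unfolding ord by linarith
  qed
  have lam: "graph_lambda 1 ?H = graph_lambda 1 X_U" by (rule graph_lambda_map_graph[OF simple_Y f'])
  have par: "graph_order ?H mod 2 = r mod 2"
    unfolding graph_order_map_graph[OF simple_Y f'] ord using odd_card_U r by presburger
  show ?thesis
    unfolding rho2_def lam[symmetric]
    by (rule Least_lambda_le[where P = "\<lambda>H. graph_order H mod 2 = r mod 2", OF cls par])
      (use lambda_Y_less lam in simp)
qed

lemma rho1_le_lambda_Y:
  assumes m: "odd m" "int boundary < m"
  shows "rho1 r (m - 1) \<le> graph_lambda 1 X_U"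
proof -
  \<comment> \<open>\<open>boundary\<close>, \<open>m\<close> and \<open>r\<close> are all odd, so
    each strict inequality has a gap of at least two.\<close>
  have "int boundary \<le> min m (int r) - 2"
  proof -
    have "odd (int boundary)" "odd (int r)" using U_props(4) r by simp_all
    moreover have "even (m - 1)" "even (int r - 1)" using m(1) r by simp_all
    ultimately have "int boundary \<noteq> m - 1" "int boundary \<noteq> int r - 1" by metis+
    then show ?thesis using m(2) U_props(5) by linarith
  qed
  \<comment> \<open>\<open>m\<close> limits the deficiency \<open>2 * j\<close> to
    \<open>m - 1\<close>, and \<open>r\<close> keeps the matching within
    \<open>complete_minus_matching\<close> with a vertex of full degree left over.\<close>
  moreover obtain j where j: "min m (int r) = 2 * int j + 1"
  proof -
    have "odd (min m (int r))" using m(1) r by (simp add: min_def)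
    then obtain i where i: "min m (int r) = 2 * i + 1" by (rule oddE)
    moreover have "i \<ge> 0" using i m(2) by linarith
    ultimately show thesis using that[of "nat i"] by simp
  qed
  ultimately have bj: "int boundary \<le> 2 * int j - 1" by linarith
  have boundary_pos: "boundary \<ge> 1" using U_props(4) odd_pos by fastforce
  have "1 \<le> j" "2 * j + 1 \<le> r" "2 * int j \<le> m - 1" using j bj boundary_pos by linarith+
  then have "rho1 r (m - 1) \<le> real r - (2 * real j - 1) / (real r + 2)"
    by (intro rho1_le_complete_minus_matching[OF r])
  \<comment> \<open>Here the order bound \<open>r + 2\<close> is decisive: the component spreads a
    deficiency of at most \<open>2 * j - 1\<close> over at least \<open>r + 2\<close>
    vertices.\<close>
  moreover have "real boundary / real (card U) \<le> (2 * real j - 1) / (real r + 2)"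
    using bj card_U by (intro frac_le) linarith+
  ultimately show ?thesis using lambda_Y_ge by linarith
qed

end

lemma factor_complement:
  assumes X: "simple_graph X" and reg: "regular_graph r X" and k: "k \<le> r"
    and F: "is_factor (r - k) X F"
  shows "\<exists>F'. is_factor k X F'"
proof -
  let ?F' = "(verts X, edges X - edges F)"
  have F': "simple_graph F" "verts F = verts X" "edges F \<subseteq> edges X" "regular_graph (r - k) F"
    using F unfolding is_factor_def by auto
  have "vdegree ?F' v = k" if v: "v \<in> verts X" for v
  proof -
    have "{e \<in> edges ?F'. v \<in> e} = {e \<in> edges X. v \<in> e} - {e \<in> edges F. v \<in> e}" by auto
    then have "vdegree ?F' v = vdegree X v - vdegree F v"
      unfolding vdegree_def using finite_edges[OF F'(1)] F'(3) by (simp add: card_Diff_subset subset_iff Collect_mono)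
    also have "\<dots> = r - (r - k)" using reg F'(2,4) v unfolding regular_graph_def by simp
    finally show ?thesis using k by simp
  qed
  then have "is_factor k X ?F'" using X unfolding is_factor_def regular_graph_def simple_graph_def by simp
  then show ?thesis by blast
qed

lemma factor_even:
  fixes m mstar :: int
  assumes m: "m \<ge> 0" "mstar \<in> {m, m + 1}" "mstar mod 2 = 1"
    and X: "simple_graph X" and reg: "regular_graph r X"
    and lam: "graph_lambda 3 X < (if odd m then rho1 r (m - 1) else rho2 r (m - 1))"
    and r: "odd r" and k: "even k" "k \<le> r" "real k \<le> real r * (1 - 1 / real_of_int mstar)"
  shows "\<exists>F. is_factor k X F"
proof (rule ccontr)
  assume no: "\<not> ?thesis"
  have kr: "k < r" using k r by (metis le_neq_implies_less)
  have "mstar \<ge> 0" "mstar \<noteq> 0" using m by auto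
  then have ms: "mstar > 0" by linarith
  \<comment> \<open>The hypothesis on \<open>k\<close> cleared of denominators; combined with
    \<open>(r - k) * ?b < r\<close> it yields \<open>?b < mstar\<close>.\<close>
  have rl: "int r \<le> int (r - k) * mstar"
  proof -
    have "real r * (1 - 1 / real_of_int mstar) = real r - real r / real_of_int mstar" by (simp add: algebra_simps)
    then have "real r / real_of_int mstar \<le> real (r - k)" using k kr by (simp add: of_nat_diff)
    then have "real r \<le> real (r - k) * real_of_int mstar" using ms by (simp add: pos_divide_le_eq)
    then have "real_of_int (int r) \<le> real_of_int (int (r - k) * mstar)" by simp
    then show ?thesis by (simp only: of_int_le_iff)
  qed
  have ge: "(if odd m then rho1 r (m - 1) else rho2 r (m - 1)) \<le> graph_lambda 1 (induced X U)"
    if U: "thin X r (r - k) U" for U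
  proof -
    let ?b = "card (pairs X U (verts X - U))"
    have l: "0 < r - k" using kr by simp
    note th = X reg r l U
    have "int (r - k) * int ?b < int (r - k) * mstar"
    proof -
      have "int ((r - k) * ?b) < int r" using U_props(6)[OF th] by (simp only: of_nat_less_iff)
      then show ?thesis using rl unfolding of_nat_mult by linarith
    qed
    then have bm: "int ?b < mstar" using l by simp
    show ?thesis
    proof (cases "odd m")
      case True
      then have "mstar = m" using m by auto
      then show ?thesis using rho1_le_lambda_Y[OF th True] bm True by simp
    next
      case False
      then have "mstar = m + 1" using m by auto
      \<comment> \<open>For even \<open>m\<close> only \<open>?b < m + 1\<close> is known; oddness
        of the boundary improves it to \<open>?b \<le> m - 1\<close>, the slack of
        \<open>rho2\<close>.\<close>
      moreover have "int ?b \<noteq> m" using False U_props(4)[OF th] by auto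
      ultimately show ?thesis using rho2_le_lambda_Y[OF th, of "m - 1"] bm False by simp
    qed
  qed
  obtain A B C where ABC: "thin X r (r - k) A" "thin X r (r - k) B" "thin X r (r - k) C"
    and sep: "separated X A B" "separated X A C" "separated X B C"
    using three_thin_sets_if_no_factor[OF X reg k(1) kr no] by metis
  have "(if odd m then rho1 r (m - 1) else rho2 r (m - 1)) \<le> graph_lambda 3 X"
    by (rule graph_lambda_3_ge_induced[OF X _ _ _ _ _ _ sep ge[OF ABC(1)] ge[OF ABC(2)] ge[OF ABC(3)]])
      (use ABC in \<open>simp_all add: thin_def\<close>)
  then show False using lam by linarith
qed

theorem theorem3p3:
  fixes G :: "'a ugraph" and r k n :: nat and m mstar :: int
  assumes "k \<le> r" and "m \<ge> 0"
    and "mstar \<in> {m, m + 1}" and "mstar mod 2 = 1"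
    and "simple_graph G" and "connected_graph G" and "regular_graph r G" and "graph_order G = n"
    and "graph_lambda 3 G < (if odd m then rho1 r (m - 1) else rho2 r (m - 1))"
    and "(odd r \<and> even k \<and> real k \<le> real r * (1 - 1 / real_of_int mstar)) \<or>
         (odd r \<and> odd k \<and> real r / real_of_int mstar \<le> real k)"
  shows "\<exists>F. is_factor k G F"
  using assms(10)
proof
  assume "odd r \<and> even k \<and> real k \<le> real r * (1 - 1 / real_of_int mstar)"
  then show ?thesis using factor_even[OF assms(2-5,7,9)] assms(1) by simp
next
  assume *: "odd r \<and> odd k \<and> real r / real_of_int mstar \<le> real k"
  \<comment> \<open>The lower bound on \<open>k\<close> is exactly the upper bound of the even case
    for \<open>r - k\<close>, which is even as both are odd.\<close>
  have "real r * (1 - 1 / real_of_int mstar) = real r - real r / real_of_int mstar" by (simp add: algebra_simps)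
  then have "real (r - k) \<le> real r * (1 - 1 / real_of_int mstar)" using * assms(1) by (simp add: of_nat_diff)
  moreover have "even (r - k)" using * assms(1) by simp
  ultimately have "\<exists>F. is_factor (r - k) G F" using factor_even[OF assms(2-5,7,9)] * by simp
  then obtain F where "is_factor (r - k) G F" ..
  then show ?thesis by (rule factor_complement[OF assms(5,7,1)])
qed

end
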